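(* Let $\Omega$ be a Riemannian manifold and let $0\le h<\infty$. Let $M_i$ ($i=1,2,3,\dots$) be a sequence of $m$-dimensional varieties (or, more generally, varifolds) in $\Omega$ with mean curvature bounded by $h$ or, more generally, such that $$\limsup_{i\to\infty}\int_{M_i\cap K}(|H|-h)^+\,dA<\infty$$ for every compact $K\subset\Omega$. Suppose also that $\limsup_{i\to\infty}|\partial M_i|(K)<\infty$ for every compact $K\subset\Omega$. Let $$Z=\{x\in\Omega:\ \limsup_i |M_i|(\mathbf{B}(x,r))=\infty\ \text{for every } r>0\}.$$ If $f:\Omega\to\mathbf{R}$ is a $C^2$ function and if $f|Z$ has a local maximum at $p\in Z$, then $$\operatorname{Trace}_m(\mathrm{D}^2f(p))\le h\,|\mathrm{D}f(p)|.$$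
   Context: $\mathbf{B}(x,r)$ is the ball of radius $r$ about $x$. $t^+=\max\{t,0\}$. A variety here is a properly embedded $m$-dimensional submanifold-with-boundary $M$ of $\Omega$; $|M|(U)$ is the $m$-dimensional area of $M\cap U$, $|\partial M|(U)$ is the $(m-1)$-dimensional area of $(\partial M)\cap U$, $H$ is its mean curvature vector and $dA$ is area measure. More generally $M$ may be an $m$-dimensional varifold of locally bounded first variation; then $|M|$ is its mass (weight) measure, $H$ is its generalized mean curvature (so the part of the first variation $\delta M$ absolutely continuous with respect to $|M|$ is $-H\,|M|$), $|\partial M|$ is its generalized boundary measure, i.e. the part of the total variation measure of $\delta M$ singular with respect to $|M|$, and $\int_{M\cap K}\cdot\,dA$ means $\int_K\cdot\,d|M|$. For a $C^2$ function $f$, $\mathrm{D}^2f$ is the Hessian of $f$ with respect to the Riemannian metric, $|\mathrm{D}f|$ is the norm of the derivative, and $\operatorname{Trace}_m(\mathrm{D}^2f(p))$ is the sum of the $m$ lowest eigenvalues (counted with multiplicity, with respect to the metric) of the Hessian of $f$ at $p$. *)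

theory Defs
  imports "HOL-Analysis.Analysis"
begin

section \<open>Functions of class C^k on open subsets of a Euclidean space\<close>

primrec Ck_on :: "nat \<Rightarrow> ('e::euclidean_space \<Rightarrow> 'b::real_normed_vector) \<Rightarrow> 'e set \<Rightarrow> bool" where
  "Ck_on 0 F S \<longleftrightarrow> continuous_on S F"
| "Ck_on (Suc k) F S \<longleftrightarrow> (\<forall>x\<in>S. F differentiable (at x)) \<and>
     (\<forall>v. Ck_on k (\<lambda>x. frechet_derivative F (at x) v) S)"

definition smooth_on :: "('e::euclidean_space \<Rightarrow> 'b::real_normed_vector) \<Rightarrow> 'e set \<Rightarrow> bool" where
  "smooth_on F S \<longleftrightarrow> (\<forall>k. Ck_on k F S)"

section \<open>Riemannian manifolds\<close>

text \<open>
  The manifold is a whole Hausdorff, second countable type \<open>'a\<close>; the model space is \<open>'e\<close>.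
  Every point \<open>x\<close> has a preferred chart \<open>chart_at \<Omega> x\<close> of the atlas, and the tangent space at \<open>x\<close>
  is \<open>'e\<close>: the vector \<open>v :: 'e\<close> stands for the tangent vector at \<open>x\<close> whose coordinates in the
  preferred chart at \<open>x\<close> are \<open>v\<close>.  Since the preferred chart may jump from point to point, regularity
  of tensor fields is always expressed through their coordinates in the charts of the atlas.
\<close>

record ('a, 'e) chart =
  cdom :: "'a set"
  cmap :: "'a \<Rightarrow> 'e"

record ('a, 'e) riemannian_structure =
  atlas :: "('a, 'e) chart set"
  chart_at :: "'a \<Rightarrow> ('a, 'e) chart"
  metric_at :: "'a \<Rightarrow> 'e \<Rightarrow> 'e \<Rightarrow> real"

definition cinv :: "('a, 'e) chart \<Rightarrow> 'e \<Rightarrow> 'a" where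
  "cinv c = inv_into (cdom c) (cmap c)"

definition is_chart :: "('a::topological_space, 'e::euclidean_space) chart \<Rightarrow> bool" where
  "is_chart c \<longleftrightarrow> open (cdom c) \<and> open (cmap c ` cdom c) \<and>
     homeomorphism (cdom c) (cmap c ` cdom c) (cmap c) (cinv c)"

text \<open>\<open>coord_change c d x\<close> turns the \<open>c\<close>-coordinates of a tangent vector at \<open>x\<close> into its
  \<open>d\<close>-coordinates.\<close>

definition coord_change ::
    "('a, 'e::euclidean_space) chart \<Rightarrow> ('a, 'e) chart \<Rightarrow> 'a \<Rightarrow> 'e \<Rightarrow> 'e" where
  "coord_change c d x = frechet_derivative (cmap d \<circ> cinv c) (at (cmap c x))"

definition to_chart ::
    "('a, 'e::euclidean_space) riemannian_structure \<Rightarrow> ('a, 'e) chart \<Rightarrow> 'a \<Rightarrow> 'e \<Rightarrow> 'e" where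
  "to_chart \<Omega> c x = coord_change (chart_at \<Omega> x) c x"

definition of_chart ::
    "('a, 'e::euclidean_space) riemannian_structure \<Rightarrow> ('a, 'e) chart \<Rightarrow> 'a \<Rightarrow> 'e \<Rightarrow> 'e" where
  "of_chart \<Omega> c x = coord_change c (chart_at \<Omega> x) x"

definition metric_in ::
    "('a, 'e::euclidean_space) riemannian_structure \<Rightarrow> ('a, 'e) chart \<Rightarrow> 'e \<Rightarrow> 'e \<Rightarrow> 'e \<Rightarrow> real" where
  "metric_in \<Omega> c y a b =
     metric_at \<Omega> (cinv c y) (of_chart \<Omega> c (cinv c y) a) (of_chart \<Omega> c (cinv c y) b)"

definition inner_product_form :: "('e::real_vector \<Rightarrow> 'e \<Rightarrow> real) \<Rightarrow> bool" where
  "inner_product_form G \<longleftrightarrow> (\<forall>v. linear (G v)) \<and> (\<forall>v w. G v w = G w v) \<and> (\<forall>v. v \<noteq> 0 \<longrightarrow> G v v > 0)"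

definition riemannian_manifold ::
    "('a::{t2_space, second_countable_topology}, 'e::euclidean_space) riemannian_structure \<Rightarrow> bool" where
  "riemannian_manifold \<Omega> \<longleftrightarrow>
     (\<forall>c\<in>atlas \<Omega>. is_chart c) \<and>
     (\<forall>c\<in>atlas \<Omega>. \<forall>d\<in>atlas \<Omega>. smooth_on (cmap d \<circ> cinv c) (cmap c ` (cdom c \<inter> cdom d))) \<and>
     (\<forall>x. chart_at \<Omega> x \<in> atlas \<Omega> \<and> x \<in> cdom (chart_at \<Omega> x)) \<and>
     (\<forall>x. inner_product_form (metric_at \<Omega> x)) \<and>
     (\<forall>c\<in>atlas \<Omega>. \<forall>a b. smooth_on (\<lambda>y. metric_in \<Omega> c y a b) (cmap c ` cdom c))"

definition gnorm :: "('a, 'e) riemannian_structure \<Rightarrow> 'a \<Rightarrow> 'e \<Rightarrow> real" where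
  "gnorm \<Omega> x v = sqrt (metric_at \<Omega> x v v)"

section \<open>Riemannian distance\<close>

definition velocity ::
    "('a, 'e::euclidean_space) riemannian_structure \<Rightarrow> (real \<Rightarrow> 'a) \<Rightarrow> real \<Rightarrow> 'e" where
  "velocity \<Omega> \<gamma> t = vector_derivative (cmap (chart_at \<Omega> (\<gamma> t)) \<circ> \<gamma>) (at t)"

definition piecewise_C1_curve ::
    "('a::topological_space, 'e::euclidean_space) riemannian_structure \<Rightarrow> (real \<Rightarrow> 'a) \<Rightarrow> bool" where
  "piecewise_C1_curve \<Omega> \<gamma> \<longleftrightarrow> continuous_on {0..1} \<gamma> \<and>
     (\<exists>S. finite S \<and>
        (\<forall>c\<in>atlas \<Omega>. (cmap c \<circ> \<gamma>) C1_differentiable_on {t \<in> {0<..<1} - S. \<gamma> t \<in> cdom c}))"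

definition curve_length ::
    "('a, 'e::euclidean_space) riemannian_structure \<Rightarrow> (real \<Rightarrow> 'a) \<Rightarrow> ennreal" where
  "curve_length \<Omega> \<gamma> = (\<integral>\<^sup>+ t\<in>{0..1}. ennreal (gnorm \<Omega> (\<gamma> t) (velocity \<Omega> \<gamma> t)) \<partial>lborel)"

text \<open>The distance is \<open>\<infinity>\<close> between different connected components.\<close>

definition riemannian_dist ::
    "('a::topological_space, 'e::euclidean_space) riemannian_structure \<Rightarrow> 'a \<Rightarrow> 'a \<Rightarrow> ennreal" where
  "riemannian_dist \<Omega> x y =
     (INF \<gamma>\<in>{\<gamma>. piecewise_C1_curve \<Omega> \<gamma> \<and> \<gamma> 0 = x \<and> \<gamma> 1 = y}. curve_length \<Omega> \<gamma>)"

definition gball ::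
    "('a::topological_space, 'e::euclidean_space) riemannian_structure \<Rightarrow> 'a \<Rightarrow> real \<Rightarrow> 'a set" where
  "gball \<Omega> x r = {y. riemannian_dist \<Omega> x y < ennreal r}"

section \<open>Levi-Civita connection and Hessian\<close>

text \<open>\<open>christoffel \<Omega> c y a b\<close> is the vector with \<open>k\<close>-th coordinate \<open>\<Gamma>\<^sup>k\<^sub>i\<^sub>j a\<^sup>i b\<^sup>j\<close> in the chart \<open>c\<close>, at the
  point with coordinates \<open>y\<close>; the index has been lowered to avoid the inverse of the metric.\<close>

definition christoffel ::
    "('a, 'e::euclidean_space) riemannian_structure \<Rightarrow> ('a, 'e) chart \<Rightarrow> 'e \<Rightarrow> 'e \<Rightarrow> 'e \<Rightarrow> 'e" where
  "christoffel \<Omega> c y a b = (THE u. \<forall>w. 2 * metric_in \<Omega> c y u w =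
       frechet_derivative (\<lambda>z. metric_in \<Omega> c z b w) (at y) a
     + frechet_derivative (\<lambda>z. metric_in \<Omega> c z a w) (at y) b
     - frechet_derivative (\<lambda>z. metric_in \<Omega> c z a b) (at y) w)"

definition field_in ::
    "('a, 'e::euclidean_space) riemannian_structure \<Rightarrow> ('a, 'e) chart \<Rightarrow> ('a \<Rightarrow> 'e) \<Rightarrow> 'e \<Rightarrow> 'e" where
  "field_in \<Omega> c X y = to_chart \<Omega> c (cinv c y) (X (cinv c y))"

definition C1_field ::
    "('a, 'e::euclidean_space) riemannian_structure \<Rightarrow> ('a \<Rightarrow> 'e) \<Rightarrow> bool" where
  "C1_field \<Omega> X \<longleftrightarrow> (\<forall>c\<in>atlas \<Omega>. Ck_on 1 (field_in \<Omega> c X) (cmap c ` cdom c))"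

text \<open>The covariant derivative \<open>\<nabla>\<^sub>v X\<close> at \<open>x\<close>, the differential and the Hessian at \<open>x\<close> are computed
  in the preferred chart at \<open>x\<close>, in which \<open>v\<close> and \<open>X x\<close> are their own coordinates.\<close>

definition cov_deriv ::
    "('a, 'e::euclidean_space) riemannian_structure \<Rightarrow> ('a \<Rightarrow> 'e) \<Rightarrow> 'a \<Rightarrow> 'e \<Rightarrow> 'e" where
  "cov_deriv \<Omega> X x v = (let c = chart_at \<Omega> x; y = cmap c x in
     frechet_derivative (field_in \<Omega> c X) (at y) v + christoffel \<Omega> c y v (X x))"

definition C2_fun ::
    "('a, 'e::euclidean_space) riemannian_structure \<Rightarrow> ('a \<Rightarrow> real) \<Rightarrow> bool" where
  "C2_fun \<Omega> f \<longleftrightarrow> (\<forall>c\<in>atlas \<Omega>. Ck_on 2 (f \<circ> cinv c) (cmap c ` cdom c))"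

definition differential ::
    "('a, 'e::euclidean_space) riemannian_structure \<Rightarrow> ('a \<Rightarrow> real) \<Rightarrow> 'a \<Rightarrow> 'e \<Rightarrow> real" where
  "differential \<Omega> f x v = (let c = chart_at \<Omega> x in frechet_derivative (f \<circ> cinv c) (at (cmap c x)) v)"

definition differential_norm ::
    "('a, 'e::euclidean_space) riemannian_structure \<Rightarrow> ('a \<Rightarrow> real) \<Rightarrow> 'a \<Rightarrow> real" where
  "differential_norm \<Omega> f x = (SUP v\<in>{v. gnorm \<Omega> x v \<le> 1}. \<bar>differential \<Omega> f x v\<bar>)"

definition hessian ::
    "('a, 'e::euclidean_space) riemannian_structure \<Rightarrow> ('a \<Rightarrow> real) \<Rightarrow> 'a \<Rightarrow> 'e \<Rightarrow> 'e \<Rightarrow> real" where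
  "hessian \<Omega> f x v w = (let c = chart_at \<Omega> x; y = cmap c x; F = f \<circ> cinv c in
     frechet_derivative (\<lambda>z. frechet_derivative F (at z) w) (at y) v
     - frechet_derivative F (at y) (christoffel \<Omega> c y v w))"

section \<open>Eigenvalues of a symmetric form with respect to an inner product\<close>

definition eigenspace ::
    "('e::real_vector \<Rightarrow> 'e \<Rightarrow> real) \<Rightarrow> ('e \<Rightarrow> 'e \<Rightarrow> real) \<Rightarrow> real \<Rightarrow> 'e set" where
  "eigenspace G B l = {v. \<forall>w. B v w = l * G v w}"

text \<open>The increasing list of eigenvalues of \<open>B\<close> with respect to \<open>G\<close>, each repeated according to
  its multiplicity.\<close>

definition eigenvalue_list ::
    "('e::euclidean_space \<Rightarrow> 'e \<Rightarrow> real) \<Rightarrow> ('e \<Rightarrow> 'e \<Rightarrow> real) \<Rightarrow> real list" where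
  "eigenvalue_list G B = concat (map (\<lambda>l. replicate (dim (eigenspace G B l)) l)
     (sorted_list_of_set {l. eigenspace G B l \<noteq> {0}}))"

definition Trace_lowest ::
    "nat \<Rightarrow> ('e::euclidean_space \<Rightarrow> 'e \<Rightarrow> real) \<Rightarrow> ('e \<Rightarrow> 'e \<Rightarrow> real) \<Rightarrow> real" where
  "Trace_lowest m G B = sum_list (take m (eigenvalue_list G B))"

section \<open>Varifolds\<close>

text \<open>The Grassmann bundle consists of the pairs \<open>(x, S)\<close> with \<open>S\<close> an \<open>m\<close>-dimensional subspace of the
  tangent space at \<open>x\<close>.  In a chart \<open>c\<close> the plane \<open>S\<close> becomes \<open>to_chart \<Omega> c x ` S\<close>, and the topology
  of the Grassmannian of \<open>'e\<close> is the one of the orthogonal projections (\<open>closest_point\<close>) onto the planes.\<close>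

definition grassmann_bundle ::
    "('a::topological_space, 'e::euclidean_space) riemannian_structure \<Rightarrow> nat \<Rightarrow> ('a \<times> 'e set) topology" where
  "grassmann_bundle \<Omega> m = topology_generated_by
     {{(x, S). x \<in> U \<and> subspace S \<and> dim S = m \<and> closest_point (to_chart \<Omega> c x ` S) v \<in> W}
       | c U v W. c \<in> atlas \<Omega> \<and> open U \<and> U \<subseteq> cdom c \<and> open W}"

definition grassmann_borel ::
    "('a::topological_space, 'e::euclidean_space) riemannian_structure \<Rightarrow> nat \<Rightarrow> ('a \<times> 'e set) measure" where
  "grassmann_borel \<Omega> m =
     sigma (topspace (grassmann_bundle \<Omega> m)) {A. openin (grassmann_bundle \<Omega> m) A}"

definition varifold ::
    "('a::topological_space, 'e::euclidean_space) riemannian_structure \<Rightarrow> nat \<Rightarrow> ('a \<times> 'e set) measure \<Rightarrow> bool" where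
  "varifold \<Omega> m V \<longleftrightarrow> sets V = sets (grassmann_borel \<Omega> m) \<and>
     (\<forall>K. compact K \<longrightarrow> emeasure V {(x, S) \<in> space V. x \<in> K} < \<infinity>)"

definition weight :: "('a::topological_space \<times> 'e set) measure \<Rightarrow> 'a measure" where
  "weight V = distr V borel fst"

definition orthonormal_basis_of :: "('e::real_vector \<Rightarrow> 'e \<Rightarrow> real) \<Rightarrow> 'e set \<Rightarrow> 'e set \<Rightarrow> bool" where
  "orthonormal_basis_of G S E \<longleftrightarrow>
     (\<forall>u\<in>E. \<forall>v\<in>E. G u v = (if u = v then 1 else 0)) \<and> span E = S"

text \<open>The choice of the orthonormal basis is immaterial.\<close>

definition div_plane ::
    "('a, 'e::euclidean_space) riemannian_structure \<Rightarrow> ('a \<Rightarrow> 'e) \<Rightarrow> 'a \<Rightarrow> 'e set \<Rightarrow> real" where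
  "div_plane \<Omega> X x S = (let E = (SOME E. orthonormal_basis_of (metric_at \<Omega> x) S E) in
     \<Sum>e\<in>E. metric_at \<Omega> x (cov_deriv \<Omega> X x e) e)"

definition first_variation ::
    "('a, 'e::euclidean_space) riemannian_structure \<Rightarrow> ('a \<times> 'e set) measure \<Rightarrow> ('a \<Rightarrow> 'e) \<Rightarrow> real" where
  "first_variation \<Omega> V X = (LINT z|V. div_plane \<Omega> X (fst z) (snd z))"

definition test_field ::
    "('a::topological_space, 'e::euclidean_space) riemannian_structure \<Rightarrow> 'a set \<Rightarrow> ('a \<Rightarrow> 'e) \<Rightarrow> bool" where
  "test_field \<Omega> U X \<longleftrightarrow>
     C1_field \<Omega> X \<and> compact (closure {x. X x \<noteq> 0}) \<and> closure {x. X x \<noteq> 0} \<subseteq> U"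

definition locally_bounded_first_variation ::
    "('a::topological_space, 'e::euclidean_space) riemannian_structure \<Rightarrow> ('a \<times> 'e set) measure \<Rightarrow> bool" where
  "locally_bounded_first_variation \<Omega> V \<longleftrightarrow>
     (\<forall>K. compact K \<longrightarrow> (\<exists>C. \<forall>X. test_field \<Omega> K X \<and> (\<forall>x. gnorm \<Omega> x (X x) \<le> 1) \<longrightarrow>
        \<bar>first_variation \<Omega> V X\<bar> \<le> C))"

text \<open>\<open>\<mu>\<close> is the total variation measure of the linear functional \<open>L\<close> on \<open>C\<^sup>1\<close> vector fields of
  compact support; a locally finite Borel measure is determined by its values on open sets.\<close>

definition total_variation_measure ::
    "('a::topological_space, 'e::euclidean_space) riemannian_structure \<Rightarrow> (('a \<Rightarrow> 'e) \<Rightarrow> real) \<Rightarrow> 'a measure \<Rightarrow> bool" where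
  "total_variation_measure \<Omega> L \<mu> \<longleftrightarrow> sets \<mu> = sets borel \<and>
     (\<forall>K. compact K \<longrightarrow> emeasure \<mu> K < \<infinity>) \<and>
     (\<forall>U. open U \<longrightarrow> emeasure \<mu> U =
        (SUP X\<in>{X. test_field \<Omega> U X \<and> (\<forall>x. gnorm \<Omega> x (X x) \<le> 1)}. ennreal (L X)))"

definition singular_to :: "'a measure \<Rightarrow> 'a measure \<Rightarrow> bool" where
  "singular_to \<mu> \<nu> \<longleftrightarrow> (\<exists>N\<in>sets \<mu>. emeasure \<mu> N = 0 \<and> emeasure \<nu> (space \<nu> - N) = 0)"

text \<open>\<open>\<sigma>\<close> is the singular part, with respect to \<open>weight V\<close>, of the total variation measure \<open>\<mu>\<close> of
  the first variation.\<close>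

definition boundary_measure ::
    "('a::topological_space, 'e::euclidean_space) riemannian_structure \<Rightarrow> ('a \<times> 'e set) measure \<Rightarrow> 'a measure \<Rightarrow> bool" where
  "boundary_measure \<Omega> V \<sigma> \<longleftrightarrow> sets \<sigma> = sets borel \<and> singular_to (weight V) \<sigma> \<and>
     (\<exists>\<mu> \<alpha>. total_variation_measure \<Omega> (first_variation \<Omega> V) \<mu> \<and>
        sets \<alpha> = sets borel \<and> absolutely_continuous (weight V) \<alpha> \<and>
        (\<forall>A\<in>sets borel. emeasure \<mu> A = emeasure \<alpha> A + emeasure \<sigma> A))"

definition borel_field ::
    "('a::topological_space, 'e::euclidean_space) riemannian_structure \<Rightarrow> ('a \<Rightarrow> 'e) \<Rightarrow> bool" where
  "borel_field \<Omega> H \<longleftrightarrow>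
     (\<forall>c\<in>atlas \<Omega>. (\<lambda>x. to_chart \<Omega> c x (H x)) \<in> borel_measurable (restrict_space borel (cdom c)))"

text \<open>By uniqueness of the Lebesgue decomposition, the absolutely continuous part of the first
  variation is \<open>- H\<close> times the weight iff the first variation minus that part, i.e. the functional
  \<open>X \<mapsto> \<delta>V(X) + \<integral> \<langle>H, X\<rangle> d|V|\<close>, is singular.\<close>

definition generalized_mean_curvature ::
    "('a::topological_space, 'e::euclidean_space) riemannian_structure \<Rightarrow> ('a \<times> 'e set) measure \<Rightarrow> ('a \<Rightarrow> 'e) \<Rightarrow> bool" where
  "generalized_mean_curvature \<Omega> V H \<longleftrightarrow> borel_field \<Omega> H \<and>
     (\<forall>K. compact K \<longrightarrow> (\<integral>\<^sup>+ x\<in>K. ennreal (gnorm \<Omega> x (H x)) \<partial>weight V) < \<infinity>) \<and>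
     (\<exists>\<tau>. total_variation_measure \<Omega>
            (\<lambda>X. first_variation \<Omega> V X + (LINT x|weight V. metric_at \<Omega> x (H x) (X x))) \<tau> \<and>
          singular_to (weight V) \<tau>)"

section \<open>Area blow-up set\<close>

definition area_blowup_set ::
    "('a::topological_space, 'e::euclidean_space) riemannian_structure \<Rightarrow> (nat \<Rightarrow> ('a \<times> 'e set) measure) \<Rightarrow> 'a set" where
  "area_blowup_set \<Omega> M =
     {x. \<forall>r>0. limsup (\<lambda>i. emeasure (weight (M i)) (gball \<Omega> x r)) = \<infinity>}"

end

theory Submission
  imports Defs
begin

text \<open>
  Suppose that the inequality fails at \<open>p\<close>.  Subtracting a quartic from \<open>f\<close> in a chart gives a function
  \<open>F\<close> with the same derivatives up to order two at \<open>p\<close> and with a strict local maximum on the blow-up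
  set at \<open>p\<close>.  Near \<open>p\<close> the Hessian of \<open>F\<close> has trace at least \<open>h |DF| + \<delta>\<close> on every \<open>m\<close>-plane, because
  the trace over a plane is at least the sum of the \<open>m\<close> lowest eigenvalues.  Take the vector field
  \<open>X = \<eta> \<phi>(F) grad F\<close>, where \<open>\<eta>\<close> is a cutoff function and \<open>\<phi>\<close> is nondecreasing and vanishes below a
  level slightly less than \<open>F(p)\<close>.  Its divergence along planes is at least \<open>h |X|\<close>, with a definite
  excess near \<open>p\<close>, except on a compact set \<open>Q\<close> that does not meet the blow-up set.  On the other hand
  the first variation of \<open>M\<^sub>i\<close> at \<open>X\<close> is at most \<open>\<integral>|H| |X|\<close> plus the boundary measure.  Hence the area
  of \<open>M\<^sub>i\<close> near \<open>p\<close> is bounded by the areas in \<open>Q\<close>, the integrals of \<open>(|H| - h)\<^sup>+\<close> and the boundary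
  measures, all of which stay bounded, so \<open>p\<close> is not in the blow-up set.
\<close>

section \<open>Calculus of C^1 and C^2 functions\<close>

text \<open>The lower bound h |X| is exactly what the mean curvature can consume: the curvature term
  is at most h times the integral of |X| plus the excess of |H| over h, and the common finite term
  cancels, leaving the area gained near \<open>p\<close>. The subtracted term is quartic since a
  quadratic would change the Hessian; it makes f exceed f(p) where the cutoff varies and F is not
  too low, so that a non-strict local maximum keeps the blow-up set away from that zone. Preferred
  charts may jump from point to point, so the computations take place in one fixed chart, with the
  Lie derivative of the metric in place of the covariant derivative; its independence of the chart
  rests on the symmetry of second derivatives. Two measure-theoretic obstacles remain. The
  divergence along a plane is defined by an arbitrary choice of basis, so its measurability needs a
  canonical one. And the boundary measure is the singular part of a total variation, whereas the
  estimate produces the total variation of a singular functional; outer regularity relates the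
  two.\<close>

lemma C1_on_iff:
  "Ck_on 1 F S \<longleftrightarrow> (\<forall>x\<in>S. F differentiable (at x)) \<and>
     (\<forall>v. continuous_on S (\<lambda>x. frechet_derivative F (at x) v))"
  unfolding One_nat_def Ck_on.simps by simp

text \<open>Uniqueness of the Frechet derivative allows an explicit formula \<open>D\<close> in
  place of \<open>frechet_derivative\<close>, which is defined by choice.\<close>

lemma C1_onI:
  assumes "\<And>x. x \<in> S \<Longrightarrow> (F has_derivative D x) (at x)" "\<And>v. continuous_on S (\<lambda>x. D x v)"
  shows "Ck_on 1 F S"
proof -
  have eq: "frechet_derivative F (at x) = D x" if "x \<in> S" for x
    using frechet_derivative_at[OF assms(1)[OF that]] by simp
  have "continuous_on S (\<lambda>x. frechet_derivative F (at x) v)" for v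
    using assms(2)[of v] by (simp add: eq cong: continuous_on_cong)
  moreover have "\<forall>x\<in>S. F differentiable (at x)"
    using assms(1) by (auto simp: differentiable_def)
  ultimately show ?thesis unfolding C1_on_iff by blast
qed

lemma C1_on_has_derivative:
  "Ck_on 1 F S \<Longrightarrow> x \<in> S \<Longrightarrow> (F has_derivative frechet_derivative F (at x)) (at x)"
  using frechet_derivative_works unfolding C1_on_iff by blast

lemma C1_on_continuous_deriv:
  "Ck_on 1 F S \<Longrightarrow> continuous_on S (\<lambda>x. frechet_derivative F (at x) v)"
  unfolding C1_on_iff by blast

lemma C1_on_continuous_on: "Ck_on 1 F S \<Longrightarrow> continuous_on S F"
  unfolding C1_on_iff
  by (meson continuous_at_imp_continuous_on differentiable_imp_continuous_within)

lemma C1_on_subset: "Ck_on 1 F S \<Longrightarrow> T \<subseteq> S \<Longrightarrow> Ck_on 1 F T"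
  unfolding C1_on_iff by (meson continuous_on_subset subsetD)

text \<open>Derivatives in \<open>Ck_on\<close> are taken \<open>at x\<close> rather than within
  \<open>S\<close>, so agreement on \<open>S\<close> determines them only because \<open>S\<close>
  is open.\<close>

lemma C1_on_cong:
  assumes "Ck_on 1 F S" "open S" "\<And>x. x \<in> S \<Longrightarrow> F x = G x"
  shows "Ck_on 1 G S"
proof (rule C1_onI)
  show "(G has_derivative frechet_derivative F (at x)) (at x)" if "x \<in> S" for x
    using has_derivative_transform_within_open[OF C1_on_has_derivative[OF assms(1) that] assms(2) that]
      assms(3) by blast
qed (rule C1_on_continuous_deriv[OF assms(1)])

text \<open>For gluing: a field transplanted from a chart is treated separately inside the chart
  domain and away from its support.\<close>

lemma C1_on_local:
  assumes "\<And>x. x \<in> S \<Longrightarrow> \<exists>U. open U \<and> x \<in> U \<and> Ck_on 1 F U"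
  shows "Ck_on 1 F S"
proof (rule C1_onI)
  show "(F has_derivative frechet_derivative F (at x)) (at x)" if "x \<in> S" for x
    using assms[OF that] C1_on_has_derivative by blast
  show "continuous_on S (\<lambda>x. frechet_derivative F (at x) v)" for v
  proof (rule continuous_at_imp_continuous_on, rule ballI)
    fix x assume "x \<in> S"
    then obtain U where "open U" "x \<in> U" "Ck_on 1 F U" using assms by blast
    then show "isCont (\<lambda>x. frechet_derivative F (at x) v) x"
      using C1_on_continuous_deriv continuous_on_eq_continuous_at by blast
  qed
qed

lemma Ck_on_Suc_imp: "Ck_on (Suc k) F S \<Longrightarrow> Ck_on k F S"
proof (induction k arbitrary: F)
  case 0
  then show ?case using C1_on_continuous_on by (simp add: One_nat_def)
next
  case (Suc k)
  have "Ck_on k (\<lambda>x. frechet_derivative F (at x) v) S" for v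
    using Suc.prems by (intro Suc.IH) (auto simp del: Ck_on.simps(2) simp: Ck_on.simps(2)[of "Suc k"])
  moreover have "\<forall>x\<in>S. F differentiable (at x)" using Suc.prems by simp
  ultimately show ?case by simp
qed

lemma C2_on_imp_C1_on: "Ck_on 2 F S \<Longrightarrow> Ck_on 1 F S"
  using Ck_on_Suc_imp[of 1 F S] by (simp add: numeral_2_eq_2)

lemma C2_on_deriv: "Ck_on 2 F S \<Longrightarrow> Ck_on 1 (\<lambda>x. frechet_derivative F (at x) v) S"
  by (simp add: numeral_2_eq_2)

lemma C2_onI:
  assumes "\<And>x. x \<in> S \<Longrightarrow> (F has_derivative D x) (at x)" "\<And>v. Ck_on 1 (\<lambda>x. D x v) S" "open S"
  shows "Ck_on 2 F S"
proof -
  have eq: "D x = frechet_derivative F (at x)" if "x \<in> S" for x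
    using frechet_derivative_at[OF assms(1)[OF that]] by simp
  have "Ck_on 1 (\<lambda>x. frechet_derivative F (at x) v) S" for v
    by (rule C1_on_cong[OF assms(2)[of v] assms(3)]) (simp add: eq)
  moreover have "\<forall>x\<in>S. F differentiable (at x)"
    using assms(1) by (auto simp: differentiable_def)
  ultimately show ?thesis by (simp add: numeral_2_eq_2)
qed

lemma smooth_on_C2_on: "smooth_on F S \<Longrightarrow> Ck_on 2 F S"
  by (simp add: smooth_on_def)

lemma smooth_on_C1_on: "smooth_on F S \<Longrightarrow> Ck_on 1 F S"
  by (simp add: smooth_on_def)

lemma linear_basis_expansion:
  fixes L :: "'e::euclidean_space \<Rightarrow> 'b::real_normed_vector"
  assumes "linear L" shows "L v = (\<Sum>b\<in>Basis. (v \<bullet> b) *\<^sub>R L b)"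
proof -
  have "L v = L (\<Sum>b\<in>Basis. (v \<bullet> b) *\<^sub>R b)" by (simp add: euclidean_representation)
  also have "\<dots> = (\<Sum>b\<in>Basis. (v \<bullet> b) *\<^sub>R L b)"
    using assms by (simp add: linear_sum linear_scale)
  finally show ?thesis .
qed

lemma C1_on_linear_deriv: "Ck_on 1 F S \<Longrightarrow> x \<in> S \<Longrightarrow> linear (frechet_derivative F (at x))"
  using C1_on_has_derivative has_derivative_linear by blast

text \<open>\<open>Ck_on\<close> gives continuity of the derivative for each fixed direction only;
  expanding the direction over \<open>Basis\<close> makes it joint in point and direction.\<close>

lemma C1_on_continuous_deriv_apply:
  fixes F :: "'e::euclidean_space \<Rightarrow> 'b::real_normed_vector"
  assumes "Ck_on 1 F S" "continuous_on T a" "a ` T \<subseteq> S" "continuous_on T v"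
  shows "continuous_on T (\<lambda>t. frechet_derivative F (at (a t)) (v t))"
proof -
  have "continuous_on T (\<lambda>t. \<Sum>b\<in>Basis. (v t \<bullet> b) *\<^sub>R frechet_derivative F (at (a t)) b)"
    by (intro continuous_intros assms
        continuous_on_compose2[OF C1_on_continuous_deriv[OF assms(1)] assms(2) assms(3)])
  moreover have "frechet_derivative F (at (a t)) (v t)
      = (\<Sum>b\<in>Basis. (v t \<bullet> b) *\<^sub>R frechet_derivative F (at (a t)) b)" if "t \<in> T" for t
    using assms(3) that by (intro linear_basis_expansion C1_on_linear_deriv[OF assms(1)]) auto
  ultimately show ?thesis by (simp cong: continuous_on_cong)
qed

lemma C1_on_const: "Ck_on 1 (\<lambda>x. c) S"
  by (rule C1_onI[where D="\<lambda>x v. 0"]) auto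

lemma C1_on_id: "Ck_on 1 (\<lambda>x. x) S"
  by (rule C1_onI[where D="\<lambda>x v. v"]) (auto intro: has_derivative_ident)

lemma C1_on_add:
  assumes "Ck_on 1 F S" "Ck_on 1 G S" shows "Ck_on 1 (\<lambda>x. F x + G x) S"
  by (rule C1_onI[OF has_derivative_add[OF C1_on_has_derivative[OF assms(1)]
        C1_on_has_derivative[OF assms(2)]]])
     (auto intro!: continuous_intros C1_on_continuous_deriv assms)

lemma C1_on_diff:
  assumes "Ck_on 1 F S" "Ck_on 1 G S" shows "Ck_on 1 (\<lambda>x. F x - G x) S"
  by (rule C1_onI[OF has_derivative_diff[OF C1_on_has_derivative[OF assms(1)]
        C1_on_has_derivative[OF assms(2)]]])
     (auto intro!: continuous_intros C1_on_continuous_deriv assms)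

lemma C1_on_sum:
  assumes "\<And>i. i \<in> I \<Longrightarrow> Ck_on 1 (F i) S" shows "Ck_on 1 (\<lambda>x. \<Sum>i\<in>I. F i x) S"
  using assms
proof (induction I rule: infinite_finite_induct)
  case (insert i I)
  then show ?case using C1_on_add[of "F i" S "\<lambda>x. \<Sum>i\<in>I. F i x"] by simp
qed (auto intro: C1_on_const)

lemma C1_on_bilinear:
  assumes "bounded_bilinear B" "Ck_on 1 F S" "Ck_on 1 G S"
  shows "Ck_on 1 (\<lambda>x. B (F x) (G x)) S"
proof (rule C1_onI)
  show "((\<lambda>x. B (F x) (G x)) has_derivative (\<lambda>v. B (F x) (frechet_derivative G (at x) v)
      + B (frechet_derivative F (at x) v) (G x))) (at x)" if "x \<in> S" for x
    by (rule bounded_bilinear.FDERIV[OF assms(1) C1_on_has_derivative[OF assms(2) that]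
          C1_on_has_derivative[OF assms(3) that]])
  show "continuous_on S (\<lambda>x. B (F x) (frechet_derivative G (at x) v)
      + B (frechet_derivative F (at x) v) (G x))" for v
    by (intro continuous_on_add bounded_bilinear.continuous_on[OF assms(1)]
        C1_on_continuous_deriv C1_on_continuous_on assms)
qed

lemmas C1_on_scaleR = C1_on_bilinear[OF bounded_bilinear_scaleR]
lemmas C1_on_mult = C1_on_bilinear[OF bounded_bilinear_mult]
lemmas C1_on_inner = C1_on_bilinear[OF bounded_bilinear_inner]

lemma C1_on_compose:
  assumes "Ck_on 1 G T" "Ck_on 1 F S" "F ` S \<subseteq> T"
  shows "Ck_on 1 (\<lambda>x. G (F x)) S"
proof (rule C1_onI)
  show "((\<lambda>x. G (F x)) has_derivative
      (\<lambda>v. frechet_derivative G (at (F x)) (frechet_derivative F (at x) v))) (at x)" if "x \<in> S" for x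
    using has_derivative_compose[OF C1_on_has_derivative[OF assms(2) that]]
      C1_on_has_derivative[OF assms(1)] assms(3) that by blast
  show "continuous_on S (\<lambda>x. frechet_derivative G (at (F x)) (frechet_derivative F (at x) v))" for v
    by (rule C1_on_continuous_deriv_apply[OF assms(1) C1_on_continuous_on[OF assms(2)] assms(3)
          C1_on_continuous_deriv[OF assms(2)]])
qed

lemma C1_on_compose_real:
  fixes F :: "'e::euclidean_space \<Rightarrow> real"
  assumes "Ck_on 1 F S" "F ` S \<subseteq> T"
    and "\<And>t. t \<in> T \<Longrightarrow> (\<phi> has_real_derivative \<phi>' t) (at t)" "continuous_on T \<phi>'"
  shows "Ck_on 1 (\<lambda>x. \<phi> (F x)) S"
proof (rule C1_on_compose[OF _ assms(1,2)])
  show "Ck_on 1 \<phi> T"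
    using assms(3,4)
    by (intro C1_onI[where D="\<lambda>t v. \<phi>' t * v"]) (auto simp: has_field_derivative_def intro!: continuous_intros)
qed

text \<open>Product rule for a derivative applied to a moving vector. It differentiates the
  transformation law of vector fields, and its first term is where second derivatives of a
  coordinate change appear.\<close>

lemma has_derivative_deriv_apply:
  fixes \<psi> :: "'e::euclidean_space \<Rightarrow> 'b::real_normed_vector"
  assumes "Ck_on 2 \<psi> S" "open S" "y \<in> S" "(\<xi> has_derivative \<xi>') (at y)"
  shows "((\<lambda>z. frechet_derivative \<psi> (at z) (\<xi> z)) has_derivative
     (\<lambda>v. frechet_derivative (\<lambda>z. frechet_derivative \<psi> (at z) (\<xi> y)) (at y) v
        + frechet_derivative \<psi> (at y) (\<xi>' v))) (at y)"
proof -
  let ?D = "\<lambda>z. frechet_derivative \<psi> (at z)"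
  let ?D2 = "\<lambda>b. frechet_derivative (\<lambda>z. ?D z b) (at y)"
  have C1: "Ck_on 1 \<psi> S" using C2_on_imp_C1_on assms(1) by blast
  have hd: "((\<lambda>z. ?D z b) has_derivative ?D2 b) (at y)" for b
    using C1_on_has_derivative[OF C2_on_deriv[OF assms(1)] assms(3)] .
  have exp: "?D z v = (\<Sum>b\<in>Basis. (v \<bullet> b) *\<^sub>R ?D z b)" if "z \<in> S" for z v
    by (rule linear_basis_expansion[OF C1_on_linear_deriv[OF C1 that]])
  have "((\<lambda>z. \<Sum>b\<in>Basis. (\<xi> y \<bullet> b) *\<^sub>R ?D z b) has_derivative
      (\<lambda>v. \<Sum>b\<in>Basis. (\<xi> y \<bullet> b) *\<^sub>R ?D2 b v)) (at y)"
    by (intro has_derivative_sum has_derivative_scaleR_right hd)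
  then have "((\<lambda>z. ?D z (\<xi> y)) has_derivative
      (\<lambda>v. \<Sum>b\<in>Basis. (\<xi> y \<bullet> b) *\<^sub>R ?D2 b v)) (at y)"
    by (rule has_derivative_transform_within_open[OF _ assms(2,3)]) (simp add: exp[symmetric])
  then have D2: "?D2 (\<xi> y) = (\<lambda>v. \<Sum>b\<in>Basis. (\<xi> y \<bullet> b) *\<^sub>R ?D2 b v)"
    by (rule frechet_derivative_at[symmetric])
  have "((\<lambda>z. \<Sum>b\<in>Basis. (\<xi> z \<bullet> b) *\<^sub>R ?D z b) has_derivative
      (\<lambda>v. \<Sum>b\<in>Basis. (\<xi> y \<bullet> b) *\<^sub>R ?D2 b v + (\<xi>' v \<bullet> b) *\<^sub>R ?D y b)) (at y)"
    by (intro has_derivative_sum has_derivative_scaleR hd has_derivative_inner_left assms(4))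
  then have "((\<lambda>z. ?D z (\<xi> z)) has_derivative
      (\<lambda>v. \<Sum>b\<in>Basis. (\<xi> y \<bullet> b) *\<^sub>R ?D2 b v + (\<xi>' v \<bullet> b) *\<^sub>R ?D y b)) (at y)"
    by (rule has_derivative_transform_within_open[OF _ assms(2,3)]) (simp add: exp[symmetric])
  then show ?thesis
    by (simp add: D2 sum.distrib exp[OF assms(3), symmetric])
qed

lemma C1_on_deriv_apply:
  fixes \<psi> :: "'e::euclidean_space \<Rightarrow> 'b::real_normed_vector"
  assumes "Ck_on 2 \<psi> S" "Ck_on 1 u T" "u ` T \<subseteq> S" "Ck_on 1 \<xi> T" "open T"
  shows "Ck_on 1 (\<lambda>z. frechet_derivative \<psi> (at (u z)) (\<xi> z)) T"
proof (rule C1_on_cong[OF _ assms(5)])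
  show "Ck_on 1 (\<lambda>z. \<Sum>b\<in>Basis. (\<xi> z \<bullet> b) *\<^sub>R frechet_derivative \<psi> (at (u z)) b) T"
    by (intro C1_on_sum C1_on_scaleR C1_on_inner C1_on_const assms
        C1_on_compose[OF C2_on_deriv[OF assms(1)] assms(2,3)])
  show "(\<Sum>b\<in>Basis. (\<xi> z \<bullet> b) *\<^sub>R frechet_derivative \<psi> (at (u z)) b)
      = frechet_derivative \<psi> (at (u z)) (\<xi> z)" if "z \<in> T" for z
    using that assms(3)
    by (intro linear_basis_expansion[symmetric] C1_on_linear_deriv[OF C2_on_imp_C1_on[OF assms(1)]]) auto
qed

section \<open>Symmetry of second derivatives\<close>

lemma has_real_derivative_along_line:
  assumes "(F has_derivative F') (at (c + t *\<^sub>R v))"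
  shows "((\<lambda>t. F (c + t *\<^sub>R v)) has_real_derivative F' v) (at t)"
proof -
  have "((\<lambda>t. c + t *\<^sub>R v) has_derivative (\<lambda>h. h *\<^sub>R v)) (at t)"
    by (auto intro!: derivative_eq_intros)
  from has_derivative_compose[OF this assms]
  have "((\<lambda>t. F (c + t *\<^sub>R v)) has_derivative (\<lambda>h. F' (h *\<^sub>R v))) (at t)" .
  moreover have "F' (h *\<^sub>R v) = F' v * h" for h
    using has_derivative_linear[OF assms] by (simp add: linear_scale)
  ultimately show ?thesis by (simp add: has_field_derivative_def)
qed

text \<open>Mean value theorem twice: along \<open>v\<close> for the increment of \<open>F\<close>
  in direction \<open>w\<close>, then along \<open>w\<close> for the derivative of \<open>F\<close>
  in direction \<open>v\<close>.\<close>

lemma second_difference_mvt: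
  fixes F :: "'e::euclidean_space \<Rightarrow> real"
  assumes "Ck_on 2 F S" "ball y \<rho> \<subseteq> S" "0 < s" "s * (norm v + norm w) < \<rho>"
  shows "\<exists>z. dist y z \<le> s * (norm v + norm w) \<and>
     F (y + s *\<^sub>R v + s *\<^sub>R w) - F (y + s *\<^sub>R v) - F (y + s *\<^sub>R w) + F y
     = s\<^sup>2 * frechet_derivative (\<lambda>z. frechet_derivative F (at z) v) (at z) w"
proof -
  let ?DF = "\<lambda>z. frechet_derivative F (at z)"
  have C1: "Ck_on 1 F S" using C2_on_imp_C1_on assms(1) by blast
  have dist_le: "dist y (y + a *\<^sub>R v + b *\<^sub>R w) \<le> s * (norm v + norm w)"
    if "0 \<le> a" "a \<le> s" "0 \<le> b" "b \<le> s" for a b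
  proof -
    have "norm (a *\<^sub>R v + b *\<^sub>R w) \<le> a * norm v + b * norm w"
      using norm_triangle_ineq[of "a *\<^sub>R v" "b *\<^sub>R w"] that by simp
    also have "\<dots> \<le> s * norm v + s * norm w"
      using that by (intro add_mono mult_right_mono) auto
    finally show ?thesis
      by (simp add: dist_norm algebra_simps norm_minus_commute)
  qed
  have inS: "y + a *\<^sub>R v + b *\<^sub>R w \<in> S" if "0 \<le> a" "a \<le> s" "0 \<le> b" "b \<le> s" for a b
    using dist_le[OF that] assms(2,4) by (auto simp: subset_iff)
  let ?q = "\<lambda>t. F ((y + s *\<^sub>R w) + t *\<^sub>R v) - F (y + t *\<^sub>R v)"
  have "\<exists>t>0. t < s \<and> ?q s - ?q 0
      = (s - 0) * (?DF ((y + s *\<^sub>R w) + t *\<^sub>R v) v - ?DF (y + t *\<^sub>R v) v)"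
  proof (rule MVT2[OF assms(3)])
    fix t assume t: "0 \<le> t" "t \<le> s"
    have "(y + s *\<^sub>R w) + t *\<^sub>R v \<in> S" "y + t *\<^sub>R v \<in> S"
      using inS[of t s] inS[of t 0] t by (auto simp: algebra_simps)
    then show "(?q has_real_derivative ?DF ((y + s *\<^sub>R w) + t *\<^sub>R v) v - ?DF (y + t *\<^sub>R v) v) (at t)"
      by (intro DERIV_diff has_real_derivative_along_line[OF C1_on_has_derivative[OF C1]])
  qed
  then obtain t where t: "0 < t" "t < s"
    and eq1: "?q s - ?q 0 = s * (?DF ((y + s *\<^sub>R w) + t *\<^sub>R v) v - ?DF (y + t *\<^sub>R v) v)" by auto
  let ?r = "\<lambda>\<tau>. ?DF ((y + t *\<^sub>R v) + \<tau> *\<^sub>R w) v"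
  have "\<exists>\<tau>>0. \<tau> < s \<and> ?r s - ?r 0 = (s - 0) *
      frechet_derivative (\<lambda>z. ?DF z v) (at ((y + t *\<^sub>R v) + \<tau> *\<^sub>R w)) w"
  proof (rule MVT2[OF assms(3)])
    fix \<tau> assume \<tau>: "0 \<le> \<tau>" "\<tau> \<le> s"
    then show "(?r has_real_derivative
        frechet_derivative (\<lambda>z. ?DF z v) (at ((y + t *\<^sub>R v) + \<tau> *\<^sub>R w)) w) (at \<tau>)"
      by (intro has_real_derivative_along_line[OF C1_on_has_derivative[OF C2_on_deriv[OF assms(1)]]] inS)
         (use t in auto)
  qed
  then obtain \<tau> where \<tau>: "0 < \<tau>" "\<tau> < s"
    and eq2: "?r s - ?r 0 = s * frechet_derivative (\<lambda>z. ?DF z v) (at ((y + t *\<^sub>R v) + \<tau> *\<^sub>R w)) w" by auto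
  show ?thesis
  proof (intro exI[of _ "(y + t *\<^sub>R v) + \<tau> *\<^sub>R w"] conjI)
    show "dist y (y + t *\<^sub>R v + \<tau> *\<^sub>R w) \<le> s * (norm v + norm w)" using dist_le t \<tau> by simp
    have a: "?DF ((y + s *\<^sub>R w) + t *\<^sub>R v) v - ?DF (y + t *\<^sub>R v) v = ?r s - ?r 0"
      by (simp add: add.commute add.left_commute)
    have b: "F (y + s *\<^sub>R v + s *\<^sub>R w) - F (y + s *\<^sub>R v) - F (y + s *\<^sub>R w) + F y = ?q s - ?q 0"
      by (simp add: add.commute add.left_commute)
    show "F (y + s *\<^sub>R v + s *\<^sub>R w) - F (y + s *\<^sub>R v) - F (y + s *\<^sub>R w) + F y
        = s\<^sup>2 * frechet_derivative (\<lambda>z. ?DF z v) (at ((y + t *\<^sub>R v) + \<tau> *\<^sub>R w)) w"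
      unfolding b eq1 a eq2 by (simp add: power2_eq_square)
  qed
qed

text \<open>The second difference is symmetric in \<open>v\<close> and \<open>w\<close>, so one
  mixed derivative at some point equals the other at another point, both arbitrarily close to
  \<open>y\<close>; continuity moves the equality to \<open>y\<close>.\<close>

lemma second_derivative_symmetric_real:
  fixes F :: "'e::euclidean_space \<Rightarrow> real"
  assumes "Ck_on 2 F S" "open S" "y \<in> S"
  shows "frechet_derivative (\<lambda>z. frechet_derivative F (at z) v) (at y) w
       = frechet_derivative (\<lambda>z. frechet_derivative F (at z) w) (at y) v"
proof -
  define B where "B v w z = frechet_derivative (\<lambda>z. frechet_derivative F (at z) v) (at z) w" for v w z
  obtain \<rho> where \<rho>: "\<rho> > 0" "ball y \<rho> \<subseteq> S" using assms openE by blast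
  \<comment> \<open>The factor \<open>n + 2\<close> leaves room for the strict bound by
    \<open>\<rho> / (n + 1)\<close>; the added 1 keeps the denominator positive when
    \<open>v\<close> and \<open>w\<close> vanish.\<close>
  define \<sigma> where "\<sigma> n = \<rho> / ((norm v + norm w + 1) * real (n + 2))" for n :: nat
  have Npos: "norm v + norm w + 1 > 0"
    by (metis add_nonneg_nonneg add_nonneg_pos norm_ge_zero zero_less_one)
  have \<sigma>pos: "\<sigma> n > 0" for n using \<rho> Npos by (simp add: \<sigma>_def)
  have \<sigma>: "\<sigma> n * (norm v + norm w) < \<rho> / real (n + 1)" for n
  proof -
    have "(norm v + norm w) / (norm v + norm w + 1) \<le> 1" using Npos by (simp add: divide_le_eq_1)
    then have "\<rho> / real (n + 2) * ((norm v + norm w) / (norm v + norm w + 1)) \<le> \<rho> / real (n + 2) * 1"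
      using \<rho> by (intro mult_left_mono) auto
    also have "\<dots> < \<rho> / real (n + 1)" using \<rho> by (simp add: frac_less2)
    finally show ?thesis by (simp add: \<sigma>_def field_simps)
  qed
  have \<sigma>': "\<sigma> n * (norm v + norm w) < \<rho>" for n
  proof -
    have "\<rho> / real (n + 1) \<le> \<rho>" using \<rho> by (simp add: divide_le_eq)
    then show ?thesis using \<sigma>[of n] by linarith
  qed
  have "\<exists>z z'. dist y z < \<rho> / real (n + 1) \<and> dist y z' < \<rho> / real (n + 1) \<and> B v w z = B w v z'" for n
  proof -
    obtain z where z: "dist y z \<le> \<sigma> n * (norm v + norm w)"
      "F (y + \<sigma> n *\<^sub>R v + \<sigma> n *\<^sub>R w) - F (y + \<sigma> n *\<^sub>R v) - F (y + \<sigma> n *\<^sub>R w) + F y = (\<sigma> n)\<^sup>2 * B v w z"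
      using second_difference_mvt[OF assms(1) \<rho>(2) \<sigma>pos \<sigma>'[of n]] unfolding B_def by blast
    obtain z' where z': "dist y z' \<le> \<sigma> n * (norm w + norm v)"
      "F (y + \<sigma> n *\<^sub>R w + \<sigma> n *\<^sub>R v) - F (y + \<sigma> n *\<^sub>R w) - F (y + \<sigma> n *\<^sub>R v) + F y = (\<sigma> n)\<^sup>2 * B w v z'"
      using second_difference_mvt[OF assms(1) \<rho>(2) \<sigma>pos, of n w v] \<sigma>'[of n]
      unfolding B_def by (auto simp: add.commute)
    have "(\<sigma> n)\<^sup>2 * B v w z = (\<sigma> n)\<^sup>2 * B w v z'"
      using z(2) z'(2)[unfolded add.assoc add.commute[of "\<sigma> n *\<^sub>R w" "\<sigma> n *\<^sub>R v"]]
      unfolding add.assoc by linarith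
    then have "B v w z = B w v z'" using \<sigma>pos[of n] by simp
    moreover have "dist y z < \<rho> / real (n + 1)" "dist y z' < \<rho> / real (n + 1)"
      using z(1) z'(1) \<sigma>[of n] by (auto simp: add.commute)
    ultimately show ?thesis by blast
  qed
  then obtain Z Z' where Z: "\<And>n. dist y (Z n) < \<rho> / real (n + 1)"
      "\<And>n. dist y (Z' n) < \<rho> / real (n + 1)" "\<And>n. B v w (Z n) = B w v (Z' n)"
    by metis
  have lim0: "(\<lambda>n. \<rho> / real (n + 1)) \<longlonglongrightarrow> 0"
    using LIMSEQ_inverse_real_of_nat[THEN tendsto_mult_right_zero, of \<rho>] by (simp add: divide_inverse)
  have lims: "X \<longlonglongrightarrow> y" if "\<And>n. dist y (X n) < \<rho> / real (n + 1)" for X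
  proof (rule metric_tendsto_imp_tendsto[OF lim0])
    show "\<forall>\<^sub>F n in sequentially. dist (X n) y \<le> dist (\<rho> / real (n + 1)) 0"
      using that \<rho> by (intro always_eventually) (auto simp: dist_commute less_imp_le)
  qed
  have cont: "isCont (B v w) y" for v w
    unfolding B_def using C1_on_continuous_deriv[OF C2_on_deriv[OF assms(1)]] assms(2,3)
    by (simp add: continuous_on_eq_continuous_at)
  have "(\<lambda>n. B v w (Z n)) \<longlonglongrightarrow> B v w y" "(\<lambda>n. B w v (Z' n)) \<longlonglongrightarrow> B w v y"
    using isCont_tendsto_compose[OF cont lims] Z by blast+
  then have "B v w y = B w v y" unfolding Z(3) using LIMSEQ_unique by blast
  then show ?thesis unfolding B_def .
qed

lemma second_derivative_symmetric:
  fixes F :: "'e::euclidean_space \<Rightarrow> 'b::euclidean_space"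
  assumes "Ck_on 2 F S" "open S" "y \<in> S"
  shows "frechet_derivative (\<lambda>z. frechet_derivative F (at z) v) (at y) w
       = frechet_derivative (\<lambda>z. frechet_derivative F (at z) w) (at y) v"
proof (rule euclidean_eqI)
  fix b :: 'b assume "b \<in> Basis"
  have C1: "Ck_on 1 F S" using C2_on_imp_C1_on assms(1) by blast
  have d1: "((\<lambda>z. F z \<bullet> b) has_derivative (\<lambda>v. frechet_derivative F (at z) v \<bullet> b)) (at z)" if "z \<in> S" for z
    by (intro has_derivative_inner_left C1_on_has_derivative[OF C1 that])
  have C2: "Ck_on 2 (\<lambda>z. F z \<bullet> b) S"
    by (rule C2_onI[OF d1 _ assms(2)]) (assumption | intro C1_on_inner C2_on_deriv[OF assms(1)] C1_on_const)+
  have "frechet_derivative (\<lambda>z. frechet_derivative (\<lambda>z. F z \<bullet> b) (at z) v) (at y) w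
      = frechet_derivative (\<lambda>z. frechet_derivative F (at z) v) (at y) w \<bullet> b" for v w
  proof -
    have "((\<lambda>z. frechet_derivative F (at z) v \<bullet> b) has_derivative
        (\<lambda>w. frechet_derivative (\<lambda>z. frechet_derivative F (at z) v) (at y) w \<bullet> b)) (at y)"
      by (intro has_derivative_inner_left C1_on_has_derivative[OF C2_on_deriv[OF assms(1)] assms(3)])
    then have "((\<lambda>z. frechet_derivative (\<lambda>z. F z \<bullet> b) (at z) v) has_derivative
        (\<lambda>w. frechet_derivative (\<lambda>z. frechet_derivative F (at z) v) (at y) w \<bullet> b)) (at y)"
      by (rule has_derivative_transform_within_open[OF _ assms(2,3)])
         (simp add: frechet_derivative_at[OF d1, symmetric])
    then show ?thesis using frechet_derivative_at by metis
  qed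
  then show "frechet_derivative (\<lambda>z. frechet_derivative F (at z) v) (at y) w \<bullet> b
      = frechet_derivative (\<lambda>z. frechet_derivative F (at z) w) (at y) v \<bullet> b"
    using second_derivative_symmetric_real[OF C2 assms(2,3)] by metis
qed

section \<open>Gram-Schmidt orthonormalization and traces\<close>

text \<open>The recursion is total: a vector dependent on its predecessors has residual 0 and is
  sent to 0. Thus it applies to spanning families without selecting a basis first, which keeps the
  output a measurable function of the input.\<close>

fun gram_schmidt :: "('e::real_vector \<Rightarrow> 'e \<Rightarrow> real) \<Rightarrow> (nat \<Rightarrow> 'e) \<Rightarrow> nat \<Rightarrow> 'e" where
  "gram_schmidt G v k =
     (let w = v k - (\<Sum>j\<in>{..<k}. G (v k) (gram_schmidt G v j) *\<^sub>R gram_schmidt G v j)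
      in (1 / sqrt (G w w)) *\<^sub>R w)"

declare gram_schmidt.simps [simp del]

locale ip_form =
  fixes G :: "'e::euclidean_space \<Rightarrow> 'e \<Rightarrow> real"
  assumes ip: "inner_product_form G"
begin

lemma linear_right: "linear (G v)" and sym: "G v w = G w v" and pos: "v \<noteq> 0 \<Longrightarrow> G v v > 0"
  using ip unfolding inner_product_form_def by auto

lemma linear_left: "linear (\<lambda>x. G x v)"
  using linear_right[of v] by (subst sym) simp

lemmas G_simps = linear_add[OF linear_right] linear_add[OF linear_left]
  linear_diff[OF linear_right] linear_diff[OF linear_left]
  linear_scale[OF linear_right, unfolded real_scaleR_def]
  linear_scale[OF linear_left, unfolded real_scaleR_def]
  linear_0[OF linear_right] linear_0[OF linear_left]
  linear_neg[OF linear_right] linear_neg[OF linear_left]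

lemmas G_sum = linear_sum[OF linear_right] linear_sum[OF linear_left]

lemma nonneg: "G v v \<ge> 0"
  by (cases "v = 0") (auto simp: G_simps pos less_imp_le)

lemma eq_0_iff: "G v v = 0 \<longleftrightarrow> v = 0"
  using pos[of v] by (cases "v = 0") (auto simp: G_simps)

lemma Cauchy_Schwarz: "\<bar>G v w\<bar> \<le> sqrt (G v v) * sqrt (G w w)"
proof (cases "w = 0")
  case False
  have gw: "G w w > 0" using pos[OF False] .
  have "0 \<le> G (G w w *\<^sub>R v - G v w *\<^sub>R w) (G w w *\<^sub>R v - G v w *\<^sub>R w)" by (rule nonneg)
  also have "\<dots> = G w w * (G v v * G w w - (G v w)\<^sup>2)"
    by (simp add: G_simps sym[of w v] algebra_simps power2_eq_square)
  finally have "(G v w)\<^sup>2 \<le> G v v * G w w" using gw by (simp add: zero_le_mult_iff)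
  then have "sqrt ((G v w)\<^sup>2) \<le> sqrt (G v v * G w w)" by (rule real_sqrt_le_mono)
  then show ?thesis by (simp add: real_sqrt_mult)
qed (simp add: G_simps)

definition orthonormal :: "'e set \<Rightarrow> bool" where
  "orthonormal E \<longleftrightarrow> (\<forall>u\<in>E. \<forall>v\<in>E. G u v = (if u = v then 1 else 0))"

lemma orthonormal_basis_of_iff: "orthonormal_basis_of G S E \<longleftrightarrow> orthonormal E \<and> span E = S"
  by (simp add: orthonormal_basis_of_def orthonormal_def)

lemma orthonormal_independent:
  assumes "orthonormal E" shows "independent E"
  unfolding dependent_def
proof safe
  fix a assume a: "a \<in> E" "a \<in> span (E - {a})"
  have "G a a = 0"
    by (rule linear_eq_0_on_span[OF linear_right _ a(2)]) (use assms a in \<open>auto simp: orthonormal_def\<close>)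
  then show False using assms a by (auto simp: orthonormal_def)
qed

lemma orthonormal_finite: "orthonormal E \<Longrightarrow> finite E"
  using orthonormal_independent independent_imp_finite by blast

lemma orthonormal_card: "orthonormal E \<Longrightarrow> card E = dim (span E)"
  using orthonormal_independent dim_eq_card_independent dim_span by metis

lemma orthonormal_expansion:
  assumes "orthonormal E" "x \<in> span E"
  shows "x = (\<Sum>e\<in>E. G x e *\<^sub>R e)"
proof (rule linear_eq_on_span[OF linear_id[unfolded id_def] _ _ assms(2)])
  show "linear (\<lambda>x. \<Sum>e\<in>E. G x e *\<^sub>R e)"
    by (rule linearI) (auto simp: G_simps sum.distrib scaleR_left_distrib scaleR_right.sum)
  fix x assume x: "x \<in> E"
  then have "(\<Sum>e\<in>E. G x e *\<^sub>R e) = (\<Sum>e\<in>E. if x = e then e else 0)"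
    using assms(1) by (intro sum.cong) (auto simp: orthonormal_def)
  then show "x = (\<Sum>e\<in>E. G x e *\<^sub>R e)"
    using x orthonormal_finite[OF assms(1)] by simp
qed

lemma orthonormal_Parseval:
  assumes "orthonormal E" "x \<in> span E"
  shows "G x y = (\<Sum>e\<in>E. G x e * G e y)"
  by (subst orthonormal_expansion[OF assms]) (simp add: G_sum G_simps)

lemma orthonormal_bilinear_expansion:
  assumes "orthonormal E" "x \<in> span E" "y \<in> span E" "\<And>v. linear (B v)" "\<And>v. linear (\<lambda>x. B x v)"
  shows "B x y = (\<Sum>e\<in>E. \<Sum>f\<in>E. G x e * G y f * (B e f :: real))"
proof -
  have "B x y = B (\<Sum>e\<in>E. G x e *\<^sub>R e) (\<Sum>f\<in>E. G y f *\<^sub>R f)"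
    using orthonormal_expansion[OF assms(1)] assms(2,3) by metis
  also have "\<dots> = (\<Sum>e\<in>E. \<Sum>f\<in>E. G x e * G y f * B e f)"
    by (simp add: linear_sum[OF assms(4)] linear_sum[OF assms(5)] linear_scale[OF assms(4)]
        linear_scale[OF assms(5)] sum_distrib_left mult.assoc mult.left_commute)
       (subst sum.swap, simp add: mult.left_commute)
  finally show ?thesis .
qed

text \<open>Each vector of \<open>E\<close> is expanded in \<open>E'\<close>; summed over
  \<open>E\<close>, the products of coefficients become \<open>G a b\<close> by Parseval, so only
  the diagonal survives. Hence the basis chosen in \<open>div_plane\<close> is immaterial.\<close>

lemma trace_basis_independent:
  assumes E: "orthonormal E" and E': "orthonormal E'" and eq: "span E = span E'"
    and B: "\<And>v. linear (B v)" "\<And>v. linear (\<lambda>x. B x v :: real)"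
  shows "(\<Sum>e\<in>E. B e e) = (\<Sum>e\<in>E'. B e e)"
proof -
  have inE: "e \<in> span E'" if "e \<in> E" for e using that eq span_base by metis
  have inE': "e \<in> span E" if "e \<in> E'" for e using that eq span_base by metis
  have "(\<Sum>e\<in>E. B e e) = (\<Sum>e\<in>E. \<Sum>a\<in>E'. \<Sum>b\<in>E'. G e a * G e b * B a b)"
    by (intro sum.cong refl orthonormal_bilinear_expansion[OF E' inE inE B])
  also have "\<dots> = (\<Sum>a\<in>E'. \<Sum>b\<in>E'. (\<Sum>e\<in>E. G a e * G e b) * B a b)"
    by (simp add: sum_distrib_right sym[of _ "_ :: 'e"] sum.swap[of _ E])
  also have "\<dots> = (\<Sum>a\<in>E'. \<Sum>b\<in>E'. G a b * B a b)"
    by (intro sum.cong refl) (simp add: orthonormal_Parseval[OF E inE', symmetric])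
  also have "\<dots> = (\<Sum>a\<in>E'. \<Sum>b\<in>E'. if a = b then B a b else 0)"
    using E' by (intro sum.cong refl) (auto simp: orthonormal_def)
  also have "\<dots> = (\<Sum>a\<in>E'. B a a)"
    using orthonormal_finite[OF E'] by simp
  finally show ?thesis .
qed

section \<open>The Gram-Schmidt process\<close>

abbreviation gs :: "(nat \<Rightarrow> 'e) \<Rightarrow> nat \<Rightarrow> 'e" where "gs \<equiv> gram_schmidt G"

definition gs_residual :: "(nat \<Rightarrow> 'e) \<Rightarrow> nat \<Rightarrow> 'e" where
  "gs_residual v k = v k - (\<Sum>j<k. G (v k) (gs v j) *\<^sub>R gs v j)"

lemma gs_eq: "gs v k = (1 / sqrt (G (gs_residual v k) (gs_residual v k))) *\<^sub>R gs_residual v k"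
  by (subst gram_schmidt.simps) (simp add: gs_residual_def Let_def)

lemma gs_norm: "gs v k \<noteq> 0 \<Longrightarrow> G (gs v k) (gs v k) = 1"
  using nonneg[of "gs_residual v k"] eq_0_iff[of "gs_residual v k"]
  unfolding gs_eq[of v k] by (simp add: G_simps)

text \<open>Among the earlier vectors orthogonality is known by induction, so subtracting the
  projections removes exactly the component along \<open>gs v j\<close>.\<close>

lemma gs_orthogonal: "j < k \<Longrightarrow> G (gs v k) (gs v j) = 0"
proof (induction k arbitrary: j rule: less_induct)
  case (less k)
  have orth: "G (gs v i) (gs v j) = 0" if "i < k" "i \<noteq> j" for i
    using that less.IH[of i j] less.IH[of j i] less.prems sym by (metis nat_neq_iff)
  have "G (gs_residual v k) (gs v j)
      = G (v k) (gs v j) - (\<Sum>i<k. G (v k) (gs v i) * G (gs v i) (gs v j))"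
    by (simp add: gs_residual_def G_simps G_sum)
  also have "(\<Sum>i<k. G (v k) (gs v i) * G (gs v i) (gs v j))
      = (\<Sum>i<k. if i = j then G (v k) (gs v j) * G (gs v j) (gs v j) else 0)"
    by (intro sum.cong) (auto simp: orth)
  also have "\<dots> = G (v k) (gs v j) * G (gs v j) (gs v j)"
    using less.prems by simp
  \<comment> \<open>If \<open>gs v j\<close> is 0 instead of a unit vector, both sides
    vanish.\<close>
  also have "\<dots> = G (v k) (gs v j)"
    using gs_norm[of v j] by (cases "gs v j = 0") (auto simp: G_simps)
  finally show ?case by (subst gs_eq) (simp add: G_simps)
qed

lemma gs_orthogonal': "j \<noteq> k \<Longrightarrow> G (gs v k) (gs v j) = 0"
  using gs_orthogonal sym by (metis nat_neq_iff)

lemma gs_orthonormal: "orthonormal (gs v ` A - {0})"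
  unfolding orthonormal_def using gs_norm gs_orthogonal' by auto metis

lemma gs_inj_on: "inj_on (gs v) {k \<in> A. gs v k \<noteq> 0}"
proof (rule inj_onI, rule ccontr)
  fix j k assume jk: "j \<in> {k \<in> A. gs v k \<noteq> 0}" "gs v j = gs v k" "j \<noteq> k"
  then have "G (gs v j) (gs v j) = 0" using gs_orthogonal'[of k j v] by simp
  then show False using jk(1) by (simp add: eq_0_iff)
qed

text \<open>Zero vectors contribute nothing and the others are distinct. The trace over a plane
  becomes a sum over a fixed index set, which is suited to measurability.\<close>

lemma sum_gs:
  assumes "finite A" "B 0 0 = (0::real)"
  shows "(\<Sum>k\<in>A. B (gs v k) (gs v k)) = (\<Sum>e\<in>gs v ` A - {0}. B e e)"
proof -
  have "(\<Sum>k\<in>A. B (gs v k) (gs v k)) = (\<Sum>k\<in>{k \<in> A. gs v k \<noteq> 0}. B (gs v k) (gs v k))"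
    using assms by (intro sum.mono_neutral_right) auto
  also have "\<dots> = (\<Sum>e\<in>gs v ` {k \<in> A. gs v k \<noteq> 0}. B e e)"
    by (simp add: sum.reindex[OF gs_inj_on])
  also have "gs v ` {k \<in> A. gs v k \<noteq> 0} = gs v ` A - {0}" by auto
  finally show ?thesis .
qed

lemma gs_residual_scale: "gs_residual v k = sqrt (G (gs_residual v k) (gs_residual v k)) *\<^sub>R gs v k"
  using eq_0_iff[of "gs_residual v k"] unfolding gs_eq[of v k] by auto

lemma gs_span: "span (gs v ` {..<n}) = span (v ` {..<n})"
proof (induction n)
  case (Suc n)
  have ins: "f ` {..<Suc n} = insert (f n) (f ` {..<n})" for f :: "nat \<Rightarrow> 'e"
    by (simp add: lessThan_Suc)
  have S: "(\<Sum>j<n. G (v n) (gs v j) *\<^sub>R gs v j) \<in> span (gs v ` {..<n})"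
    by (intro span_sum span_scale span_base) auto
  have mono: "span (f ` {..<n}) \<subseteq> span (f ` {..<Suc n})" for f :: "nat \<Rightarrow> 'e"
    by (intro span_mono) auto
  have "gs_residual v n \<in> span (gs v ` {..<Suc n})"
    by (subst gs_residual_scale) (intro span_scale span_base, auto)
  then have "v n \<in> span (gs v ` {..<Suc n})"
    using span_add[OF _ subsetD[OF mono[of "gs v"] S], of "gs_residual v n"] unfolding gs_residual_def by simp
  then have 1: "v ` {..<Suc n} \<subseteq> span (gs v ` {..<Suc n})"
    using Suc mono[of "gs v"] span_superset[of "v ` {..<n}"] unfolding ins by blast
  have "gs_residual v n \<in> span (v ` {..<Suc n})"
    unfolding gs_residual_def
    by (intro span_diff span_base[of "v n"] subsetD[OF mono[of v] S[unfolded Suc]]) auto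
  then have "gs v n \<in> span (v ` {..<Suc n})" by (subst gs_eq) (rule span_scale)
  then have 2: "gs v ` {..<Suc n} \<subseteq> span (v ` {..<Suc n})"
    using Suc mono[of v] span_superset[of "gs v ` {..<n}"] unfolding ins by blast
  show ?case using 1 2 by (metis span_subspace subset_antisym span_minimal subspace_span)
qed simp

lemma exists_orthonormal_basis:
  assumes "subspace S" obtains E where "orthonormal E" "span E = S"
proof -
  obtain B where B: "B \<subseteq> S" "finite B" "S \<subseteq> span B"
    using basis_exists[of S] independent_imp_finite by metis
  obtain v n where v: "B = v ` {i::nat. i < n}" "inj_on v {i. i < n}"
    using finite_imp_nat_seg_image_inj_on[OF B(2)] by blast
  have "{i. i < n} = {..<n}" by auto
  then have "span (v ` {..<n}) = S"
    using B v(1) assms by (metis span_minimal subset_antisym)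
  then show ?thesis using that gs_orthonormal gs_span by (metis span_delete_0)
qed

lemma gs_nonzero:
  assumes "inj_on v {..<n}" "independent (v ` {..<n})" "k < n"
  shows "gs v k \<noteq> 0"
proof
  assume "gs v k = 0"
  then have "gs_residual v k = 0" by (subst gs_residual_scale) simp
  then have "v k = (\<Sum>j<k. G (v k) (gs v j) *\<^sub>R gs v j)" by (simp add: gs_residual_def)
  also have "\<dots> \<in> span (gs v ` {..<k})" by (intro span_sum span_scale span_base) auto
  finally have "v k \<in> span (v ` {..<k})" by (simp add: gs_span)
  moreover have "v ` {..<k} \<subseteq> v ` {..<n} - {v k}"
    using assms(1,3) by (auto simp: inj_on_def)
  ultimately have "v k \<in> span (v ` {..<n} - {v k})" using span_mono by blast
  then show False using assms(2,3) unfolding dependent_def by blast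
qed

end

text \<open>Gram-Schmidt acts on sequences, hence an enumeration of \<open>Basis\<close>; its values
  from the dimension on are arbitrary.\<close>

definition basis_vector :: "nat \<Rightarrow> 'e::euclidean_space" where
  "basis_vector = (SOME b. bij_betw b {..<DIM('e)} Basis)"

lemma bij_betw_basis_vector: "bij_betw (basis_vector :: nat \<Rightarrow> 'e::euclidean_space) {..<DIM('e)} Basis"
proof -
  have "\<exists>b. bij_betw b {..<DIM('e)} (Basis :: 'e set)"
    using ex_bij_betw_nat_finite[of "Basis :: 'e set"] by (auto simp: atLeast0LessThan)
  then show ?thesis unfolding basis_vector_def by (rule someI_ex)
qed

lemma basis_vector_image: "(basis_vector :: nat \<Rightarrow> 'e::euclidean_space) ` {..<DIM('e)} = Basis"
  using bij_betw_basis_vector by (rule bij_betw_imp_surj_on)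

lemma closest_point_orthogonal:
  fixes T :: "'e::euclidean_space set"
  assumes "subspace T" "t \<in> T"
  shows "(a - closest_point T a) \<bullet> t = 0"
proof -
  have T: "convex T" "closed T" "T \<noteq> {}"
    using assms subspace_imp_convex closed_subspace by auto
  let ?p = "closest_point T a"
  have p: "?p \<in> T" using T by (intro closest_point_in_set) auto
  have "(a - ?p) \<bullet> ((?p + t) - ?p) \<le> 0" "(a - ?p) \<bullet> ((?p - t) - ?p) \<le> 0"
    by (rule closest_point_dot[OF T(1,2)], use p assms subspace_add subspace_diff in blast)+
  then show ?thesis by simp
qed

text \<open>A vector of \<open>T\<close> orthogonal to all projected basis vectors is orthogonal to
  the basis vectors themselves. The topology of the Grassmannian only makes projections of fixed
  vectors accessible, and these therefore recover the plane.\<close>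

lemma span_closest_point_Basis:
  fixes T :: "'e::euclidean_space set"
  assumes "subspace T"
  shows "span (closest_point T ` Basis) = T"
proof (rule ccontr)
  have T: "closed T" "T \<noteq> {}" using assms closed_subspace subspace_0 by auto
  have sub: "closest_point T ` Basis \<subseteq> T" using T closest_point_in_set by blast
  assume "span (closest_point T ` Basis) \<noteq> T"
  then have "span (closest_point T ` Basis) \<subset> span T"
    using sub assms by (metis psubsetI span_eq_iff span_mono)
  then obtain x where x: "x \<noteq> 0" "x \<in> span T" "\<And>y. y \<in> span (closest_point T ` Basis) \<Longrightarrow> orthogonal x y"
    using orthogonal_to_subspace_exists_gen by metis
  have "x \<bullet> b = 0" if b: "b \<in> Basis" for b
  proof -
    have "x \<bullet> (b - closest_point T b) = 0"
      using x(2) assms by (subst inner_commute, intro closest_point_orthogonal) (auto simp: span_eq_iff[THEN iffD2])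
    moreover have "x \<bullet> closest_point T b = 0"
      using x(3)[OF span_base[OF imageI[OF b]]] by (simp add: orthogonal_def)
    ultimately show ?thesis by (simp add: inner_diff_right)
  qed
  then show False using x(1) euclidean_all_zero_iff by blast
qed

section \<open>Eigenvalues and the variational bound for the lowest ones\<close>

lemma continuous_on_bilinear_form:
  fixes B :: "'e::euclidean_space \<Rightarrow> 'e \<Rightarrow> real"
  assumes "\<And>v. linear (B v)" "\<And>v. linear (\<lambda>x. B x v)" "continuous_on T a" "continuous_on T b"
  shows "continuous_on T (\<lambda>t. B (a t) (b t))"
proof -
  have "continuous_on T (\<lambda>t. \<Sum>i\<in>Basis. (a t \<bullet> i) *\<^sub>R B i (b t))"
    using linear_conv_bounded_linear assms(1)
    by (intro continuous_intros assms(3) bounded_linear.continuous_on[OF _ assms(4)]) blast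
  moreover have "B (a t) (b t) = (\<Sum>i\<in>Basis. (a t \<bullet> i) *\<^sub>R B i (b t))" for t
    by (rule linear_basis_expansion[OF assms(2)])
  ultimately show ?thesis by simp
qed

text \<open>After subtraction of \<open>c = a (m - 1)\<close> the first \<open>m\<close> terms are
  nonpositive and the others nonnegative, so weights in the unit interval can only increase the sum;
  the shift costs \<open>c * m\<close> on both sides because the weights sum to
  \<open>m\<close>.\<close>

lemma sum_lowest_le_weighted_sum:
  fixes a w :: "nat \<Rightarrow> real"
  assumes mono: "\<And>i j. i \<le> j \<Longrightarrow> j < n \<Longrightarrow> a i \<le> a j"
    and w: "\<And>i. i < n \<Longrightarrow> 0 \<le> w i \<and> w i \<le> 1" "(\<Sum>i<n. w i) = real m" and "m \<le> n"
  shows "(\<Sum>i<m. a i) \<le> (\<Sum>i<n. a i * w i)"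
proof (cases "m = 0")
  case True
  then have "(\<Sum>i<n. w i) = 0" using w(2) by simp
  then have "\<forall>i\<in>{..<n}. w i = 0"
    using w(1) by (subst (asm) sum_nonneg_eq_0_iff) auto
  then have "(\<Sum>i<n. a i * w i) = 0" by (intro sum.neutral) auto
  then show ?thesis using True by simp
next
  case False
  define c where "c = a (m - 1)"
  have "(\<Sum>i<m. a i - c) = (\<Sum>i<n. if i < m then a i - c else 0)"
    using \<open>m \<le> n\<close> by (intro sum.mono_neutral_cong_left) auto
  also have "\<dots> \<le> (\<Sum>i<n. (a i - c) * w i)"
  proof (rule sum_mono)
    fix i assume i: "i \<in> {..<n}"
    show "(if i < m then a i - c else 0) \<le> (a i - c) * w i"
    proof (cases "i < m")
      case True
      then have "a i - c \<le> 0" unfolding c_def using mono[of i "m - 1"] \<open>m \<le> n\<close> by auto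
      then have "(a i - c) * 1 \<le> (a i - c) * w i"
        using w(1) i by (intro mult_left_mono_neg) auto
      then show ?thesis using True by simp
    next
      case False
      then have "c \<le> a i" unfolding c_def using mono[of "m - 1" i] i by auto
      then show ?thesis using w(1) i False by simp
    qed
  qed
  also have "\<dots> = (\<Sum>i<n. a i * w i) - c * real m"
    by (simp add: left_diff_distrib sum_subtractf sum_distrib_left[symmetric] w(2))
  finally show ?thesis by (simp add: sum_subtractf mult.commute)
qed

locale symmetric_form = ip_form G for G :: "'e::euclidean_space \<Rightarrow> 'e \<Rightarrow> real" +
  fixes B :: "'e \<Rightarrow> 'e \<Rightarrow> real"
  assumes B_linear: "linear (B v)" and B_sym: "B v w = B w v"
begin

lemma B_linear_left: "linear (\<lambda>x. B x v)"
  using B_linear[of v] by (subst B_sym) simp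

lemmas B_simps = linear_add[OF B_linear] linear_add[OF B_linear_left]
  linear_diff[OF B_linear] linear_diff[OF B_linear_left]
  linear_scale[OF B_linear, unfolded real_scaleR_def]
  linear_scale[OF B_linear_left, unfolded real_scaleR_def]
  linear_0[OF B_linear] linear_0[OF B_linear_left]

text \<open>A minimizer of the Rayleigh quotient on the orthogonal complement of known eigenvectors is
  again an eigenvector.\<close>

lemma exists_next_eigenvector:
  assumes U: "orthonormal U" "\<And>u w. u \<in> U \<Longrightarrow> B u w = l u * G u w" and card: "card U < DIM('e)"
  shows "\<exists>x c. G x x = 1 \<and> (\<forall>u\<in>U. G x u = 0) \<and> (\<forall>w. B x w = c * G x w)"
proof -
  define S where "S = {x. \<forall>u\<in>U. G x u = 0}"
  have S: "subspace S" unfolding S_def by (rule subspaceI) (auto simp: G_simps)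
  have res: "y - (\<Sum>u\<in>U. G y u *\<^sub>R u) \<in> S" for y
  proof -
    have "G (y - (\<Sum>u\<in>U. G y u *\<^sub>R u)) v = 0" if v: "v \<in> U" for v
    proof -
      have "(\<Sum>u\<in>U. G y u * G u v) = (\<Sum>u\<in>U. if u = v then G y v else 0)"
        using U(1) v by (intro sum.cong) (auto simp: orthonormal_def)
      then show ?thesis using v orthonormal_finite[OF U(1)] by (simp add: G_simps G_sum)
    qed
    then show ?thesis by (simp add: S_def)
  qed
  have "span U \<noteq> UNIV" using orthonormal_card[OF U(1)] card by (metis dim_UNIV less_irrefl)
  then obtain y where y: "y \<notin> span U" by auto
  define y0 where "y0 = y - (\<Sum>u\<in>U. G y u *\<^sub>R u)"
  have "(\<Sum>u\<in>U. G y u *\<^sub>R u) \<in> span U" by (intro span_sum span_scale span_base)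
  then have y0: "y0 \<in> S" "y0 \<noteq> 0" using res y by (auto simp: y0_def)
  let ?K = "S \<inter> sphere 0 1"
  have K: "compact ?K" using closed_subspace[OF S] by (intro closed_Int_compact) auto
  have "(1 / norm y0) *\<^sub>R y0 \<in> ?K" using y0 subspace_scale[OF S] by auto
  then have Kne: "?K \<noteq> {}" by blast
  have "continuous_on ?K (\<lambda>x. B x x / G x x)"
    by (intro continuous_on_divide continuous_on_bilinear_form[OF B_linear B_linear_left]
        continuous_on_bilinear_form[OF linear_right linear_left] continuous_on_id) (auto simp: eq_0_iff)
  from continuous_attains_inf[OF K Kne this]
  obtain x where x: "x \<in> ?K" "\<And>z. z \<in> ?K \<Longrightarrow> B x x / G x x \<le> B z z / G z z" by blast
  define c where "c = B x x / G x x"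
  have x0: "x \<noteq> 0" using x(1) by auto
  have xS: "x \<in> S" using x(1) by simp
  have min: "0 \<le> B z z - c * G z z" if z: "z \<in> S" for z
  proof (cases "z = 0")
    case False
    have "(1 / norm z) *\<^sub>R z \<in> ?K" using z False subspace_scale[OF S] by auto
    from x(2)[OF this] have "c \<le> B z z / G z z"
      using False by (simp add: c_def B_simps G_simps)
    then show ?thesis using pos[OF False] by (simp add: field_simps)
  qed (simp add: B_simps G_simps)
  have xx: "B x x - c * G x x = 0" using pos[OF x0] by (simp add: c_def)
  have eigS: "B x w - c * G x w = 0" if w: "w \<in> S" for w
  proof (rule ccontr)
    define \<beta> where "\<beta> = B x w - c * G x w"
    define \<gamma> where "\<gamma> = B w w - c * G w w"
    assume "B x w - c * G x w \<noteq> 0"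
    then have \<beta>: "\<beta> \<noteq> 0" by (simp add: \<beta>_def)
    have q: "0 \<le> 2 * t * \<beta> + t\<^sup>2 * \<gamma>" for t
    proof -
      have "x + t *\<^sub>R w \<in> S" using xS w S by (simp add: subspace_add subspace_scale)
      from min[OF this] have "0 \<le> (B x x - c * G x x) + 2 * t * \<beta> + t\<^sup>2 * \<gamma>"
        unfolding \<beta>_def \<gamma>_def
        by (simp add: B_simps G_simps B_sym[of w x] sym[of w x] algebra_simps power2_eq_square)
      then show ?thesis using xx by simp
    qed
    have \<gamma>: "0 \<le> \<gamma>" using min[OF w] by (simp add: \<gamma>_def)
    \<comment> \<open>The value \<open>t = - \<beta> / (\<gamma> + 1)\<close> makes the quadratic
      negative; the added 1 covers \<open>\<gamma> = 0\<close>.\<close>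
    have "0 \<le> 2 * (- \<beta> / (\<gamma> + 1)) * \<beta> + (- \<beta> / (\<gamma> + 1))\<^sup>2 * \<gamma>" by (rule q)
    also have "\<dots> = - (\<beta>\<^sup>2 * (\<gamma> + 2)) / (\<gamma> + 1)\<^sup>2"
      using \<gamma> by (simp add: field_simps power2_eq_square add_nonneg_eq_0_iff)
    also have "\<dots> < 0" using \<gamma> \<beta> by (simp add: divide_neg_pos)
    finally show False by simp
  qed
  \<comment> \<open>The known eigenvectors are both \<open>B\<close>- and
    \<open>G\<close>-orthogonal to \<open>x\<close>, so the equation on \<open>S\<close> extends to
    every \<open>w\<close> by splitting off its component in the span of \<open>U\<close>.\<close>
  have eig: "B x w = c * G x w" for w
  proof -
    have ou: "G x u = 0" if "u \<in> U" for u using xS that by (simp add: S_def)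
    then have bu: "B x u = 0" if "u \<in> U" for u using U(2)[OF that, of x] that by (simp add: B_sym[of x] sym[of u])
    define s where "s = (\<Sum>u\<in>U. G w u *\<^sub>R u)"
    have "B x s = 0" "G x s = 0"
      unfolding s_def by (simp_all add: linear_sum[OF B_linear] G_sum B_simps G_simps bu ou)
    moreover have "B x (w - s) - c * G x (w - s) = 0" using eigS res unfolding s_def by blast
    ultimately show ?thesis by (simp add: B_simps G_simps)
  qed
  define x' where "x' = (1 / sqrt (G x x)) *\<^sub>R x"
  have "G x' x' = 1" "\<forall>u\<in>U. G x' u = 0" "\<forall>w. B x' w = c * G x' w"
    using pos[OF x0] xS by (auto simp: x'_def G_simps B_simps S_def eig)
  then show ?thesis by blast
qed

lemma exists_orthonormal_eigenvectors:
  assumes "k \<le> DIM('e)"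
  shows "\<exists>U l. orthonormal U \<and> card U = k \<and> (\<forall>u\<in>U. \<forall>w. B u w = l u * G u w)"
  using assms
proof (induction k)
  case 0
  show ?case by (intro exI[of _ "{}"]) (simp add: orthonormal_def)
next
  case (Suc k)
  then obtain U l where U: "orthonormal U" "card U = k" "\<forall>u\<in>U. \<forall>w. B u w = l u * G u w" by auto
  then obtain x c where x: "G x x = 1" "\<forall>u\<in>U. G x u = 0" "\<forall>w. B x w = c * G x w"
    using exists_next_eigenvector[of U l] Suc.prems by auto
  have xU: "x \<notin> U" using x U by auto
  have "orthonormal (insert x U)"
  proof -
    have "G u x = 0" if "u \<in> U" for u using x(2) that by (subst sym) blast
    then show ?thesis using U(1) x xU by (auto simp: orthonormal_def)
  qed
  moreover have "card (insert x U) = Suc k" using xU U orthonormal_finite by simp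
  moreover have "\<forall>u\<in>insert x U. \<forall>w. B u w = (l(x := c)) u * G u w" using U(3) x(3) xU by auto
  ultimately show ?case by blast
qed

text \<open>Eigenvectors to different eigenvalues are \<open>G\<close>-orthogonal, so the expansion
  of an eigenvector in \<open>U\<close> keeps only the vectors with eigenvalue
  \<open>c\<close>.\<close>

lemma eigenspace_eq_span:
  assumes U: "orthonormal U" "span U = UNIV" "\<And>u w. u \<in> U \<Longrightarrow> B u w = l u * G u w"
  shows "eigenspace G B c = span {u \<in> U. l u = c}"
proof
  have "subspace (eigenspace G B c)"
    by (rule subspaceI) (auto simp: eigenspace_def B_simps G_simps algebra_simps)
  then show "span {u \<in> U. l u = c} \<subseteq> eigenspace G B c"
    by (rule span_minimal[rotated]) (auto simp: eigenspace_def U(3))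
  show "eigenspace G B c \<subseteq> span {u \<in> U. l u = c}"
  proof
    fix v assume "v \<in> eigenspace G B c"
    then have "c * G v u = l u * G v u" if "u \<in> U" for u
      using U(3)[OF that, of v] unfolding eigenspace_def B_sym[of u v] sym[of u v] by auto
    then have 0: "G v u = 0" if "u \<in> U" "l u \<noteq> c" for u using that by fastforce
    have "v = (\<Sum>u\<in>U. G v u *\<^sub>R u)" using orthonormal_expansion[OF U(1)] U(2) by auto
    also have "\<dots> = (\<Sum>u\<in>{u \<in> U. l u = c}. G v u *\<^sub>R u)"
      using orthonormal_finite[OF U(1)] 0 by (intro sum.mono_neutral_right) auto
    also have "\<dots> \<in> span {u \<in> U. l u = c}" by (intro span_sum span_scale span_base)
    finally show "v \<in> span {u \<in> U. l u = c}" .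
  qed
qed

lemma dim_eigenspace:
  assumes U: "orthonormal U" "span U = UNIV" "\<And>u w. u \<in> U \<Longrightarrow> B u w = l u * G u w"
  shows "dim (eigenspace G B c) = card {u \<in> U. l u = c}"
proof -
  have "orthonormal {u \<in> U. l u = c}" using U(1) by (auto simp: orthonormal_def)
  then show ?thesis using eigenspace_eq_span[OF U, of c] orthonormal_card by metis
qed

text \<open>Both lists are sorted, and each value has the same multiplicity in both since the
  dimension of an eigenspace counts the vectors of \<open>U\<close> with that eigenvalue.\<close>

lemma eigenvalue_list_eq:
  assumes U: "orthonormal U" "span U = UNIV" "\<And>u w. u \<in> U \<Longrightarrow> B u w = l u * G u w"
  obtains us where "distinct us" "set us = U" "map l us = eigenvalue_list G B" "sorted (map l us)"
proof -
  have fin: "finite U" using orthonormal_finite U(1) .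
  obtain us0 where us0: "set us0 = U" "distinct us0" using finite_distinct_list[OF fin] by blast
  define us where "us = sort_key l us0"
  have card0: "(eigenspace G B c \<noteq> {0}) = (c \<in> l ` U)" for c
  proof -
    have sub: "subspace (eigenspace G B c)"
      by (rule subspaceI) (auto simp: eigenspace_def B_simps G_simps algebra_simps)
    then have "0 \<in> eigenspace G B c" by (rule subspace_0)
    then have "eigenspace G B c = {0} \<longleftrightarrow> eigenspace G B c \<subseteq> {0}" by (metis empty_iff insert_iff subset_singletonD subset_refl)
    then have "eigenspace G B c \<noteq> {0} \<longleftrightarrow> dim (eigenspace G B c) \<noteq> 0"
      by (simp add: dim_eq_0)
    also have "dim (eigenspace G B c) = card {u \<in> U. l u = c}" by (rule dim_eigenspace[OF U])
    also have "(\<dots> \<noteq> 0) = (c \<in> l ` U)" using fin by (auto simp: card_eq_0_iff)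
    finally show ?thesis .
  qed
  then have Seq: "{c. eigenspace G B c \<noteq> {0}} = l ` U" by auto
  have cnt: "count (mset (concat (map (\<lambda>c. replicate (d c) c) xs))) a = (if a \<in> set xs then d a else 0)"
    if "distinct xs" for d :: "real \<Rightarrow> nat" and xs a
    using that by (induction xs) auto
  have srt: "sorted (concat (map (\<lambda>c. replicate (d c) c) xs))"
    if "sorted xs" for d :: "real \<Rightarrow> nat" and xs
    using that by (induction xs) (auto simp: sorted_append)
  have "count (mset (map l us)) a = count (mset (eigenvalue_list G B)) a" for a
  proof -
    have "count (mset (map l us)) a = count (image_mset l (mset_set U)) a"
      using us0 by (simp add: us_def mset_set_set[symmetric])
    also have "\<dots> = card {u \<in> U. l u = a}"
      using fin by (simp add: count_image_mset' Collect_conj_eq Int_commute card_eq_sum[symmetric] eq_commute)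
    also have "\<dots> = count (mset (eigenvalue_list G B)) a"
      unfolding eigenvalue_list_def Seq using fin by (subst cnt) (auto simp: dim_eigenspace[OF U])
    finally show ?thesis .
  qed
  then have "mset (map l us) = mset (eigenvalue_list G B)" by (rule multiset_eqI)
  moreover have s: "sorted (map l us)" by (simp add: us_def)
  moreover have "sorted (eigenvalue_list G B)"
    unfolding eigenvalue_list_def using srt by simp
  ultimately have "map l us = eigenvalue_list G B"
    by (metis properties_for_sort)
  then show ?thesis using that[of us] us0 s by (simp add: us_def)
qed

lemma Bessel:
  assumes "orthonormal E" shows "(\<Sum>e\<in>E. (G x e)\<^sup>2) \<le> G x x"
proof -
  define s where "s = (\<Sum>e\<in>E. G x e *\<^sub>R e)"
  have xs: "G x s = (\<Sum>e\<in>E. (G x e)\<^sup>2)"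
    by (simp add: s_def G_sum G_simps power2_eq_square)
  have "s \<in> span E" unfolding s_def by (intro span_sum span_scale span_base)
  have se: "G s e = G x e" if "e \<in> E" for e
  proof -
    have "(\<Sum>f\<in>E. G x f * G f e) = (\<Sum>f\<in>E. if f = e then G x e else 0)"
      using assms that by (intro sum.cong) (auto simp: orthonormal_def)
    then show ?thesis using that orthonormal_finite[OF assms] by (simp add: s_def G_sum G_simps)
  qed
  have "G s s = (\<Sum>e\<in>E. G x e * G s e)"
    by (subst (2) s_def) (simp add: G_sum G_simps)
  then have ss: "G s s = G x s" by (simp add: se xs power2_eq_square)
  have "0 \<le> G (x - s) (x - s)" by (rule nonneg)
  then show ?thesis using ss by (simp add: G_simps sym[of s x] xs)
qed

text \<open>Ky Fan's principle. In an eigenbasis the trace is a weighted sum of the eigenvalues; the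
  weight of \<open>u\<close> is the squared length of its projection onto the span of
  \<open>E\<close>, at most 1 by Bessel, and the weights sum to \<open>m\<close>. The estimate is
  then \<open>sum_lowest_le_weighted_sum\<close>.\<close>

theorem Trace_lowest_le_trace:
  assumes E: "orthonormal E" and m: "card E = m"
  shows "Trace_lowest m G B \<le> (\<Sum>e\<in>E. B e e)"
proof -
  obtain U l where U: "orthonormal U" "card U = DIM('e)" "\<And>u w. u \<in> U \<Longrightarrow> B u w = l u * G u w"
    using exists_orthonormal_eigenvectors[of "DIM('e)"] by auto
  have spU: "span U = UNIV"
    using orthonormal_card[OF U(1)] U(2) by (metis dim_eq_full span_span)
  obtain us where us: "distinct us" "set us = U" "map l us = eigenvalue_list G B" "sorted (map l us)"
    using eigenvalue_list_eq[OF U(1) spU U(3)] by blast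
  define n where "n = length us"
  have n: "n = DIM('e)" using us U(2) by (simp add: n_def distinct_card[symmetric])
  have mn: "m \<le> n" using orthonormal_card[OF E] m dim_subset_UNIV[of "span E"] n by simp
  have bij: "bij_betw ((!) us) {..<n} U"
    using us bij_betw_nth[OF us(1)] by (simp add: n_def)
  define w where "w u = (\<Sum>e\<in>E. (G e u)\<^sup>2)" for u
  have trace: "(\<Sum>e\<in>E. B e e) = (\<Sum>u\<in>U. l u * w u)"
  proof -
    have "B e e = (\<Sum>u\<in>U. l u * (G e u)\<^sup>2)" for e
    proof -
      have "B e e = B (\<Sum>u\<in>U. G e u *\<^sub>R u) e"
        using orthonormal_expansion[OF U(1), of e] spU by simp
      also have "\<dots> = (\<Sum>u\<in>U. G e u * B u e)"
        by (simp add: linear_sum[OF B_linear_left] B_simps)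
      also have "\<dots> = (\<Sum>u\<in>U. l u * (G e u)\<^sup>2)"
        by (intro sum.cong refl) (simp add: U(3) sym[of _ e] power2_eq_square)
      finally show ?thesis .
    qed
    then show ?thesis unfolding w_def by (simp add: sum_distrib_left) (subst sum.swap, simp)
  qed
  have w01: "0 \<le> w u \<and> w u \<le> 1" if "u \<in> U" for u
  proof
    have "w u = (\<Sum>e\<in>E. (G u e)\<^sup>2)" unfolding w_def by (intro sum.cong refl) (subst sym, rule refl)
    also have "\<dots> \<le> G u u" by (rule Bessel[OF E])
    also have "\<dots> = 1" using that U(1) by (auto simp: orthonormal_def)
    finally show "w u \<le> 1" .
  qed (simp add: w_def sum_nonneg)
  have "(\<Sum>u\<in>U. w u) = (\<Sum>e\<in>E. \<Sum>u\<in>U. (G e u)\<^sup>2)" unfolding w_def by (rule sum.swap)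
  also have "\<dots> = (\<Sum>e\<in>E. G e e)"
  proof (rule sum.cong[OF refl])
    fix e
    have "G e e = (\<Sum>u\<in>U. G e u * G u e)" by (rule orthonormal_Parseval[OF U(1)]) (simp add: spU)
    also have "\<dots> = (\<Sum>u\<in>U. (G e u)\<^sup>2)"
      unfolding power2_eq_square by (intro sum.cong refl arg_cong2[where f="(*)"]) (rule sym)
    finally show "(\<Sum>u\<in>U. (G e u)\<^sup>2) = G e e" by simp
  qed
  also have "\<dots> = real m" using E m by (simp add: orthonormal_def)
  finally have wm: "(\<Sum>u\<in>U. w u) = real m" .
  have "Trace_lowest m G B = (\<Sum>i<m. l (us ! i))"
    unfolding Trace_lowest_def us(3)[symmetric] using mn
    by (auto simp: sum_list_sum_nth n_def take_map atLeast0LessThan min_absorb2 intro!: sum.cong)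
  also have "\<dots> \<le> (\<Sum>i<n. l (us ! i) * w (us ! i))"
  proof (rule sum_lowest_le_weighted_sum[OF _ _ _ mn])
    show "l (us ! i) \<le> l (us ! j)" if "i \<le> j" "j < n" for i j
      using sorted_nth_mono[OF us(4)] that by (simp add: n_def)
    show "0 \<le> w (us ! i) \<and> w (us ! i) \<le> 1" if "i < n" for i
      using that us(2) by (intro w01) (auto simp: n_def)
    show "(\<Sum>i<n. w (us ! i)) = real m"
      using sum.reindex_bij_betw[OF bij, of w] wm by simp
  qed
  also have "\<dots> = (\<Sum>u\<in>U. l u * w u)"
    using sum.reindex_bij_betw[OF bij, of "\<lambda>u. l u * w u"] by simp
  finally show ?thesis using trace by simp
qed

end

section \<open>Metrics on open subsets of a Euclidean space\<close>

text \<open>Coordinate picture of the metric in a single chart. The local analysis takes place here,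
  free of preferred charts, and reaches the manifold through
  \<open>metric_domain_chart\<close>.\<close>

locale metric_domain =
  fixes V :: "'e::euclidean_space set" and g :: "'e \<Rightarrow> 'e \<Rightarrow> 'e \<Rightarrow> real"
  assumes open_V: "open V" and ip_g: "y \<in> V \<Longrightarrow> inner_product_form (g y)"
    and C2_g: "Ck_on 2 (\<lambda>y. g y a b) V"
begin

lemma ip_form_g: "y \<in> V \<Longrightarrow> ip_form (g y)"
  by (simp add: ip_form_def ip_g)

lemma C1_g: "Ck_on 1 (\<lambda>y. g y a b) V"
  using C2_g C2_on_imp_C1_on by blast

abbreviation Dg :: "'e \<Rightarrow> 'e \<Rightarrow> 'e \<Rightarrow> 'e \<Rightarrow> real" where
  "Dg y a b v \<equiv> frechet_derivative (\<lambda>z. g z a b) (at y) v"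

text \<open>Regularity of \<open>g\<close> is known only for fixed arguments; the coefficients on
  \<open>Basis\<close> carry it over to moving ones.\<close>

lemma g_expansion:
  assumes "y \<in> V" shows "g y a b = (\<Sum>i\<in>Basis. \<Sum>j\<in>Basis. (a \<bullet> i) * (b \<bullet> j) * g y i j)"
proof -
  interpret ip_form "g y" using ip_form_g assms .
  have "g y i b = (\<Sum>j\<in>Basis. (b \<bullet> j) * g y i j)" for i
    using linear_basis_expansion[OF linear_right, of i b] by simp
  moreover have "g y a b = (\<Sum>i\<in>Basis. (a \<bullet> i) * g y i b)"
    using linear_basis_expansion[OF linear_left, of a b] by simp
  ultimately show ?thesis by (simp add: sum_distrib_left mult.assoc)
qed

lemma Dg_has_derivative: "y \<in> V \<Longrightarrow> ((\<lambda>z. g z a b) has_derivative Dg y a b) (at y)"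
  using C1_on_has_derivative[OF C1_g] .

lemma Dg_expansion:
  assumes "y \<in> V" shows "Dg y a b v = (\<Sum>i\<in>Basis. \<Sum>j\<in>Basis. (a \<bullet> i) * (b \<bullet> j) * Dg y i j v)"
proof -
  have "((\<lambda>z. \<Sum>i\<in>Basis. \<Sum>j\<in>Basis. (a \<bullet> i) * (b \<bullet> j) * g z i j) has_derivative
      (\<lambda>v. \<Sum>i\<in>Basis. \<Sum>j\<in>Basis. (a \<bullet> i) * (b \<bullet> j) * Dg y i j v)) (at y)"
    by (intro has_derivative_sum has_derivative_mult_right Dg_has_derivative assms)
  then have "((\<lambda>z. g z a b) has_derivative
      (\<lambda>v. \<Sum>i\<in>Basis. \<Sum>j\<in>Basis. (a \<bullet> i) * (b \<bullet> j) * Dg y i j v)) (at y)"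
    by (rule has_derivative_transform_within_open[OF _ open_V assms]) (rule g_expansion[symmetric])
  from fun_cong[OF frechet_derivative_at[OF this], of v] show ?thesis by simp
qed

lemma Dg_linear: "y \<in> V \<Longrightarrow> linear (Dg y a b)"
  using Dg_has_derivative has_derivative_linear by blast

lemma Dg_linear_right: "y \<in> V \<Longrightarrow> linear (\<lambda>b. Dg y a b v)"
proof -
  assume y: "y \<in> V"
  show ?thesis
    unfolding Dg_expansion[OF y, of a _ v]
    by (rule linearI) (auto simp: inner_add_left algebra_simps sum.distrib sum_distrib_left)
qed

lemma Dg_sym: "y \<in> V \<Longrightarrow> Dg y a b v = Dg y b a v"
proof -
  assume y: "y \<in> V"
  have "((\<lambda>z. g z b a) has_derivative Dg y a b) (at y)"
    by (rule has_derivative_transform_within_open[OF Dg_has_derivative[OF y] open_V y])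
       (rule ip_form.sym[OF ip_form_g])
  then show ?thesis using frechet_derivative_at by metis
qed

lemma Dg_linear_left: "y \<in> V \<Longrightarrow> linear (\<lambda>a. Dg y a b v)"
  using Dg_linear_right by (subst Dg_sym) auto

text \<open>The base point moves along \<open>u\<close> too, as required to differentiate a metric
  pulled back by a coordinate change.\<close>

lemma has_derivative_g:
  assumes u: "(u has_derivative u') (at y)" "u y \<in> V" and "open T" "y \<in> T" "u ` T \<subseteq> V"
    and a: "(a has_derivative a') (at y)" and b: "(b has_derivative b') (at y)"
  shows "((\<lambda>z. g (u z) (a z) (b z)) has_derivative
    (\<lambda>v. Dg (u y) (a y) (b y) (u' v) + g (u y) (a' v) (b y) + g (u y) (a y) (b' v))) (at y)"
proof -
  have d: "((\<lambda>z. g (u z) i j) has_derivative (\<lambda>v. Dg (u y) i j (u' v))) (at y)" for i j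
    using has_derivative_compose[OF u(1) Dg_has_derivative[OF u(2)]] .
  have "((\<lambda>z. \<Sum>i\<in>Basis. \<Sum>j\<in>Basis. ((a z \<bullet> i) * (b z \<bullet> j)) * g (u z) i j) has_derivative
      (\<lambda>v. \<Sum>i\<in>Basis. \<Sum>j\<in>Basis. ((a y \<bullet> i) * (b y \<bullet> j)) * Dg (u y) i j (u' v)
         + ((a y \<bullet> i) * (b' v \<bullet> j) + (a' v \<bullet> i) * (b y \<bullet> j)) * g (u y) i j)) (at y)"
    by (intro has_derivative_sum has_derivative_mult has_derivative_inner_left a b d)
  then have "((\<lambda>z. g (u z) (a z) (b z)) has_derivative
      (\<lambda>v. \<Sum>i\<in>Basis. \<Sum>j\<in>Basis. ((a y \<bullet> i) * (b y \<bullet> j)) * Dg (u y) i j (u' v)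
         + ((a y \<bullet> i) * (b' v \<bullet> j) + (a' v \<bullet> i) * (b y \<bullet> j)) * g (u y) i j)) (at y)"
    by (rule has_derivative_transform_within_open[OF _ assms(3,4)])
       (rule g_expansion[symmetric], use assms(5) in blast)
  moreover have "(\<lambda>v. \<Sum>i\<in>Basis. \<Sum>j\<in>Basis. ((a y \<bullet> i) * (b y \<bullet> j)) * Dg (u y) i j (u' v)
         + ((a y \<bullet> i) * (b' v \<bullet> j) + (a' v \<bullet> i) * (b y \<bullet> j)) * g (u y) i j)
      = (\<lambda>v. Dg (u y) (a y) (b y) (u' v) + g (u y) (a' v) (b y) + g (u y) (a y) (b' v))"
    unfolding Dg_expansion[OF u(2), of "a y" "b y"] g_expansion[OF u(2), of "a y"]
      g_expansion[OF u(2), of _ "b y"]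
    by (simp add: sum.distrib distrib_right add.commute add.left_commute)
  ultimately show ?thesis by simp
qed

lemma C1_on_g:
  assumes "open T" "Ck_on 1 u T" "u ` T \<subseteq> V" "Ck_on 1 a T" "Ck_on 1 b T"
  shows "Ck_on 1 (\<lambda>z. g (u z) (a z) (b z)) T"
proof (rule C1_on_cong[OF _ assms(1)])
  show "Ck_on 1 (\<lambda>z. \<Sum>i\<in>Basis. \<Sum>j\<in>Basis. (a z \<bullet> i) * (b z \<bullet> j) * g (u z) i j) T"
    by (intro C1_on_sum C1_on_mult C1_on_inner assms C1_on_const C1_on_compose[OF C1_g assms(2,3)])
  show "(\<Sum>i\<in>Basis. \<Sum>j\<in>Basis. (a z \<bullet> i) * (b z \<bullet> j) * g (u z) i j) = g (u z) (a z) (b z)"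
    if "z \<in> T" for z using assms(3) that by (intro g_expansion[symmetric]) auto
qed

lemma continuous_on_g:
  assumes "continuous_on T u" "u ` T \<subseteq> V" "continuous_on T a" "continuous_on T b"
  shows "continuous_on T (\<lambda>z. g (u z) (a z) (b z))"
proof -
  have "continuous_on T (\<lambda>z. \<Sum>i\<in>Basis. \<Sum>j\<in>Basis. (a z \<bullet> i) * (b z \<bullet> j) * g (u z) i j)"
    by (intro continuous_intros assms
        continuous_on_compose2[OF C1_on_continuous_on[OF C1_g] assms(1,2)])
  then show ?thesis
    by (rule continuous_on_eq) (rule g_expansion[symmetric], use assms(2) in blast)
qed

lemma continuous_on_Dg:
  assumes "continuous_on T u" "u ` T \<subseteq> V" "continuous_on T a" "continuous_on T b" "continuous_on T v"
  shows "continuous_on T (\<lambda>z. Dg (u z) (a z) (b z) (v z))"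
proof -
  have "continuous_on T (\<lambda>z. \<Sum>i\<in>Basis. \<Sum>j\<in>Basis. (a z \<bullet> i) * (b z \<bullet> j) * Dg (u z) i j (v z))"
    by (intro continuous_intros assms C1_on_continuous_deriv_apply[OF C1_g])
  then show ?thesis
    by (rule continuous_on_eq) (rule Dg_expansion[symmetric], use assms(2) in blast)
qed

text \<open>Half of the Lie derivative of the metric along \<open>\<xi>\<close>, up to an antisymmetric term.  On the
  diagonal it is \<open>g(\<nabla>\<^sub>v \<xi>, v)\<close>, so its trace over a plane is the divergence, and unlike the
  covariant derivative it does not involve the Christoffel symbols.\<close>

definition lie_form :: "('e \<Rightarrow> 'e) \<Rightarrow> 'e \<Rightarrow> 'e \<Rightarrow> 'e \<Rightarrow> real" where
  "lie_form \<xi> y v w = Dg y v w (\<xi> y) / 2 + g y (frechet_derivative \<xi> (at y) v) w"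

lemma lie_form_linear:
  assumes "y \<in> V" "\<xi> differentiable at y"
  shows "linear (lie_form \<xi> y v)" "linear (\<lambda>x. lie_form \<xi> y x v)"
proof -
  interpret ip_form "g y" using ip_form_g assms(1) .
  have lin: "linear (frechet_derivative \<xi> (at y))"
    using assms(2) frechet_derivative_works has_derivative_linear by blast
  have "linear (\<lambda>w. Dg y v w (\<xi> y) / 2)" "linear (\<lambda>x. Dg y x v (\<xi> y) / 2)"
    using linear_compose[OF Dg_linear_right[OF assms(1)] linear_times[of "1/2"]]
      linear_compose[OF Dg_linear_left[OF assms(1)] linear_times[of "1/2"]]
    by (simp_all add: o_def)
  then show "linear (lie_form \<xi> y v)" "linear (\<lambda>x. lie_form \<xi> y x v)"
    unfolding lie_form_def[abs_def]
    using linear_right linear_compose[OF lin linear_left] by (auto intro!: linear_compose_add simp: o_def)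
qed

text \<open>Koszul formula: the right side is linear in \<open>w\<close>, so it is represented by a
  unique vector. This makes the \<open>THE\<close> in \<open>christoffel\<close> meaningful.\<close>

lemma christoffel_ex1:
  assumes "y \<in> V"
  shows "\<exists>!u. \<forall>w. 2 * g y u w = Dg y b w a + Dg y a w b - Dg y a b w"
proof -
  interpret ip_form "g y" using ip_form_g assms .
  define \<rho> where "\<rho> w = Dg y b w a + Dg y a w b - Dg y a b w" for w
  have lin: "linear \<rho>"
    unfolding \<rho>_def[abs_def]
    by (intro linear_compose_add linear_compose_sub Dg_linear_right Dg_linear assms)
  obtain E where E: "orthonormal E" "span E = UNIV" using exists_orthonormal_basis[OF subspace_UNIV] .
  have "2 * g y (\<Sum>e\<in>E. (\<rho> e / 2) *\<^sub>R e) w = \<rho> w" for w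
  proof -
    have "w = (\<Sum>e\<in>E. g y w e *\<^sub>R e)" using orthonormal_expansion[OF E(1)] E(2) by auto
    then have "\<rho> w = \<rho> (\<Sum>e\<in>E. g y w e *\<^sub>R e)" by simp
    also have "\<dots> = (\<Sum>e\<in>E. g y w e * \<rho> e)" by (simp add: linear_sum[OF lin] linear_scale[OF lin])
    also have "\<dots> = 2 * g y (\<Sum>e\<in>E. (\<rho> e / 2) *\<^sub>R e) w"
      by (simp add: G_sum G_simps sum_distrib_left) (intro sum.cong refl, subst sym, simp)
    finally show ?thesis by simp
  qed
  moreover have "u = u'" if "\<forall>w. 2 * g y u w = \<rho> w" "\<forall>w. 2 * g y u' w = \<rho> w" for u u'
  proof -
    have "g y u w = g y u' w" for w using that[rule_format, of w] by linarith
    then have "g y (u - u') (u - u') = 0" by (simp add: G_simps)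
    then show ?thesis by (simp add: eq_0_iff)
  qed
  ultimately show ?thesis unfolding \<rho>_def by blast
qed

end

section \<open>Charts of a Riemannian manifold\<close>

abbreviation cimg :: "('a, 'e) chart \<Rightarrow> 'e set" where "cimg c \<equiv> cmap c ` cdom c"

locale riemannian =
  fixes \<Omega> :: "('a::{t2_space, second_countable_topology}, 'e::euclidean_space) riemannian_structure"
  assumes riem: "riemannian_manifold \<Omega>"
begin

lemma is_chart: "c \<in> atlas \<Omega> \<Longrightarrow> is_chart c"
  and chart_at: "chart_at \<Omega> x \<in> atlas \<Omega>" "x \<in> cdom (chart_at \<Omega> x)"
  and ip_metric_at: "inner_product_form (metric_at \<Omega> x)"
  and smooth_transition: "c \<in> atlas \<Omega> \<Longrightarrow> d \<in> atlas \<Omega> \<Longrightarrow>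
    smooth_on (cmap d \<circ> cinv c) (cmap c ` (cdom c \<inter> cdom d))"
  and smooth_metric_in: "c \<in> atlas \<Omega> \<Longrightarrow> smooth_on (\<lambda>y. metric_in \<Omega> c y a b) (cimg c)"
  using riem unfolding riemannian_manifold_def by blast+

lemma ip_form_metric_at: "ip_form (metric_at \<Omega> x)"
  by (simp add: ip_form_def ip_metric_at)

context
  fixes c assumes c: "c \<in> atlas \<Omega>"
begin

lemma open_cdom: "open (cdom c)" and open_cimg: "open (cimg c)"
  and homeo: "homeomorphism (cdom c) (cimg c) (cmap c) (cinv c)"
  using is_chart[OF c] unfolding is_chart_def by auto

lemma cinv_cmap: "x \<in> cdom c \<Longrightarrow> cinv c (cmap c x) = x"
  and cmap_cinv: "y \<in> cimg c \<Longrightarrow> cmap c (cinv c y) = y"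
  and cinv_in: "y \<in> cimg c \<Longrightarrow> cinv c y \<in> cdom c"
  using homeo unfolding homeomorphism_def by auto

lemma continuous_cmap: "continuous_on (cdom c) (cmap c)"
  and continuous_cinv: "continuous_on (cimg c) (cinv c)"
  using homeo unfolding homeomorphism_def by auto

lemma open_cinv_image: "open U \<Longrightarrow> U \<subseteq> cimg c \<Longrightarrow> open (cinv c ` U)"
proof -
  assume U: "open U" "U \<subseteq> cimg c"
  have "cinv c ` U = cdom c \<inter> cmap c -` U"
    using U(2) cinv_in cmap_cinv cinv_cmap by (auto simp: image_iff) (metis)
  then show ?thesis
    using continuous_on_open_vimage[OF open_cdom] continuous_cmap U(1) by (metis Int_commute)
qed

lemma open_cmap_image: "open U \<Longrightarrow> open (cmap c ` (cdom c \<inter> U))"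
proof -
  assume U: "open U"
  have "cmap c ` (cdom c \<inter> U) = cimg c \<inter> cinv c -` U"
    using cinv_in cmap_cinv cinv_cmap by (auto simp: image_iff)
  then show ?thesis
    using continuous_on_open_vimage[OF open_cimg] continuous_cinv U by (metis Int_commute)
qed

end

section \<open>Change of coordinates for tangent vectors and the metric\<close>

lemma coord_change_has_derivative:
  assumes "c \<in> atlas \<Omega>" "d \<in> atlas \<Omega>" "x \<in> cdom c" "x \<in> cdom d"
  shows "((cmap d \<circ> cinv c) has_derivative coord_change c d x) (at (cmap c x))"
  unfolding coord_change_def
  using assms by (intro C1_on_has_derivative[OF smooth_on_C1_on[OF smooth_transition]]) auto

lemma coord_change_linear:
  assumes "c \<in> atlas \<Omega>" "d \<in> atlas \<Omega>" "x \<in> cdom c" "x \<in> cdom d"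
  shows "linear (coord_change c d x)"
  using coord_change_has_derivative[OF assms] has_derivative_linear by blast

lemma coord_change_compose:
  assumes "c \<in> atlas \<Omega>" "d \<in> atlas \<Omega>" "e \<in> atlas \<Omega>" "x \<in> cdom c" "x \<in> cdom d" "x \<in> cdom e"
  shows "coord_change d e x (coord_change c d x v) = coord_change c e x v"
proof -
  have "((cmap d \<circ> cinv c) has_derivative coord_change c d x) (at (cmap c x))"
    by (rule coord_change_has_derivative) (use assms in auto)
  moreover have "((cmap e \<circ> cinv d) has_derivative coord_change d e x) (at ((cmap d \<circ> cinv c) (cmap c x)))"
    using coord_change_has_derivative[of d e x] assms cinv_cmap by simp
  ultimately have "((\<lambda>z. (cmap e \<circ> cinv d) ((cmap d \<circ> cinv c) z)) has_derivative
      (\<lambda>v. coord_change d e x (coord_change c d x v))) (at (cmap c x))"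
    by (rule has_derivative_compose)
  then have "((cmap e \<circ> cinv c) has_derivative
      (\<lambda>v. coord_change d e x (coord_change c d x v))) (at (cmap c x))"
  proof (rule has_derivative_transform_within_open[OF _ open_cmap_image[of c "cdom d"]])
    show "c \<in> atlas \<Omega>" "open (cdom d)" "cmap c x \<in> cmap c ` (cdom c \<inter> cdom d)"
      using assms open_cdom by auto
    show "(cmap e \<circ> cinv d) ((cmap d \<circ> cinv c) z) = (cmap e \<circ> cinv c) z"
      if "z \<in> cmap c ` (cdom c \<inter> cdom d)" for z
      using that assms cinv_cmap by auto
  qed
  then show ?thesis
    unfolding coord_change_def[of c e] using frechet_derivative_at by metis
qed

lemma coord_change_same:
  assumes "c \<in> atlas \<Omega>" "x \<in> cdom c" shows "coord_change c c x v = v"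
proof -
  have "((\<lambda>z. z) has_derivative (\<lambda>v. v)) (at (cmap c x))" by (rule has_derivative_ident)
  then have "((cmap c \<circ> cinv c) has_derivative (\<lambda>v. v)) (at (cmap c x))"
    by (rule has_derivative_transform_within_open[OF _ open_cimg[OF assms(1)]])
       (use assms cmap_cinv in auto)
  then show ?thesis unfolding coord_change_def using frechet_derivative_at by metis
qed

lemma coord_change_inverse:
  assumes "c \<in> atlas \<Omega>" "d \<in> atlas \<Omega>" "x \<in> cdom c" "x \<in> cdom d"
  shows "coord_change d c x (coord_change c d x v) = v"
  using coord_change_compose[of c d c x v] coord_change_same assms by simp

lemma to_chart_linear: "c \<in> atlas \<Omega> \<Longrightarrow> x \<in> cdom c \<Longrightarrow> linear (to_chart \<Omega> c x)"
  and of_chart_linear: "c \<in> atlas \<Omega> \<Longrightarrow> x \<in> cdom c \<Longrightarrow> linear (of_chart \<Omega> c x)"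
  and to_of_chart: "c \<in> atlas \<Omega> \<Longrightarrow> x \<in> cdom c \<Longrightarrow> to_chart \<Omega> c x (of_chart \<Omega> c x v) = v"
  and of_to_chart: "c \<in> atlas \<Omega> \<Longrightarrow> x \<in> cdom c \<Longrightarrow> of_chart \<Omega> c x (to_chart \<Omega> c x v) = v"
  unfolding to_chart_def of_chart_def
  by (auto intro: coord_change_linear coord_change_inverse chart_at)

lemma coord_change_to_chart:
  "c \<in> atlas \<Omega> \<Longrightarrow> d \<in> atlas \<Omega> \<Longrightarrow> x \<in> cdom c \<Longrightarrow> x \<in> cdom d \<Longrightarrow>
    coord_change c d x (to_chart \<Omega> c x v) = to_chart \<Omega> d x v"
  unfolding to_chart_def by (intro coord_change_compose chart_at)

lemma of_chart_coord_change:
  "c \<in> atlas \<Omega> \<Longrightarrow> d \<in> atlas \<Omega> \<Longrightarrow> x \<in> cdom c \<Longrightarrow> x \<in> cdom d \<Longrightarrow>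
    of_chart \<Omega> d x (coord_change c d x v) = of_chart \<Omega> c x v"
  unfolding of_chart_def by (intro coord_change_compose chart_at)

lemma to_chart_preferred: "to_chart \<Omega> (chart_at \<Omega> x) x v = v"
  unfolding to_chart_def by (intro coord_change_same chart_at)

lemma metric_in_to_chart:
  assumes "c \<in> atlas \<Omega>" "x \<in> cdom c"
  shows "metric_in \<Omega> c (cmap c x) (to_chart \<Omega> c x v) (to_chart \<Omega> c x w) = metric_at \<Omega> x v w"
  using assms by (simp add: metric_in_def cinv_cmap of_to_chart)

lemma metric_in_preferred:
  "metric_in \<Omega> (chart_at \<Omega> x) (cmap (chart_at \<Omega> x) x) v w = metric_at \<Omega> x v w"
  using metric_in_to_chart[OF chart_at, of x v w] by (simp add: to_chart_preferred)

lemma metric_in_coord_change: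
  assumes "c \<in> atlas \<Omega>" "d \<in> atlas \<Omega>" "x \<in> cdom c" "x \<in> cdom d"
  shows "metric_in \<Omega> d (cmap d x) (coord_change c d x a) (coord_change c d x b)
    = metric_in \<Omega> c (cmap c x) a b"
  using assms by (simp add: metric_in_def cinv_cmap of_chart_coord_change)

lemma metric_domain_chart:
  assumes c: "c \<in> atlas \<Omega>" shows "metric_domain (cimg c) (metric_in \<Omega> c)"
proof
  show "open (cimg c)" using open_cimg c .
  show "Ck_on 2 (\<lambda>y. metric_in \<Omega> c y a b) (cimg c)" for a b
    using smooth_metric_in[OF c] smooth_on_C2_on by blast
  fix y assume y: "y \<in> cimg c"
  define x where "x = cinv c y"
  have x: "x \<in> cdom c" "cmap c x = y" using cinv_in cmap_cinv c y by (auto simp: x_def)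
  interpret ip_form "metric_at \<Omega> x" by (rule ip_form_metric_at)
  have eq: "metric_in \<Omega> c y a b = metric_at \<Omega> x (of_chart \<Omega> c x a) (of_chart \<Omega> c x b)" for a b
    by (simp add: metric_in_def x_def)
  have lin: "linear (of_chart \<Omega> c x)" using of_chart_linear c x by blast
  have "of_chart \<Omega> c x v \<noteq> 0" if "v \<noteq> 0" for v
    using to_of_chart[OF c x(1), of v] that linear_0[OF to_chart_linear[OF c x(1)]] by auto
  then show "inner_product_form (metric_in \<Omega> c y)"
    unfolding inner_product_form_def eq
    using linear_compose[OF lin linear_right] sym pos by (auto simp: o_def eq[abs_def])
qed

lemma ip_form_metric_in: "c \<in> atlas \<Omega> \<Longrightarrow> y \<in> cimg c \<Longrightarrow> ip_form (metric_in \<Omega> c y)"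
  using metric_domain.ip_form_g[OF metric_domain_chart] .

section \<open>Divergence computed in an arbitrary chart\<close>

abbreviation lie :: "('a, 'e) chart \<Rightarrow> ('a \<Rightarrow> 'e) \<Rightarrow> 'e \<Rightarrow> 'e \<Rightarrow> 'e \<Rightarrow> real" where
  "lie c X \<equiv> metric_domain.lie_form (metric_in \<Omega> c) (field_in \<Omega> c X)"

lemma C1_field_differentiable:
  assumes "C1_field \<Omega> X" "c \<in> atlas \<Omega>" "y \<in> cimg c"
  shows "(field_in \<Omega> c X has_derivative frechet_derivative (field_in \<Omega> c X) (at y)) (at y)"
  using C1_on_has_derivative assms unfolding C1_field_def by blast

text \<open>Differentiating the pulled-back metric produces the second derivative
  \<open>D2 v (\<xi> ?y)\<close> of the transition map, and differentiating the transformed field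
  produces \<open>D2 (\<xi> ?y) v\<close>, which enters with the opposite sign. They cancel by
  symmetry, so Christoffel symbols never have to be transformed.\<close>

lemma lie_coord_change:
  assumes X: "C1_field \<Omega> X" and c: "c \<in> atlas \<Omega>" and d: "d \<in> atlas \<Omega>" and x: "x \<in> cdom c" "x \<in> cdom d"
  shows "lie c X (cmap c x) v v
    = lie d X (cmap d x) (coord_change c d x v) (coord_change c d x v)"
proof -
  interpret mc: metric_domain "cimg c" "metric_in \<Omega> c" by (rule metric_domain_chart[OF c])
  interpret md: metric_domain "cimg d" "metric_in \<Omega> d" by (rule metric_domain_chart[OF d])
  define \<psi> where "\<psi> = cmap d \<circ> cinv c"
  define U where "U = cmap c ` (cdom c \<inter> cdom d)"
  define \<xi> where "\<xi> = field_in \<Omega> c X"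
  define \<eta> where "\<eta> = field_in \<Omega> d X"
  define D\<psi> where "D\<psi> z = frechet_derivative \<psi> (at z)" for z
  define D2 where "D2 v w = frechet_derivative (\<lambda>z. D\<psi> z v) (at (cmap c x)) w" for v w
  let ?y = "cmap c x"
  let ?w = "D\<psi> ?y v"
  let ?gd = "metric_in \<Omega> d (cmap d x)"
  interpret ip_form ?gd using ip_form_metric_in[OF d] x by blast
  have U: "open U" "?y \<in> U" unfolding U_def using open_cmap_image[OF c open_cdom[OF d]] x by auto
  have y: "?y \<in> cimg c" using x by blast
  have C2: "Ck_on 2 \<psi> U" unfolding \<psi>_def U_def by (rule smooth_on_C2_on[OF smooth_transition[OF c d]])
  have \<psi>U: "\<psi> ` U \<subseteq> cimg d" unfolding \<psi>_def U_def using cinv_cmap[OF c] by auto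
  have \<psi>y: "\<psi> ?y = cmap d x" using cinv_cmap[OF c] x by (simp add: \<psi>_def)
  have cc: "coord_change c d x = D\<psi> ?y" by (simp add: coord_change_def D\<psi>_def \<psi>_def)
  have gU: "metric_in \<Omega> c z a b = metric_in \<Omega> d (\<psi> z) (D\<psi> z a) (D\<psi> z b)" if "z \<in> U" for z a b
    using that metric_in_coord_change[OF c d, symmetric] cinv_cmap[OF c]
    by (auto simp: U_def \<psi>_def D\<psi>_def coord_change_def)
  have \<eta>U: "\<eta> (\<psi> z) = D\<psi> z (\<xi> z)" if "z \<in> U" for z
    using that coord_change_to_chart[OF c d, symmetric] cinv_cmap[OF c] cinv_cmap[OF d]
    by (auto simp: U_def \<psi>_def D\<psi>_def coord_change_def \<xi>_def \<eta>_def field_in_def)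
  have d\<psi>: "(\<psi> has_derivative D\<psi> ?y) (at ?y)"
    unfolding D\<psi>_def by (rule C1_on_has_derivative[OF C2_on_imp_C1_on[OF C2] U(2)])
  have dD\<psi>: "((\<lambda>z. D\<psi> z v) has_derivative D2 v) (at ?y)" for v
    unfolding D2_def D\<psi>_def by (rule C1_on_has_derivative[OF C2_on_deriv[OF C2] U(2)])
  have "((\<lambda>z. metric_in \<Omega> d (\<psi> z) (D\<psi> z v) (D\<psi> z v)) has_derivative
     (\<lambda>u. md.Dg (\<psi> ?y) ?w ?w (D\<psi> ?y u) + metric_in \<Omega> d (\<psi> ?y) (D2 v u) ?w
        + metric_in \<Omega> d (\<psi> ?y) ?w (D2 v u))) (at ?y)"
    using \<psi>U U by (intro md.has_derivative_g d\<psi> dD\<psi>) auto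
  then have "((\<lambda>z. metric_in \<Omega> c z v v) has_derivative
     (\<lambda>u. md.Dg (\<psi> ?y) ?w ?w (D\<psi> ?y u) + metric_in \<Omega> d (\<psi> ?y) (D2 v u) ?w
        + metric_in \<Omega> d (\<psi> ?y) ?w (D2 v u))) (at ?y)"
    by (rule has_derivative_transform_within_open[OF _ U]) (simp add: gU)
  from frechet_derivative_at[OF this, symmetric]
  have 1: "mc.Dg ?y v v u = md.Dg (cmap d x) ?w ?w (D\<psi> ?y u) + 2 * ?gd (D2 v u) ?w" for u
    by (simp add: \<psi>y) (subst sym, simp)
  have d\<xi>: "(\<xi> has_derivative frechet_derivative \<xi> (at ?y)) (at ?y)"
    unfolding \<xi>_def by (rule C1_field_differentiable[OF X c y])
  have d\<eta>: "(\<eta> has_derivative frechet_derivative \<eta> (at (cmap d x))) (at (\<psi> ?y))"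
    unfolding \<eta>_def \<psi>y using x by (intro C1_field_differentiable[OF X d]) auto
  have "((\<lambda>z. D\<psi> z (\<xi> z)) has_derivative (\<lambda>u. D2 (\<xi> ?y) u + D\<psi> ?y (frechet_derivative \<xi> (at ?y) u))) (at ?y)"
    using has_derivative_deriv_apply[OF C2 U d\<xi>] unfolding D2_def D\<psi>_def .
  then have "((\<lambda>z. \<eta> (\<psi> z)) has_derivative (\<lambda>u. D2 (\<xi> ?y) u + D\<psi> ?y (frechet_derivative \<xi> (at ?y) u))) (at ?y)"
    by (rule has_derivative_transform_within_open[OF _ U]) (simp add: \<eta>U)
  with has_derivative_compose[OF d\<psi> d\<eta>]
  have "(\<lambda>u. frechet_derivative \<eta> (at (cmap d x)) (D\<psi> ?y u))
      = (\<lambda>u. D2 (\<xi> ?y) u + D\<psi> ?y (frechet_derivative \<xi> (at ?y) u))"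
    using has_derivative_unique by blast
  then have 2: "frechet_derivative \<eta> (at (cmap d x)) ?w
      = D2 (\<xi> ?y) v + D\<psi> ?y (frechet_derivative \<xi> (at ?y) v)" by (rule fun_cong)
  have 3: "D2 v (\<xi> ?y) = D2 (\<xi> ?y) v"
    unfolding D2_def D\<psi>_def by (rule second_derivative_symmetric[OF C2 U])
  have 4: "metric_in \<Omega> c ?y a b = ?gd (D\<psi> ?y a) (D\<psi> ?y b)" for a b
    using gU[OF U(2)] by (simp add: \<psi>y)
  have 5: "\<eta> (cmap d x) = D\<psi> ?y (\<xi> ?y)" using \<eta>U[OF U(2)] by (simp add: \<psi>y)
  show ?thesis
    unfolding mc.lie_form_def md.lie_form_def cc \<xi>_def[symmetric] \<eta>_def[symmetric]
    by (simp add: 1 2 3 4 5 G_simps)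
qed

text \<open>On the diagonal two of the three terms in the Koszul formula cancel, and the remaining
  one is the \<open>Dg\<close> term of \<open>lie_form\<close>.\<close>

lemma metric_cov_deriv:
  assumes X: "C1_field \<Omega> X"
  shows "metric_at \<Omega> x (cov_deriv \<Omega> X x v) v
    = lie (chart_at \<Omega> x) X (cmap (chart_at \<Omega> x) x) v v"
proof -
  let ?c = "chart_at \<Omega> x"
  let ?y = "cmap ?c x"
  have c: "?c \<in> atlas \<Omega>" "x \<in> cdom ?c" using chart_at by auto
  then have y: "?y \<in> cimg ?c" by blast
  interpret m: metric_domain "cimg ?c" "metric_in \<Omega> ?c" by (rule metric_domain_chart[OF c(1)])
  interpret ip_form "metric_at \<Omega> x" by (rule ip_form_metric_at)
  have Xx: "field_in \<Omega> ?c X ?y = X x"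
    using c by (simp add: field_in_def cinv_cmap to_chart_preferred)
  have "\<forall>w. 2 * metric_in \<Omega> ?c ?y (christoffel \<Omega> ?c ?y v (X x)) w
      = m.Dg ?y (X x) w v + m.Dg ?y v w (X x) - m.Dg ?y v (X x) w"
    unfolding christoffel_def by (rule theI'[OF m.christoffel_ex1[OF y]])
  then have "2 * metric_in \<Omega> ?c ?y (christoffel \<Omega> ?c ?y v (X x)) v = m.Dg ?y v v (X x)"
    using m.Dg_sym[OF y, of "X x" v v] by simp
  then show ?thesis
    by (simp add: cov_deriv_def Let_def G_simps m.lie_form_def Xx metric_in_preferred)
qed

lemma to_chart_image_orthonormal:
  assumes "c \<in> atlas \<Omega>" "x \<in> cdom c" "ip_form.orthonormal (metric_at \<Omega> x) E"
  shows "ip_form.orthonormal (metric_in \<Omega> c (cmap c x)) (to_chart \<Omega> c x ` E)"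
    and "inj_on (to_chart \<Omega> c x) E"
proof -
  have y: "cmap c x \<in> cimg c" using assms by blast
  show inj: "inj_on (to_chart \<Omega> c x) E"
    using of_to_chart[OF assms(1,2)] by (metis inj_onI)
  show "ip_form.orthonormal (metric_in \<Omega> c (cmap c x)) (to_chart \<Omega> c x ` E)"
    using assms(3) inj
    unfolding ip_form.orthonormal_def[OF ip_form_metric_in[OF assms(1) y]]
      ip_form.orthonormal_def[OF ip_form_metric_at]
    by (auto simp: metric_in_to_chart[OF assms(1,2)] inj_on_eq_iff)
qed

text \<open>\<open>div_plane\<close> uses the preferred chart of each point; to estimate it over a
  neighbourhood it has to be expressed in one chart and in a convenient basis. Chart independence of
  the diagonal and basis independence of the trace combine to allow this.\<close>

lemma div_plane_eq:
  assumes X: "C1_field \<Omega> X" and c: "c \<in> atlas \<Omega>" and x: "x \<in> cdom c" and S: "subspace S"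
    and E: "ip_form.orthonormal (metric_in \<Omega> c (cmap c x)) E" "span E = to_chart \<Omega> c x ` S"
  shows "div_plane \<Omega> X x S = (\<Sum>e\<in>E. lie c X (cmap c x) e e)"
proof -
  interpret G: ip_form "metric_at \<Omega> x" by (rule ip_form_metric_at)
  have y: "cmap c x \<in> cimg c" using x by blast
  interpret g: ip_form "metric_in \<Omega> c (cmap c x)" by (rule ip_form_metric_in[OF c y])
  interpret m: metric_domain "cimg c" "metric_in \<Omega> c" by (rule metric_domain_chart[OF c])
  define F where "F = (SOME E. orthonormal_basis_of (metric_at \<Omega> x) S E)"
  have "\<exists>E. orthonormal_basis_of (metric_at \<Omega> x) S E"
    using G.exists_orthonormal_basis[OF S] by (auto simp: G.orthonormal_basis_of_iff)
  then have "orthonormal_basis_of (metric_at \<Omega> x) S F" unfolding F_def by (rule someI_ex)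
  then have F: "G.orthonormal F" "span F = S" by (auto simp: G.orthonormal_basis_of_iff)
  have "div_plane \<Omega> X x S = (\<Sum>e\<in>F. metric_at \<Omega> x (cov_deriv \<Omega> X x e) e)"
    by (simp add: div_plane_def F_def Let_def)
  also have "\<dots> = (\<Sum>e\<in>F. lie c X (cmap c x) (to_chart \<Omega> c x e) (to_chart \<Omega> c x e))"
    by (intro sum.cong refl)
       (simp add: metric_cov_deriv[OF X] lie_coord_change[OF X chart_at(1) c chart_at(2) x] to_chart_def)
  also have "\<dots> = (\<Sum>e\<in>to_chart \<Omega> c x ` F. lie c X (cmap c x) e e)"
    using to_chart_image_orthonormal(2)[OF c x F(1)] by (simp add: sum.reindex)
  also have "\<dots> = (\<Sum>e\<in>E. lie c X (cmap c x) e e)"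
  proof (rule g.trace_basis_independent[OF to_chart_image_orthonormal(1)[OF c x F(1)] E(1),
        where B="lie c X (cmap c x)"])
    show "span (to_chart \<Omega> c x ` F) = span E"
      by (simp add: E(2) F(2)[symmetric] linear_span_image[OF to_chart_linear[OF c x]])
    show "linear (lie c X (cmap c x) v)" "linear (\<lambda>u. lie c X (cmap c x) u v)" for v
      using C1_field_differentiable[OF X c y]
      by (intro m.lie_form_linear[OF y]; auto simp: differentiable_def)+
  qed
  finally show ?thesis .
qed

end

section \<open>Gradients, Hessians and the test vector field in a chart\<close>

lemma gs_basis_vector_nonzero:
  fixes G :: "'e::euclidean_space \<Rightarrow> 'e \<Rightarrow> real"
  assumes "ip_form G" "k < DIM('e)"
  shows "gram_schmidt G basis_vector k \<noteq> 0"
  using assms bij_betw_imp_inj_on[OF bij_betw_basis_vector]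
  by (intro ip_form.gs_nonzero[OF assms(1), where n="DIM('e)"])
     (auto simp: basis_vector_image independent_Basis)

text \<open>The function \<phi> before translation. Squaring makes the positive part continuously
  differentiable, which is what \<open>C1_field\<close> asks for.\<close>

definition square_pos :: "real \<Rightarrow> real" where "square_pos t = (max t 0)\<^sup>2"

lemma square_pos_has_real_derivative: "(square_pos has_real_derivative 2 * max t 0) (at t)"
proof -
  consider "t < 0" | "t = 0" | "t > 0" by linarith
  then show ?thesis
  proof cases
    case 1
    have "((\<lambda>t. 0) has_real_derivative 0) (at t)" by simp
    then have "(square_pos has_real_derivative 0) (at t)"
      by (rule has_field_derivative_transform_within_open[where S="{..<0}"]) (use 1 in \<open>auto simp: square_pos_def max_def\<close>)
    then show ?thesis using 1 by simp
  next
    case 2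
    have lim: "((\<lambda>h. max h 0) \<longlongrightarrow> 0) (at (0::real))"
      using tendsto_max[OF tendsto_ident_at tendsto_const, of 0 0 UNIV] by simp
    have "((\<lambda>h. (square_pos (0 + h) - square_pos 0) / h) \<longlongrightarrow> 0) (at 0)"
    proof (rule Lim_transform_eventually[OF lim])
      show "\<forall>\<^sub>F h in at (0::real). max h 0 = (square_pos (0 + h) - square_pos 0) / h"
        by (auto simp: square_pos_def eventually_at_filter power2_eq_square max_def)
    qed
    then show ?thesis using 2 by (simp add: DERIV_def)
  next
    case 3
    have "((\<lambda>t. t\<^sup>2) has_real_derivative 2 * t) (at t)" by (auto intro!: derivative_eq_intros)
    then have "(square_pos has_real_derivative 2 * t) (at t)"
      by (rule has_field_derivative_transform_within_open[where S="{0<..}"]) (use 3 in \<open>auto simp: square_pos_def max_def\<close>)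
    then show ?thesis using 3 by simp
  qed
qed

lemma C1_on_square_pos:
  fixes F :: "'e::euclidean_space \<Rightarrow> real"
  shows "Ck_on 1 F S \<Longrightarrow> Ck_on 1 (\<lambda>x. square_pos (F x)) S"
  by (rule C1_on_compose_real[where T=UNIV and \<phi>=square_pos and \<phi>'="\<lambda>t. 2 * max t 0"])
     (assumption | rule subset_UNIV square_pos_has_real_derivative | intro continuous_intros)+

text \<open>The quotient \<open>a / (a + b)\<close>, where \<open>a\<close> is positive exactly
  inside the ball of radius \<open>\<rho>\<close> and \<open>b\<close> exactly outside the closed
  ball of radius \<open>\<rho> / 2\<close>, so that the denominator never vanishes.\<close>

lemma exists_C1_cutoff:
  fixes y0 :: "'e::euclidean_space"
  assumes "\<rho> > 0"
  obtains \<eta> :: "'e \<Rightarrow> real" where "Ck_on 1 \<eta> UNIV" "\<And>y. 0 \<le> \<eta> y"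
    "\<And>y. dist y0 y \<le> \<rho> / 2 \<Longrightarrow> \<eta> y = 1" "\<And>y. dist y0 y \<ge> \<rho> \<Longrightarrow> \<eta> y = 0"
proof -
  define s where "s y = (y - y0) \<bullet> (y - y0)" for y
  have s_eq: "s y = (dist y0 y)\<^sup>2" for y
    by (subst dist_commute) (simp add: s_def dist_norm power2_norm_eq_inner)
  define a where "a y = square_pos (\<rho>\<^sup>2 - s y)" for y
  define b where "b y = square_pos (s y - \<rho>\<^sup>2 / 4)" for y
  have s: "Ck_on 1 s UNIV"
    unfolding s_def by (intro C1_on_inner C1_on_diff C1_on_id C1_on_const)
  have ab: "a y + b y > 0" "0 \<le> a y" for y
  proof -
    have "a y > 0 \<or> b y > 0"
    proof (rule ccontr)
      assume "\<not> (a y > 0 \<or> b y > 0)"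
      then have "\<rho>\<^sup>2 - s y \<le> 0" "s y - \<rho>\<^sup>2 / 4 \<le> 0"
        by (auto simp: a_def b_def square_pos_def max_def split: if_splits)
      then show False using assms using zero_less_power[OF assms, of 2] by linarith
    qed
    moreover have "a y \<ge> 0" "b y \<ge> 0" by (auto simp: a_def b_def square_pos_def)
    ultimately show "a y + b y > 0" "0 \<le> a y" by linarith+
  qed
  have C1a: "Ck_on 1 a UNIV" and C1b: "Ck_on 1 b UNIV"
    unfolding a_def b_def by (intro C1_on_square_pos C1_on_diff C1_on_const s)+
  have inv: "Ck_on 1 (\<lambda>y. inverse (a y + b y)) UNIV"
  proof (rule C1_on_compose_real[where T="{0<..}" and \<phi>=inverse and \<phi>'="\<lambda>t. - (inverse t * inverse t)"])
    show "Ck_on 1 (\<lambda>y. a y + b y) UNIV" by (intro C1_on_add C1a C1b)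
    show "range (\<lambda>y. a y + b y) \<subseteq> {0<..}" using ab by auto
  qed (auto intro!: derivative_eq_intros continuous_intros simp: power2_eq_square)
  show ?thesis
  proof
    show "Ck_on 1 (\<lambda>y. a y * inverse (a y + b y)) UNIV" by (intro C1_on_mult C1a inv)
    show "0 \<le> a y * inverse (a y + b y)" for y using ab[of y] by simp
    show "a y * inverse (a y + b y) = 1" if "dist y0 y \<le> \<rho> / 2" for y
    proof -
      have "(dist y0 y)\<^sup>2 \<le> (\<rho> / 2)\<^sup>2" using that by (intro power_mono) auto
      then have "b y = 0" by (simp add: b_def s_eq square_pos_def power_divide)
      then show ?thesis using ab[of y] by simp
    qed
    show "a y * inverse (a y + b y) = 0" if "dist y0 y \<ge> \<rho>" for y
    proof -
      have "\<rho>\<^sup>2 \<le> (dist y0 y)\<^sup>2" using that assms by (intro power_mono) auto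
      then show ?thesis by (simp add: a_def s_eq square_pos_def)
    qed
  qed
qed

section \<open>Moving frames, gradients and Hessians\<close>

context metric_domain
begin

text \<open>On \<open>V\<close> it is orthonormal for \<open>g y\<close> and continuously
  differentiable in \<open>y\<close>: the common reference by which vectors and forms at different
  points are compared.\<close>

definition frame :: "nat \<Rightarrow> 'e \<Rightarrow> 'e" where "frame k y = gram_schmidt (g y) basis_vector k"

lemma C1_on_frame: "k < DIM('e) \<Longrightarrow> Ck_on 1 (frame k) V"
proof (induction k rule: less_induct)
  case (less k)
  define w where "w y = basis_vector k - (\<Sum>j<k. g y (basis_vector k) (frame j y) *\<^sub>R frame j y)" for y
  have C1w: "Ck_on 1 w V"
    unfolding w_def using less
    by (intro C1_on_diff C1_on_const C1_on_sum C1_on_scaleR C1_on_g[where u="\<lambda>y. y"] open_V C1_on_id) auto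
  have w: "frame k y = (1 / sqrt (g y (w y) (w y))) *\<^sub>R w y" for y
    unfolding frame_def by (subst gram_schmidt.simps) (simp add: w_def frame_def Let_def)
  have pos: "g y (w y) (w y) > 0" if "y \<in> V" for y
  proof -
    interpret ip_form "g y" using ip_form_g that .
    have "w y \<noteq> 0" using w[of y] gs_basis_vector_nonzero[OF ip_form_g[OF that] less.prems]
      by (auto simp: frame_def)
    then show ?thesis by (rule pos)
  qed
  have "Ck_on 1 (\<lambda>y. inverse (sqrt (g y (w y) (w y)))) V"
  proof (rule C1_on_compose_real[where T="{0<..}" and \<phi>="\<lambda>t. inverse (sqrt t)"
        and \<phi>'="\<lambda>t. - (inverse (sqrt t) * (inverse (sqrt t) / 2) * inverse (sqrt t))"])
    show "Ck_on 1 (\<lambda>y. g y (w y) (w y)) V"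
      by (intro C1_on_g[where u="\<lambda>y. y"] open_V C1_on_id C1w) auto
    show "(\<lambda>y. g y (w y) (w y)) ` V \<subseteq> {0<..}" using pos by auto
  qed (auto intro!: derivative_eq_intros continuous_intros)
  then have "Ck_on 1 (\<lambda>y. inverse (sqrt (g y (w y) (w y))) *\<^sub>R w y) V"
    by (intro C1_on_scaleR C1w)
  then show ?case by (simp add: w[abs_def] divide_inverse)
qed

lemma g_frame:
  assumes "y \<in> V" "j < DIM('e)" "k < DIM('e)"
  shows "g y (frame j y) (frame k y) = (if j = k then 1 else 0)"
proof -
  interpret ip_form "g y" using ip_form_g assms(1) .
  show ?thesis
    using gs_orthogonal'[of k j basis_vector] gs_norm[OF gs_basis_vector_nonzero[OF ip_form_g[OF assms(1)] assms(2)]]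
    by (auto simp: frame_def)
qed

lemma frame_expansion:
  assumes "y \<in> V" shows "x = (\<Sum>k<DIM('e). g y x (frame k y) *\<^sub>R frame k y)"
proof -
  interpret ip_form "g y" using ip_form_g assms(1) .
  let ?E = "gs basis_vector ` {..<DIM('e)} - {0}"
  have nz: "0 \<notin> gs basis_vector ` {..<DIM('e)}"
    using gs_basis_vector_nonzero[OF ip_form_g[OF assms]] by (metis imageE lessThan_iff)
  have "span ?E = UNIV" by (simp add: gs_span basis_vector_image)
  then have "x = (\<Sum>e\<in>gs basis_vector ` {..<DIM('e)}. g y x e *\<^sub>R e)"
    using orthonormal_expansion[OF gs_orthonormal, of x basis_vector "{..<DIM('e)}"] nz by simp
  also have "\<dots> = (\<Sum>k<DIM('e). g y x (gs basis_vector k) *\<^sub>R gs basis_vector k)"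
  proof (rule sum.reindex_cong[where l="gs basis_vector"])
    have "{k \<in> {..<DIM('e)}. gs basis_vector k \<noteq> 0} = {..<DIM('e)}" using nz by auto
    then show "inj_on (gs basis_vector) {..<DIM('e)}"
      using gs_inj_on[of basis_vector "{..<DIM('e)}"] by metis
  qed auto
  finally show ?thesis by (simp add: frame_def)
qed

lemma frame_Parseval:
  assumes "y \<in> V" shows "g y x z = (\<Sum>k<DIM('e). g y x (frame k y) * g y z (frame k y))"
proof -
  interpret ip_form "g y" using ip_form_g assms(1) .
  have "g y x z = g y (\<Sum>k<DIM('e). g y x (frame k y) *\<^sub>R frame k y) z"
    using frame_expansion[OF assms, of x] by simp
  also have "\<dots> = (\<Sum>k<DIM('e). g y x (frame k y) * g y (frame k y) z)"
    by (simp add: G_sum G_simps)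
  finally show ?thesis by (simp only: sym[of "frame _ y" z])
qed

lemma frame_bilinear:
  assumes "y \<in> V" "\<And>v. linear (B v)" "\<And>v. linear (\<lambda>x. B x v :: real)"
  shows "B x x = (\<Sum>j<DIM('e). \<Sum>k<DIM('e). g y x (frame j y) * g y x (frame k y) * B (frame j y) (frame k y))"
proof -
  have "B z x = (\<Sum>k<DIM('e). g y x (frame k y) * B z (frame k y))" for z
    by (subst (1) frame_expansion[OF assms(1), of x])
       (simp add: linear_sum[OF assms(2)] linear_scale[OF assms(2)])
  moreover have "B x x = (\<Sum>j<DIM('e). g y x (frame j y) * B (frame j y) x)"
    by (subst (1) frame_expansion[OF assms(1), of x])
       (simp add: linear_sum[OF assms(3)] linear_scale[OF assms(3)])
  ultimately show ?thesis by (simp add: sum_distrib_left mult.assoc)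
qed

lemma abs_coefficient_le_1:
  assumes "y \<in> V" "g y e e = 1" "k < DIM('e)" shows "\<bar>g y e (frame k y)\<bar> \<le> 1"
proof -
  interpret ip_form "g y" using ip_form_g assms(1) .
  show ?thesis using Cauchy_Schwarz[of e "frame k y"] g_frame[OF assms(1,3,3)] assms(2) by simp
qed

text \<open>Built from the frame, which avoids inverting the metric and yields its regularity at
  once.\<close>

definition grad :: "('e \<Rightarrow> real) \<Rightarrow> 'e \<Rightarrow> 'e" where
  "grad F y = (\<Sum>k<DIM('e). frechet_derivative F (at y) (frame k y) *\<^sub>R frame k y)"

lemma C1_on_grad: "Ck_on 2 F V \<Longrightarrow> Ck_on 1 (grad F) V"
  unfolding grad_def
  by (intro C1_on_sum C1_on_scaleR C1_on_frame C1_on_deriv_apply[where u="\<lambda>y. y" and S=V] C1_on_id open_V) auto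

lemma g_grad:
  assumes "Ck_on 1 F V" "y \<in> V" shows "g y (grad F y) w = frechet_derivative F (at y) w"
proof -
  interpret ip_form "g y" using ip_form_g assms(2) .
  have lin: "linear (frechet_derivative F (at y))" using C1_on_linear_deriv assms by blast
  have "frechet_derivative F (at y) w
      = (\<Sum>k<DIM('e). g y w (frame k y) * frechet_derivative F (at y) (frame k y))"
    by (subst (1) frame_expansion[OF assms(2), of w]) (simp add: linear_sum[OF lin] linear_scale[OF lin])
  also have "\<dots> = g y (grad F y) w"
    by (simp add: grad_def G_sum G_simps sym[of w] mult.commute)
  finally show ?thesis by simp
qed

text \<open>The Christoffel term of the Hessian, written as the inner product of the Christoffel
  vector with the gradient and then by the Koszul formula. Only first derivatives of the metric are
  left, so continuity is within reach.\<close>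

definition hess :: "('e \<Rightarrow> real) \<Rightarrow> 'e \<Rightarrow> 'e \<Rightarrow> 'e \<Rightarrow> real" where
  "hess F y v w = frechet_derivative (\<lambda>z. frechet_derivative F (at z) w) (at y) v
     - (Dg y w (grad F y) v + Dg y v (grad F y) w - Dg y v w (grad F y)) / 2"

lemma hess_sym:
  assumes "Ck_on 2 F V" "y \<in> V" shows "hess F y v w = hess F y w v"
  using second_derivative_symmetric[OF assms(1) open_V assms(2), of v w] Dg_sym[OF assms(2), of v w]
  by (simp add: hess_def add.commute)

lemma hess_linear:
  assumes "Ck_on 2 F V" "y \<in> V" shows "linear (\<lambda>v. hess F y v w)"
proof -
  have "linear (\<lambda>v. Dg y w (grad F y) v + Dg y v (grad F y) w - Dg y v w (grad F y))"
    by (intro linear_compose_sub linear_compose_add Dg_linear Dg_linear_left assms(2))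
  from linear_compose[OF this linear_times[of "1/2"]]
  have "linear (\<lambda>v. (Dg y w (grad F y) v + Dg y v (grad F y) w - Dg y v w (grad F y)) / 2)"
    by (simp add: o_def)
  then show ?thesis
    unfolding hess_def by (intro linear_compose_sub C1_on_linear_deriv[OF C2_on_deriv[OF assms(1)] assms(2)])
qed

lemma symmetric_form_hess:
  assumes "Ck_on 2 F V" "y \<in> V" shows "symmetric_form (g y) (hess F y)"
proof -
  have "hess F y v = (\<lambda>w. hess F y w v)" for v by (rule ext) (rule hess_sym[OF assms])
  then have "linear (hess F y v)" for v using hess_linear[OF assms] by metis
  then show ?thesis
    unfolding symmetric_form_def symmetric_form_axioms_def
    using ip_form_g[OF assms(2)] hess_sym[OF assms] by blast
qed

text \<open>The second derivative is taken with its last argument frozen, so a moving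
  \<open>b y\<close> there is not covered by regularity along fixed directions; symmetry moves it to
  the linear slot, where it expands over \<open>Basis\<close>.\<close>

lemma continuous_on_hess:
  assumes F: "Ck_on 2 F V" and a: "continuous_on V a" "continuous_on V b"
  shows "continuous_on V (\<lambda>y. hess F y (a y) (b y))"
proof -
  have "continuous_on V (\<lambda>y. \<Sum>i\<in>Basis. (b y \<bullet> i) *
      frechet_derivative (\<lambda>z. frechet_derivative F (at z) i) (at y) (a y))"
    by (intro continuous_intros a C1_on_continuous_deriv_apply[OF C2_on_deriv[OF F]]) auto
  moreover have "frechet_derivative (\<lambda>z. frechet_derivative F (at z) (b y)) (at y) (a y)
      = (\<Sum>i\<in>Basis. (b y \<bullet> i) * frechet_derivative (\<lambda>z. frechet_derivative F (at z) i) (at y) (a y))"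
    if y: "y \<in> V" for y
  proof -
    have "frechet_derivative (\<lambda>z. frechet_derivative F (at z) (b y)) (at y) (a y)
        = frechet_derivative (\<lambda>z. frechet_derivative F (at z) (a y)) (at y) (b y)"
      by (rule second_derivative_symmetric[OF F open_V y])
    also have "\<dots> = (\<Sum>i\<in>Basis. (b y \<bullet> i) *\<^sub>R frechet_derivative (\<lambda>z. frechet_derivative F (at z) (a y)) (at y) i)"
      by (rule linear_basis_expansion[OF C1_on_linear_deriv[OF C2_on_deriv[OF F] y]])
    also have "\<dots> = (\<Sum>i\<in>Basis. (b y \<bullet> i) * frechet_derivative (\<lambda>z. frechet_derivative F (at z) i) (at y) (a y))"
      by (intro sum.cong refl) (simp add: second_derivative_symmetric[OF F open_V y, of "a y"])
    finally show ?thesis .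
  qed
  ultimately have 1: "continuous_on V (\<lambda>y. frechet_derivative (\<lambda>z. frechet_derivative F (at z) (b y)) (at y) (a y))"
    by (simp cong: continuous_on_cong)
  have gr: "continuous_on V (grad F)" by (rule C1_on_continuous_on[OF C1_on_grad[OF F]])
  have 2: "continuous_on V (\<lambda>y. Dg y (b y) (grad F y) (a y))"
    "continuous_on V (\<lambda>y. Dg y (a y) (grad F y) (b y))"
    "continuous_on V (\<lambda>y. Dg y (a y) (b y) (grad F y))"
    by (rule continuous_on_Dg[where u="\<lambda>y. y"]; auto intro: a gr)+
  show ?thesis unfolding hess_def by (intro continuous_intros 1 2) auto
qed

text \<open>The identity \<open>g_grad\<close> is differentiated in direction \<open>v\<close>. Thus
  the divergence of a gradient field along a plane is the trace of the Hessian.\<close>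

lemma lie_form_grad:
  assumes F: "Ck_on 2 F V" and y: "y \<in> V"
  shows "lie_form (grad F) y v v = hess F y v v"
proof -
  have C1: "Ck_on 1 F V" by (rule C2_on_imp_C1_on[OF F])
  have dg: "(grad F has_derivative frechet_derivative (grad F) (at y)) (at y)"
    by (rule C1_on_has_derivative[OF C1_on_grad[OF F] y])
  have "((\<lambda>z. g z (grad F z) v) has_derivative
    (\<lambda>u. Dg y (grad F y) v u + g y (frechet_derivative (grad F) (at y) u) v + g y (grad F y) 0)) (at y)"
    by (rule has_derivative_g[where u="\<lambda>z. z" and u'="\<lambda>v. v", OF has_derivative_ident y open_V y _ dg has_derivative_const])
       simp
  then have "((\<lambda>z. frechet_derivative F (at z) v) has_derivative
    (\<lambda>u. Dg y (grad F y) v u + g y (frechet_derivative (grad F) (at y) u) v + g y (grad F y) 0)) (at y)"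
    by (rule has_derivative_transform_within_open[OF _ open_V y]) (rule g_grad[OF C1])
  from fun_cong[OF frechet_derivative_at[OF this], of v]
  have "frechet_derivative (\<lambda>z. frechet_derivative F (at z) v) (at y) v
      = Dg y (grad F y) v v + g y (frechet_derivative (grad F) (at y) v) v"
    using ip_form.G_simps(7)[OF ip_form_g[OF y]] by simp
  then show ?thesis
    using Dg_sym[OF y, of v "grad F y" v] by (simp add: lie_form_def hess_def field_simps)
qed

lemma lie_form_scale:
  assumes u: "(u has_derivative u') (at y)" and \<zeta>: "(\<zeta> has_derivative \<zeta>') (at y)" and y: "y \<in> V"
  shows "lie_form (\<lambda>z. u z *\<^sub>R \<zeta> z) y v w = u y * lie_form \<zeta> y v w + u' v * g y (\<zeta> y) w"
proof -
  interpret ip_form "g y" using ip_form_g y .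
  have "((\<lambda>z. u z *\<^sub>R \<zeta> z) has_derivative (\<lambda>v. u y *\<^sub>R \<zeta>' v + u' v *\<^sub>R \<zeta> y)) (at y)"
    by (rule has_derivative_scaleR[OF u \<zeta>])
  from frechet_derivative_at[OF this, symmetric] frechet_derivative_at[OF \<zeta>, symmetric]
  show ?thesis
    by (simp add: lie_form_def G_simps linear_scale[OF Dg_linear[OF y]] algebra_simps)
qed

lemma lie_form_cong:
  assumes "open U" "y \<in> U" "\<And>z. z \<in> U \<Longrightarrow> \<xi> z = \<xi>' z" "\<xi> differentiable at y"
  shows "lie_form \<xi> y = lie_form \<xi>' y"
proof -
  have "(\<xi>' has_derivative frechet_derivative \<xi> (at y)) (at y)"
    using assms frechet_derivative_works has_derivative_transform_within_open by metis
  from frechet_derivative_at[OF this] show ?thesis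
    using assms(2,3) by (simp add: lie_form_def[abs_def])
qed

text \<open>The coefficients of a unit vector in the frame are at most 1 in absolute value, so the
  bound depends on the plane only through its dimension.\<close>

lemma abs_trace_le:
  assumes y: "y \<in> V" and B: "\<And>v. linear (B v)" "\<And>v. linear (\<lambda>x. B x v :: real)"
    and E: "ip_form.orthonormal (g y) E"
  shows "\<bar>\<Sum>e\<in>E. B e e\<bar> \<le> real (card E) * (\<Sum>j<DIM('e). \<Sum>k<DIM('e). \<bar>B (frame j y) (frame k y)\<bar>)"
proof -
  have "\<bar>B e e\<bar> \<le> (\<Sum>j<DIM('e). \<Sum>k<DIM('e). \<bar>B (frame j y) (frame k y)\<bar>)" if e: "e \<in> E" for e
  proof -
    have gee: "g y e e = 1" using E e by (auto simp: ip_form.orthonormal_def[OF ip_form_g[OF y]])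
    have "\<bar>B e e\<bar> \<le> (\<Sum>j<DIM('e). \<Sum>k<DIM('e). \<bar>g y e (frame j y) * g y e (frame k y) * B (frame j y) (frame k y)\<bar>)"
      unfolding frame_bilinear[OF y B, of e]
      by (rule order_trans[OF sum_abs]) (intro sum_mono sum_abs)
    also have "\<dots> \<le> (\<Sum>j<DIM('e). \<Sum>k<DIM('e). \<bar>B (frame j y) (frame k y)\<bar>)"
    proof (intro sum_mono)
      fix j k assume "j \<in> {..<DIM('e)}" "k \<in> {..<DIM('e)}"
      then have "\<bar>g y e (frame j y)\<bar> * \<bar>g y e (frame k y)\<bar> \<le> 1 * 1"
        by (intro mult_mono abs_coefficient_le_1[OF y gee]) auto
      then have "\<bar>g y e (frame j y)\<bar> * \<bar>g y e (frame k y)\<bar> * \<bar>B (frame j y) (frame k y)\<bar>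
          \<le> 1 * \<bar>B (frame j y) (frame k y)\<bar>"
        by (intro mult_right_mono) auto
      then show "\<bar>g y e (frame j y) * g y e (frame k y) * B (frame j y) (frame k y)\<bar>
          \<le> \<bar>B (frame j y) (frame k y)\<bar>" by (simp add: abs_mult)
    qed
    finally show ?thesis .
  qed
  then have "(\<Sum>e\<in>E. \<bar>B e e\<bar>) \<le> (\<Sum>e\<in>E. (\<Sum>j<DIM('e). \<Sum>k<DIM('e). \<bar>B (frame j y) (frame k y)\<bar>))"
    by (rule sum_mono)
  then show ?thesis by (intro order_trans[OF sum_abs]) simp
qed

text \<open>The isometry between the metrics at two points that matches the Gram-Schmidt frames.\<close>

definition transport :: "'e \<Rightarrow> 'e \<Rightarrow> 'e \<Rightarrow> 'e" where
  "transport y z x = (\<Sum>k<DIM('e). g y x (frame k y) *\<^sub>R frame k z)"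

lemma g_transport_frame:
  assumes "z \<in> V" "k < DIM('e)"
  shows "g z (transport y z x) (frame k z) = g y x (frame k y)"
proof -
  interpret ip_form "g z" using ip_form_g assms(1) .
  have "g z (transport y z x) (frame k z) = (\<Sum>j<DIM('e). g y x (frame j y) * g z (frame j z) (frame k z))"
    by (simp add: transport_def G_sum G_simps)
  also have "\<dots> = (\<Sum>j<DIM('e). if j = k then g y x (frame k y) else 0)"
    using assms by (intro sum.cong) (auto simp: g_frame)
  finally show ?thesis using assms by simp
qed

lemma transport_isometry:
  assumes "y \<in> V" "z \<in> V" shows "g z (transport y z x) (transport y z x') = g y x x'"
proof -
  have "g z (transport y z x) (transport y z x') = (\<Sum>k<DIM('e). g z (transport y z x) (frame k z)
      * g z (transport y z x') (frame k z))" by (rule frame_Parseval[OF assms(2)])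
  also have "\<dots> = (\<Sum>k<DIM('e). g y x (frame k y) * g y x' (frame k y))"
    by (intro sum.cong refl) (simp add: g_transport_frame[OF assms(2)])
  also have "\<dots> = g y x x'" by (rule frame_Parseval[OF assms(1), symmetric])
  finally show ?thesis .
qed

lemma transport_orthonormal:
  assumes "y \<in> V" "z \<in> V" "ip_form.orthonormal (g y) E"
  shows "ip_form.orthonormal (g z) (transport y z ` E)" "inj_on (transport y z) E"
proof -
  have E: "g y u v = (if u = v then 1 else 0)" if "u \<in> E" "v \<in> E" for u v
    using assms(3) that by (auto simp: ip_form.orthonormal_def[OF ip_form_g[OF assms(1)]])
  show inj: "inj_on (transport y z) E"
  proof (rule inj_onI)
    fix u v assume uv: "u \<in> E" "v \<in> E" "transport y z u = transport y z v"
    then have "g y u v = g y u u" using transport_isometry[OF assms(1,2)] by metis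
    then show "u = v" using E[OF uv(1,2)] E[OF uv(1,1)] by (auto split: if_splits)
  qed
  show "ip_form.orthonormal (g z) (transport y z ` E)"
    using E inj by (auto simp: ip_form.orthonormal_def[OF ip_form_g[OF assms(2)]]
        transport_isometry[OF assms(1,2)] inj_on_eq_iff)
qed

text \<open>The frame isometry carries \<open>E\<close> to an orthonormal family at
  \<open>y0\<close>, where the eigenvalue estimate applies. The error is at most \<open>m\<close>
  times \<open>S y\<close>, which does not depend on \<open>E\<close>, so the bound is uniform over
  planes.\<close>

lemma eventually_hess_trace_ge:
  assumes F: "Ck_on 2 F V" and y0: "y0 \<in> V" and "\<epsilon> > 0"
  shows "eventually (\<lambda>y. \<forall>E. ip_form.orthonormal (g y) E \<and> card E = m \<longrightarrow>
    Trace_lowest m (g y0) (hess F y0) - \<epsilon> \<le> (\<Sum>e\<in>E. hess F y e e)) (nhds y0)"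
proof -
  define h where "h j k y = hess F y (frame j y) (frame k y)" for j k y
  have cont: "isCont (h j k) y0" if "j < DIM('e)" "k < DIM('e)" for j k
    using continuous_on_hess[OF F C1_on_continuous_on[OF C1_on_frame[OF that(1)]]
        C1_on_continuous_on[OF C1_on_frame[OF that(2)]]] open_V y0
    by (simp add: h_def[abs_def] continuous_on_eq_continuous_at)
  define S where "S y = (\<Sum>j<DIM('e). \<Sum>k<DIM('e). \<bar>h j k y - h j k y0\<bar>)" for y
  have "isCont S y0" unfolding S_def by (intro continuous_intros cont) auto
  moreover have "S y0 = 0" by (simp add: S_def)
  ultimately have "(S \<longlongrightarrow> 0) (nhds y0)" by (metis continuous_at isCont_def tendsto_at_iff_tendsto_nhds)
  \<comment> \<open>The added 1 covers \<open>m = 0\<close>.\<close>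
  moreover have "0 < \<epsilon> / (real m + 1)" using \<open>\<epsilon> > 0\<close> by simp
  ultimately have "eventually (\<lambda>y. S y < \<epsilon> / (real m + 1)) (nhds y0)" by (rule order_tendstoD(2))
  moreover have "eventually (\<lambda>y. y \<in> V) (nhds y0)" using open_V y0 by (simp add: eventually_nhds) blast
  ultimately show ?thesis
  proof eventually_elim
    case (elim y)
    show ?case
    proof (intro allI impI, elim conjE)
      fix E assume E: "ip_form.orthonormal (g y) E" "card E = m"
      have y: "y \<in> V" using elim by blast
      interpret s: symmetric_form "g y" "hess F y" by (rule symmetric_form_hess[OF F y])
      interpret s0: symmetric_form "g y0" "hess F y0" by (rule symmetric_form_hess[OF F y0])
      let ?I = "transport y y0"
      have B: "hess F y e e = (\<Sum>j<DIM('e). \<Sum>k<DIM('e). g y e (frame j y) * g y e (frame k y) * h j k y)" for e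
        unfolding h_def by (rule frame_bilinear[OF y s.B_linear s.B_linear_left])
      have B0: "hess F y0 (?I e) (?I e)
          = (\<Sum>j<DIM('e). \<Sum>k<DIM('e). g y e (frame j y) * g y e (frame k y) * h j k y0)" for e
        unfolding h_def frame_bilinear[OF y0 s0.B_linear s0.B_linear_left, of "?I e"]
        by (intro sum.cong refl) (simp add: g_transport_frame[OF y0])
      have diff: "hess F y0 (?I e) (?I e) - S y \<le> hess F y e e" if e: "e \<in> E" for e
      proof -
        have gee: "g y e e = 1" using E(1) e by (auto simp: s.orthonormal_def)
        have "hess F y0 (?I e) (?I e) - hess F y e e
          = (\<Sum>j<DIM('e). \<Sum>k<DIM('e). g y e (frame j y) * g y e (frame k y) * (h j k y0 - h j k y))"
          unfolding B B0 by (simp add: sum_subtractf right_diff_distrib)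
        also have "\<dots> \<le> S y"
          unfolding S_def
        proof (intro sum_mono)
          fix j k assume "j \<in> {..<DIM('e)}" "k \<in> {..<DIM('e)}"
          then have "\<bar>g y e (frame j y)\<bar> * \<bar>g y e (frame k y)\<bar> \<le> 1 * 1"
            by (intro mult_mono abs_coefficient_le_1[OF y gee]) auto
          then have *: "\<bar>g y e (frame j y) * g y e (frame k y) * (h j k y0 - h j k y)\<bar> \<le> 1 * \<bar>h j k y0 - h j k y\<bar>"
            unfolding abs_mult by (intro mult_right_mono) auto
          show "g y e (frame j y) * g y e (frame k y) * (h j k y0 - h j k y) \<le> \<bar>h j k y - h j k y0\<bar>"
            by (rule order_trans[OF abs_ge_self order_trans[OF *]]) (simp add: abs_minus_commute)
        qed
        finally show ?thesis by linarith
      qed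
      have "Trace_lowest m (g y0) (hess F y0) \<le> (\<Sum>e\<in>?I ` E. hess F y0 e e)"
        using transport_orthonormal[OF y y0 E(1)] E(2)
        by (intro s0.Trace_lowest_le_trace) (auto simp: card_image)
      also have "\<dots> = (\<Sum>e\<in>E. hess F y0 (?I e) (?I e))"
        using transport_orthonormal(2)[OF y y0 E(1)] by (simp add: sum.reindex)
      also have "\<dots> \<le> (\<Sum>e\<in>E. hess F y e e + S y)"
        using diff by (intro sum_mono) (simp add: algebra_simps)
      also have "\<dots> = (\<Sum>e\<in>E. hess F y e e) + real m * S y" using E(2) by (simp add: sum.distrib)
      also have "real m * S y \<le> real m * (\<epsilon> / (real m + 1))"
        using elim by (intro mult_left_mono) auto
      also have "\<dots> \<le> \<epsilon>" using \<open>\<epsilon> > 0\<close> by (simp add: field_simps)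
      finally show "Trace_lowest m (g y0) (hess F y0) - \<epsilon> \<le> (\<Sum>e\<in>E. hess F y e e)" by simp
    qed
  qed
qed

text \<open>The frame coefficients of \<open>lie_form\<close> are continuous, hence bounded on
  \<open>K\<close>, and an orthonormal family has at most as many members as the dimension.\<close>

lemma lie_trace_bound:
  assumes \<xi>: "Ck_on 1 \<xi> V" and K: "compact K" "K \<subseteq> V"
  shows "\<exists>C\<ge>0. \<forall>y\<in>K. \<forall>E. ip_form.orthonormal (g y) E \<longrightarrow> \<bar>\<Sum>e\<in>E. lie_form \<xi> y e e\<bar> \<le> C"
proof -
  define T where "T y = (\<Sum>j<DIM('e). \<Sum>k<DIM('e). \<bar>lie_form \<xi> y (frame j y) (frame k y)\<bar>)" for y
  have fr: "continuous_on V (frame k)" if "k < DIM('e)" for k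
    using C1_on_continuous_on[OF C1_on_frame[OF that]] .
  have cont: "continuous_on V (\<lambda>y. lie_form \<xi> y (frame j y) (frame k y))" if jk: "j < DIM('e)" "k < DIM('e)" for j k
    unfolding lie_form_def
  proof (intro continuous_on_add continuous_on_divide continuous_on_const)
    show "continuous_on V (\<lambda>y. Dg y (frame j y) (frame k y) (\<xi> y))"
      by (rule continuous_on_Dg[where u="\<lambda>y. y"]) (auto intro: fr jk C1_on_continuous_on[OF \<xi>])
    show "continuous_on V (\<lambda>y. g y (frechet_derivative \<xi> (at y) (frame j y)) (frame k y))"
      by (rule continuous_on_g[where u="\<lambda>y. y"])
         (auto intro!: fr jk C1_on_continuous_deriv_apply[OF \<xi>, where a="\<lambda>y. y"])
  qed simp
  have "continuous_on V T" unfolding T_def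
    by (intro continuous_on_sum continuous_on_rabs cont) auto
  then have "compact (T ` K)" using K continuous_on_subset compact_continuous_image by metis
  then obtain C where C: "\<And>y. y \<in> K \<Longrightarrow> \<bar>T y\<bar> \<le> C"
    using compact_imp_bounded bounded_iff by (metis imageI real_norm_def)
  have "\<bar>\<Sum>e\<in>E. lie_form \<xi> y e e\<bar> \<le> real DIM('e) * \<bar>C\<bar>"
    if y: "y \<in> K" and E: "ip_form.orthonormal (g y) E" for y E
  proof -
    have yV: "y \<in> V" using y K by blast
    interpret ip_form "g y" by (rule ip_form_g[OF yV])
    have diff: "\<xi> differentiable at y" using \<xi> yV unfolding C1_on_iff by blast
    have "\<bar>\<Sum>e\<in>E. lie_form \<xi> y e e\<bar> \<le> real (card E) * T y"
      unfolding T_def by (rule abs_trace_le[OF yV lie_form_linear[OF yV diff] E])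
    also have "\<dots> \<le> real DIM('e) * \<bar>C\<bar>"
      using C[OF y] orthonormal_card[OF E] dim_subset_UNIV[of "span E"] by (intro mult_mono) (auto simp: T_def sum_nonneg)
    finally show ?thesis .
  qed
  then show ?thesis by (intro exI[of _ "real DIM('e) * \<bar>C\<bar>"]) auto
qed

end

section \<open>Construction of the test field in coordinates\<close>

context metric_domain
begin

text \<open>The fourth power of the distance vanishes at \<open>y0\<close> together with its first
  and second derivatives, unlike the square, which would lower the trace being estimated.\<close>

lemma subtract_quartic:
  fixes f :: "'e \<Rightarrow> real"
  assumes f: "Ck_on 2 f V" and y0: "y0 \<in> V"
  defines "F \<equiv> \<lambda>y. f y - ((y - y0) \<bullet> (y - y0))\<^sup>2"
  shows "Ck_on 2 F V" "grad F y0 = grad f y0" "hess F y0 = hess f y0"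
proof -
  define q' where "q' y v = 4 * ((y - y0) \<bullet> (y - y0)) * ((y - y0) \<bullet> v)" for y v :: 'e
  define DF where "DF y v = frechet_derivative f (at y) v - q' y v" for y v
  have f1: "Ck_on 1 f V" by (rule C2_on_imp_C1_on[OF f])
  have q: "((\<lambda>y. ((y - y0) \<bullet> (y - y0))\<^sup>2) has_derivative q' y) (at y)" for y
    unfolding q'_def
    by (auto intro!: derivative_eq_intros simp: inner_commute power2_eq_square algebra_simps)
  have dF: "(F has_derivative DF y) (at y)" if "y \<in> V" for y
    unfolding F_def DF_def by (intro has_derivative_diff q C1_on_has_derivative[OF f1 that])
  have C1DF: "Ck_on 1 (\<lambda>y. DF y v) V" for v
    unfolding DF_def q'_def
    by (intro C1_on_diff C2_on_deriv[OF f] C1_on_mult C1_on_inner C1_on_const C1_on_id)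
  show F: "Ck_on 2 F V" by (rule C2_onI[OF dF C1DF open_V])
  have eq: "frechet_derivative F (at y) v = DF y v" if "y \<in> V" for y v
    using fun_cong[OF frechet_derivative_at[OF dF[OF that]], of v] by simp
  have eq0: "frechet_derivative F (at y0) = frechet_derivative f (at y0)"
    by (rule ext) (simp add: eq[OF y0] DF_def q'_def)
  show gr: "grad F y0 = grad f y0" by (simp add: grad_def eq0)
  have q'0: "((\<lambda>y. q' y v) has_derivative (\<lambda>w. 0)) (at y0)" for v
    unfolding q'_def by (auto intro!: derivative_eq_intros)
  have "frechet_derivative (\<lambda>z. frechet_derivative F (at z) w) (at y0)
      = frechet_derivative (\<lambda>z. frechet_derivative f (at z) w) (at y0)" for w
  proof -
    have "((\<lambda>y. DF y w) has_derivative
        (\<lambda>v. frechet_derivative (\<lambda>z. frechet_derivative f (at z) w) (at y0) v - 0)) (at y0)"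
      unfolding DF_def by (intro has_derivative_diff q'0 C1_on_has_derivative[OF C2_on_deriv[OF f] y0])
    then have "((\<lambda>y. frechet_derivative F (at y) w) has_derivative
        (\<lambda>v. frechet_derivative (\<lambda>z. frechet_derivative f (at z) w) (at y0) v - 0)) (at y0)"
      by (rule has_derivative_transform_within_open[OF _ open_V y0]) (simp add: eq)
    from frechet_derivative_at[OF this] show ?thesis by simp
  qed
  then show "hess F y0 = hess f y0" by (intro ext) (simp add: hess_def gr)
qed

lemma g_scaleR_norm:
  assumes "y \<in> V" "0 \<le> c" shows "sqrt (g y (c *\<^sub>R x) (c *\<^sub>R x)) = c * sqrt (g y x x)"
proof -
  interpret ip_form "g y" using ip_form_g assms(1) .
  show ?thesis using assms(2) by (simp add: G_simps real_sqrt_mult mult.assoc[symmetric])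
qed

lemma lie_form_zero_outside:
  assumes "y \<in> V - K" "closed K" "\<And>z. z \<in> V - K \<Longrightarrow> \<xi> z = 0"
  shows "lie_form \<xi> y v w = 0"
proof -
  have y: "y \<in> V" using assms by blast
  interpret ip_form "g y" using ip_form_g y .
  have U: "open (V - K)" using open_V assms(2) by (rule open_Diff)
  have "((\<lambda>z. 0) has_derivative (\<lambda>v. 0)) (at y)" by simp
  then have "(\<xi> has_derivative (\<lambda>v. 0)) (at y)"
    by (rule has_derivative_transform_within_open[OF _ U assms(1)]) (simp add: assms(3))
  from frechet_derivative_at[OF this, symmetric] show ?thesis
    by (simp add: lie_form_def assms(3)[OF assms(1)] linear_0[OF Dg_linear[OF y]] G_simps)
qed

text \<open>The field is \<open>\<eta> \<phi>(F) grad F\<close>, where \<open>F\<close> is \<open>f\<close> minus a quartic, so that \<open>F\<close> has a strict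
  local maximum on the blow-up set, \<open>\<phi>\<close> is the square of the positive part of \<open>t - t0\<close> with \<open>t0\<close>
  slightly below the maximum, and \<open>\<eta>\<close> is a cutoff function.  Where the derivative of \<open>\<eta>\<close> matters,
  namely on \<open>Q\<close>, the value of \<open>f\<close> exceeds that maximum.\<close>

lemma exists_test_vector_field_unscaled:
  assumes f: "Ck_on 2 f V" and W: "open W" "y0 \<in> W" "W \<subseteq> V" and h: "0 \<le> h"
    and big: "h * sqrt (g y0 (grad f y0) (grad f y0)) < Trace_lowest m (g y0) (hess f y0)"
  obtains \<xi> K Q N C \<epsilon> where "Ck_on 1 \<xi> V" "compact K" "K \<subseteq> W" "\<And>y. y \<in> V - K \<Longrightarrow> \<xi> y = 0"
    "compact Q" "Q \<subseteq> K" "\<And>y. y \<in> Q \<Longrightarrow> f y0 < f y" "open N" "y0 \<in> N" "N \<subseteq> K" "0 < \<epsilon>" "0 \<le> C"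
    "\<And>y. y \<in> V \<Longrightarrow> sqrt (g y (\<xi> y) (\<xi> y)) \<le> C"
    "\<And>y E. y \<in> V \<Longrightarrow> ip_form.orthonormal (g y) E \<Longrightarrow> card E = m \<Longrightarrow>
       h * sqrt (g y (\<xi> y) (\<xi> y)) + \<epsilon> * indicator N y - C * indicator Q y \<le> (\<Sum>e\<in>E. lie_form \<xi> y e e)"
    "\<And>y E. y \<in> V \<Longrightarrow> ip_form.orthonormal (g y) E \<Longrightarrow> card E = m \<Longrightarrow>
       \<bar>\<Sum>e\<in>E. lie_form \<xi> y e e\<bar> \<le> C * indicator K y"
proof -
  define F where "F = (\<lambda>y. f y - ((y - y0) \<bullet> (y - y0))\<^sup>2)"
  have y0: "y0 \<in> V" using W by blast
  note q = subtract_quartic[OF f y0, folded F_def]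
  have F: "Ck_on 2 F V" by (rule q(1))
  have F1: "Ck_on 1 F V" by (rule C2_on_imp_C1_on[OF F])
  have Fy0: "F y0 = f y0" by (simp add: F_def)
  have Fdist: "F y = f y - dist y0 y ^ 4" for y
    unfolding F_def dist_norm power2_norm_eq_inner[symmetric] by (simp add: norm_minus_commute[of y0 y])
  define G where "G y = sqrt (g y (grad F y) (grad F y))" for y
  have gradC: "continuous_on V (grad F)" by (rule C1_on_continuous_on[OF C1_on_grad[OF F]])
  have contG: "continuous_on V G" unfolding G_def
    by (intro continuous_on_real_sqrt continuous_on_g[where u="\<lambda>y. y"] gradC continuous_on_id) auto
  \<comment> \<open>The margin is split in three: one third is lost on the Hessian near
    \<open>y0\<close>, one third on \<open>h * G y\<close>, and one third remains.\<close>
  define \<delta> where "\<delta> = Trace_lowest m (g y0) (hess F y0) - h * G y0"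
  have \<delta>: "\<delta> > 0" using big by (simp add: \<delta>_def G_def q)
  have ev1: "eventually (\<lambda>y. \<forall>E. ip_form.orthonormal (g y) E \<and> card E = m \<longrightarrow>
      Trace_lowest m (g y0) (hess F y0) - \<delta> / 3 \<le> (\<Sum>e\<in>E. hess F y e e)) (nhds y0)"
    by (rule eventually_hess_trace_ge[OF F y0]) (use \<delta> in simp)
  have "((\<lambda>y. h * G y) \<longlongrightarrow> h * G y0) (nhds y0)"
    using contG open_V y0 by (intro tendsto_mult_left) (metis continuous_at continuous_on_eq_continuous_at isCont_def tendsto_at_iff_tendsto_nhds)
  then have ev2: "eventually (\<lambda>y. h * G y < h * G y0 + \<delta> / 3) (nhds y0)"
    by (rule order_tendstoD(2)) (use \<delta> in simp)
  have ev3: "eventually (\<lambda>y. y \<in> W) (nhds y0)" using W eventually_nhds by blast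
  have "eventually (\<lambda>y. y \<in> W \<and> (\<forall>E. ip_form.orthonormal (g y) E \<and> card E = m \<longrightarrow>
      h * G y + \<delta> / 3 \<le> (\<Sum>e\<in>E. hess F y e e))) (nhds y0)"
    using ev1 ev2 ev3 
  proof eventually_elim
    case (elim y)
    have "h * G y + \<delta> / 3 \<le> Trace_lowest m (g y0) (hess F y0) - \<delta> / 3"
      using elim(2) unfolding \<delta>_def by argo
    then show ?case using elim(1,3) order_trans by blast
  qed
  then obtain r where r: "r > 0" "\<And>y. dist y y0 < r \<Longrightarrow> y \<in> W \<and>
      (\<forall>E. ip_form.orthonormal (g y) E \<and> card E = m \<longrightarrow> h * G y + \<delta> / 3 \<le> (\<Sum>e\<in>E. hess F y e e))"
    unfolding eventually_nhds_metric by blast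
  define \<rho> where "\<rho> = r / 2"
  have \<rho>: "\<rho> > 0" using r by (simp add: \<rho>_def)
  define K where "K = cball y0 \<rho>"
  have KW: "K \<subseteq> W" using r by (auto simp: K_def \<rho>_def dist_commute)
  have KV: "K \<subseteq> V" using KW W by blast
  have K: "compact K" by (simp add: K_def)
  have tr: "h * G y + \<delta> / 3 \<le> (\<Sum>e\<in>E. hess F y e e)"
    if "y \<in> K" "ip_form.orthonormal (g y) E" "card E = m" for y E
    using r that by (auto simp: K_def \<rho>_def dist_commute)
  \<comment> \<open>From distance \<open>\<rho> / 2\<close> on, the quartic is at least
    \<open>(\<rho> / 2) ^ 4\<close>. With half of that as the gap below \<open>f y0\<close>, the
    condition \<open>t0 \<le> F y\<close> forces \<open>f y0 < f y\<close> there; \<open>t1\<close>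
    lies strictly between \<open>t0\<close> and \<open>f y0\<close> so that \<phi>(F) is bounded
    below on \<open>N\<close>.\<close>
  define t0 where "t0 = f y0 - (\<rho> / 2) ^ 4 / 2"
  define t1 where "t1 = (t0 + f y0) / 2"
  have \<rho>4: "(\<rho> / 2) ^ 4 > 0" using \<rho> by simp
  then have t: "t0 < t1" "t1 < f y0" unfolding t1_def t0_def by (auto simp: field_simps)
  obtain \<eta> :: "'e \<Rightarrow> real" where \<eta>: "Ck_on 1 \<eta> UNIV" "\<And>y. 0 \<le> \<eta> y"
    "\<And>y. dist y0 y \<le> \<rho> / 2 \<Longrightarrow> \<eta> y = 1" "\<And>y. dist y0 y \<ge> \<rho> \<Longrightarrow> \<eta> y = 0"
    using exists_C1_cutoff[OF \<rho>] by blast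
  define u where "u y = \<eta> y * square_pos (F y - t0)" for y
  define D\<eta> where "D\<eta> y = frechet_derivative \<eta> (at y)" for y
  define DF where "DF y = frechet_derivative F (at y)" for y
  define u' where "u' y v = \<eta> y * (2 * max (F y - t0) 0 * DF y v) + D\<eta> y v * square_pos (F y - t0)" for y v
  define \<xi> where "\<xi> y = u y *\<^sub>R grad F y" for y
  define N where "N = {y \<in> ball y0 (\<rho> / 2). t1 < F y}"
  define Q where "Q = {y \<in> K. \<rho> / 2 \<le> dist y0 y \<and> t0 \<le> F y}"
  have du: "(u has_derivative u' y) (at y)" if y: "y \<in> V" for y
  proof -
    have "(F has_derivative DF y) (at y)" unfolding DF_def by (rule C1_on_has_derivative[OF F1 y])
    then have "((\<lambda>y. F y - t0) has_derivative DF y) (at y)"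
      using has_derivative_diff[OF _ has_derivative_const] by fastforce
    from has_derivative_compose[OF this square_pos_has_real_derivative[of "F y - t0", THEN has_field_derivative_imp_has_derivative]]
    have 1: "((\<lambda>y. square_pos (F y - t0)) has_derivative (\<lambda>v. 2 * max (F y - t0) 0 * DF y v)) (at y)" .
    have 2: "(\<eta> has_derivative D\<eta> y) (at y)" unfolding D\<eta>_def by (rule C1_on_has_derivative[OF \<eta>(1)]) simp
    show ?thesis unfolding u_def u'_def by (rule has_derivative_mult[OF 2 1])
  qed
  have u1: "Ck_on 1 u V"
    unfolding u_def
    by (intro C1_on_mult C1_on_subset[OF \<eta>(1)] C1_on_square_pos C1_on_diff F1 C1_on_const) auto
  have \<xi>1: "Ck_on 1 \<xi> V" unfolding \<xi>_def by (intro C1_on_scaleR u1 C1_on_grad F)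
  have lie: "lie_form \<xi> y v v = u y * hess F y v v + u' y v * DF y v" if y: "y \<in> V" for y v
    unfolding \<xi>_def lie_form_scale[OF du[OF y] C1_on_has_derivative[OF C1_on_grad[OF F] y] y]
    by (simp add: lie_form_grad[OF F y] g_grad[OF F1 y] DF_def)
  have \<xi>0: "\<xi> y = 0" if "y \<notin> K" for y
    using that \<eta>(4)[of y] by (simp add: K_def \<xi>_def u_def)
  obtain C0 where C0: "C0 \<ge> 0" "\<And>y E. y \<in> K \<Longrightarrow> ip_form.orthonormal (g y) E \<Longrightarrow> \<bar>\<Sum>e\<in>E. lie_form \<xi> y e e\<bar> \<le> C0"
    using lie_trace_bound[OF \<xi>1 K KV] by blast
  have "continuous_on K (\<lambda>y. sqrt (g y (\<xi> y) (\<xi> y)))"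
    using KV by (intro continuous_on_real_sqrt continuous_on_g[where u="\<lambda>y. y"] continuous_on_id
        continuous_on_subset[OF C1_on_continuous_on[OF \<xi>1]]) auto
  then have "bounded ((\<lambda>y. sqrt (g y (\<xi> y) (\<xi> y))) ` K)"
    using K compact_continuous_image compact_imp_bounded by blast
  then obtain C1 where C1: "\<And>y. y \<in> K \<Longrightarrow> \<bar>sqrt (g y (\<xi> y) (\<xi> y))\<bar> \<le> C1"
    unfolding bounded_iff by (auto simp del: abs_of_nonneg)
  have C1': "0 \<le> C1" using C1[of y0] \<rho> by (force simp: K_def)
  \<comment> \<open>\<open>C0\<close> bounds the trace and \<open>C1\<close> the length of the
    field; \<open>h * C1\<close> pays for the term with \<open>h\<close> on \<open>Q\<close>, where
    nothing is known about the sign of the trace.\<close>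
  define C where "C = C0 + C1 + h * C1"
  have C: "0 \<le> C" "C0 \<le> C" "C1 \<le> C" using C0 C1' h by (auto simp: C_def)
  \<comment> \<open>A lower bound of \<open>u\<close> on \<open>N\<close> times the remaining third
    of the margin.\<close>
  define \<epsilon> where "\<epsilon> = (t1 - t0)\<^sup>2 * (\<delta> / 3)"
  have \<epsilon>: "0 < \<epsilon>" using t \<delta> by (simp add: \<epsilon>_def)
  have Fcont: "continuous_on V F" by (rule C1_on_continuous_on[OF F1])
  have NK: "N \<subseteq> K" using \<rho> by (auto simp: N_def K_def)
  have Nopen: "open N"
  proof -
    have "N = ball y0 (\<rho> / 2) \<inter> (F -` {t1<..} \<inter> V)" using NK KV by (auto simp: N_def)
    moreover have "open (F -` {t1<..} \<inter> V)"
      using continuous_on_open_vimage[OF open_V, of F] Fcont by (simp add: Int_commute)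
    ultimately show ?thesis by (metis open_Int open_ball)
  qed
  have Qcompact: "compact Q"
  proof -
    have "closed (K \<inter> F -` {t0..})"
      using continuous_on_subset[OF Fcont KV] K compact_imp_closed by (metis closed_atLeast continuous_on_closed_vimage Int_commute)
    moreover have "Q = K \<inter> ((K \<inter> F -` {t0..}) \<inter> - ball y0 (\<rho> / 2))" by (auto simp: Q_def)
    moreover have "closed (- ball y0 (\<rho> / 2))" by (simp add: closed_Compl)
    ultimately show ?thesis using K by (metis closed_Int compact_Int_closed)
  qed
  have Qf: "f y0 < f y" if "y \<in> Q" for y
  proof -
    have "(\<rho> / 2) ^ 4 \<le> dist y0 y ^ 4" using that \<rho> by (intro power_mono) (auto simp: Q_def)
    moreover have "t0 \<le> f y - dist y0 y ^ 4" using that by (simp add: Q_def Fdist)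
    ultimately show ?thesis using \<rho>4 unfolding t0_def by argo
  qed
  have main: "h * sqrt (g y (\<xi> y) (\<xi> y)) + \<epsilon> * indicator N y - C * indicator Q y \<le> (\<Sum>e\<in>E. lie_form \<xi> y e e)
      \<and> \<bar>\<Sum>e\<in>E. lie_form \<xi> y e e\<bar> \<le> C * indicator K y"
    if y: "y \<in> V" and E: "ip_form.orthonormal (g y) E" "card E = m" for y E
  proof -
    interpret ip_form "g y" by (rule ip_form_g[OF y])
    consider "y \<notin> K" | "y \<in> Q" | "y \<in> K" "y \<notin> Q" "F y < t0" | "y \<in> K" "y \<notin> Q" "t0 \<le> F y" by linarith
    then show ?thesis
    proof cases
      case 1
      have "lie_form \<xi> y e e = 0" for e
        using 1 y \<xi>0 K compact_imp_closed by (intro lie_form_zero_outside[of y K]) auto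
      then show ?thesis using 1 NK by (auto simp: \<xi>0 Q_def G_simps indicator_def)
    next
      case 2
      then have yK: "y \<in> K" by (simp add: Q_def)
      have "y \<notin> N" using 2 by (auto simp: N_def Q_def)
      moreover have "h * sqrt (g y (\<xi> y) (\<xi> y)) \<le> h * C1" using C1[OF yK] h by (intro mult_left_mono) auto
      ultimately show ?thesis using C0(2)[OF yK E(1)] 2 yK C C1' unfolding C_def by auto
    next
      case 3
      then have "u y = 0" "u' y e = 0" for e by (auto simp: u_def u'_def square_pos_def)
      then show ?thesis using 3 t by (auto simp: lie[OF y] \<xi>_def N_def G_simps C)
    next
      case 4
      then have d: "dist y0 y < \<rho> / 2" by (auto simp: Q_def)
      have \<eta>1: "\<eta> y = 1" using \<eta>(3) d by simp
      have "((\<lambda>z. 1) has_derivative (\<lambda>v. 0)) (at y)" by simp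
      then have "(\<eta> has_derivative (\<lambda>v. 0)) (at y)"
        by (rule has_derivative_transform_within_open[where s="ball y0 (\<rho> / 2)"]) (use d \<eta>(3) in auto)
      from frechet_derivative_at[OF this] have D0: "D\<eta> y e = 0" for e unfolding D\<eta>_def by metis
      have up: "0 \<le> u y" using \<eta>(2) by (simp add: u_def square_pos_def)
      have "sqrt (g y (\<xi> y) (\<xi> y)) = u y * G y" unfolding \<xi>_def G_def by (rule g_scaleR_norm[OF y up])
      then have "h * sqrt (g y (\<xi> y) (\<xi> y)) + u y * (\<delta> / 3) = u y * (h * G y + \<delta> / 3)"
        by (simp add: algebra_simps)
      also have "\<dots> \<le> u y * (\<Sum>e\<in>E. hess F y e e)" using tr[OF 4(1) E] up by (rule mult_left_mono)
      also have "\<dots> \<le> (\<Sum>e\<in>E. lie_form \<xi> y e e)"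
        unfolding sum_distrib_left
      proof (rule sum_mono)
        fix e
        have "u' y e * DF y e = 2 * max (F y - t0) 0 * (DF y e)\<^sup>2"
          by (simp add: u'_def D0 \<eta>1 power2_eq_square)
        then show "u y * hess F y e e \<le> lie_form \<xi> y e e" by (simp add: lie[OF y])
      qed
      finally have lower: "h * sqrt (g y (\<xi> y) (\<xi> y)) + u y * (\<delta> / 3) \<le> (\<Sum>e\<in>E. lie_form \<xi> y e e)" .
      have "\<epsilon> * indicator N y \<le> u y * (\<delta> / 3)"
      proof (cases "y \<in> N")
        case True
        then have "(t1 - t0)\<^sup>2 \<le> (F y - t0)\<^sup>2" using t by (intro power_mono) (auto simp: N_def)
        also have "\<dots> = u y" using 4 by (simp add: u_def \<eta>1 square_pos_def)
        finally have "(t1 - t0)\<^sup>2 * (\<delta> / 3) \<le> u y * (\<delta> / 3)" using \<delta> by (intro mult_right_mono) auto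
        then show ?thesis using True by (simp add: \<epsilon>_def)
      qed (use up \<delta> in simp)
      with lower have "h * sqrt (g y (\<xi> y) (\<xi> y)) + \<epsilon> * indicator N y \<le> (\<Sum>e\<in>E. lie_form \<xi> y e e)" by linarith
      then show ?thesis using 4 C0(2)[OF 4(1) E(1)] C by auto
    qed
  qed
  have bd: "sqrt (g y (\<xi> y) (\<xi> y)) \<le> C" if y: "y \<in> V" for y
  proof (cases "y \<in> K")
    case True
    then show ?thesis using C1 C by force
  next
    case False
    then show ?thesis using ip_form.G_simps(7)[OF ip_form_g[OF y]] C by (simp add: \<xi>0)
  qed
  have "y0 \<in> N" using t \<rho> by (simp add: N_def Fy0)
  moreover have "Q \<subseteq> K" by (auto simp: Q_def)
  ultimately show ?thesis
    using \<xi>1 K KW \<xi>0 Qcompact Qf Nopen NK \<epsilon> C(1) bd main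
    by (intro that[of \<xi> K Q N \<epsilon> C]) blast+
qed

text \<open>Length at most 1 makes the field a competitor in the supremum defining the total
  variation. The inequalities are homogeneous in the field and the constants, so dividing by
  \<open>C + 1\<close> suffices.\<close>

lemma exists_test_vector_field:
  assumes "Ck_on 2 f V" "open W" "y0 \<in> W" "W \<subseteq> V" and h: "0 \<le> h"
    and "h * sqrt (g y0 (grad f y0) (grad f y0)) < Trace_lowest m (g y0) (hess f y0)"
  obtains \<xi> K Q N C \<epsilon> where "Ck_on 1 \<xi> V" "compact K" "K \<subseteq> W" "\<And>y. y \<in> V - K \<Longrightarrow> \<xi> y = 0"
    "compact Q" "Q \<subseteq> K" "\<And>y. y \<in> Q \<Longrightarrow> f y0 < f y" "open N" "y0 \<in> N" "N \<subseteq> K" "0 < \<epsilon>" "0 \<le> C"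
    "\<And>y. y \<in> V \<Longrightarrow> sqrt (g y (\<xi> y) (\<xi> y)) \<le> 1"
    "\<And>y E. y \<in> V \<Longrightarrow> ip_form.orthonormal (g y) E \<Longrightarrow> card E = m \<Longrightarrow>
       h * sqrt (g y (\<xi> y) (\<xi> y)) + \<epsilon> * indicator N y - C * indicator Q y \<le> (\<Sum>e\<in>E. lie_form \<xi> y e e)"
    "\<And>y E. y \<in> V \<Longrightarrow> ip_form.orthonormal (g y) E \<Longrightarrow> card E = m \<Longrightarrow>
       \<bar>\<Sum>e\<in>E. lie_form \<xi> y e e\<bar> \<le> C * indicator K y"
proof (rule exists_test_vector_field_unscaled[OF assms])
  fix \<xi> K Q N C \<epsilon>
  assume u: "Ck_on 1 \<xi> V" "compact K" "K \<subseteq> W" "\<And>y. y \<in> V - K \<Longrightarrow> \<xi> y = 0"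
    "compact Q" "Q \<subseteq> K" "\<And>y. y \<in> Q \<Longrightarrow> f y0 < f y" "open N" "y0 \<in> N" "N \<subseteq> K" "0 < \<epsilon>" "0 \<le> C"
    "\<And>y. y \<in> V \<Longrightarrow> sqrt (g y (\<xi> y) (\<xi> y)) \<le> C"
    and main: "\<And>y E. y \<in> V \<Longrightarrow> ip_form.orthonormal (g y) E \<Longrightarrow> card E = m \<Longrightarrow>
       h * sqrt (g y (\<xi> y) (\<xi> y)) + \<epsilon> * indicator N y - C * indicator Q y \<le> (\<Sum>e\<in>E. lie_form \<xi> y e e)"
    "\<And>y E. y \<in> V \<Longrightarrow> ip_form.orthonormal (g y) E \<Longrightarrow> card E = m \<Longrightarrow>
       \<bar>\<Sum>e\<in>E. lie_form \<xi> y e e\<bar> \<le> C * indicator K y"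
  define \<kappa> where "\<kappa> = 1 / (C + 1)"
  have \<kappa>: "\<kappa> > 0" "\<kappa> * C \<le> 1" using u(12) by (auto simp: \<kappa>_def)
  have lie: "lie_form (\<lambda>z. \<kappa> *\<^sub>R \<xi> z) y v v = \<kappa> * lie_form \<xi> y v v" if "y \<in> V" for y v
    using lie_form_scale[OF has_derivative_const C1_on_has_derivative[OF u(1) that] that] by simp
  have nrm: "sqrt (g y (\<kappa> *\<^sub>R \<xi> y) (\<kappa> *\<^sub>R \<xi> y)) = \<kappa> * sqrt (g y (\<xi> y) (\<xi> y))" if "y \<in> V" for y
    using g_scaleR_norm[OF that] \<kappa> by simp
  show thesis
  proof (rule that[of "\<lambda>z. \<kappa> *\<^sub>R \<xi> z" K Q N "\<kappa> * \<epsilon>" "\<kappa> * C"])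
    show "Ck_on 1 (\<lambda>z. \<kappa> *\<^sub>R \<xi> z) V" by (intro C1_on_scaleR C1_on_const u(1))
    show "sqrt (g y (\<kappa> *\<^sub>R \<xi> y) (\<kappa> *\<^sub>R \<xi> y)) \<le> 1" if "y \<in> V" for y
      unfolding nrm[OF that] by (rule order_trans[OF mult_left_mono[OF u(13)[OF that]] \<kappa>(2)]) (use \<kappa> in simp)
    fix y E assume y: "y \<in> V" and E: "ip_form.orthonormal (g y) E" "card E = m"
    have s: "(\<Sum>e\<in>E. lie_form (\<lambda>z. \<kappa> *\<^sub>R \<xi> z) y e e) = \<kappa> * (\<Sum>e\<in>E. lie_form \<xi> y e e)"
      by (simp add: lie[OF y] sum_distrib_left)
    show "h * sqrt (g y (\<kappa> *\<^sub>R \<xi> y) (\<kappa> *\<^sub>R \<xi> y)) + \<kappa> * \<epsilon> * indicator N y - \<kappa> * C * indicator Q y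
        \<le> (\<Sum>e\<in>E. lie_form (\<lambda>z. \<kappa> *\<^sub>R \<xi> z) y e e)"
      using mult_left_mono[OF main(1)[OF y E], of \<kappa>] \<kappa> unfolding s nrm[OF y]
      by (simp add: algebra_simps)
    show "\<bar>\<Sum>e\<in>E. lie_form (\<lambda>z. \<kappa> *\<^sub>R \<xi> z) y e e\<bar> \<le> \<kappa> * C * indicator K y"
      using mult_left_mono[OF main(2)[OF y E], of \<kappa>] \<kappa> unfolding s by (simp add: abs_mult mult.assoc)
  qed (use u \<kappa> in auto)
qed

end

section \<open>Riemannian balls\<close>

lemma C1_differentiable_on_open_Un:
  fixes f :: "real \<Rightarrow> 'b::real_normed_vector"
  assumes "open A" "open B" "f C1_differentiable_on A" "f C1_differentiable_on B"
  shows "f C1_differentiable_on (A \<union> B)"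
  using assms unfolding C1_differentiable_on_eq by (auto intro: continuous_on_open_Un)

text \<open>Homogeneity reduces this to unit vectors, and a continuous positive function on the
  compact product of a closed ball and the unit sphere has positive bounds.\<close>

lemma (in metric_domain) norm_comparison:
  assumes "y0 \<in> V"
  obtains \<rho> a C where "\<rho> > 0" "a > 0" "C > 0" "cball y0 \<rho> \<subseteq> V"
    "\<And>y v. y \<in> cball y0 \<rho> \<Longrightarrow> a * norm v \<le> sqrt (g y v v) \<and> sqrt (g y v v) \<le> C * norm v"
proof -
  obtain \<rho> where \<rho>: "\<rho> > 0" "cball y0 \<rho> \<subseteq> V"
    using open_V assms open_contains_cball by blast
  let ?K = "cball y0 \<rho> \<times> sphere (0::'e) 1"
  define q where "q z = sqrt (g (fst z) (snd z) (snd z))" for z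
  have K: "compact ?K" by (intro compact_Times) auto
  obtain b :: 'e where "b \<in> Basis" using nonempty_Basis by blast
  then have "(y0, b) \<in> ?K" using \<rho> by simp
  then have ne: "?K \<noteq> {}" by blast
  have cont: "continuous_on ?K q" unfolding q_def
    using \<rho> by (intro continuous_on_real_sqrt continuous_on_g continuous_intros) auto
  obtain z1 where z1: "z1 \<in> ?K" "\<And>z. z \<in> ?K \<Longrightarrow> q z1 \<le> q z"
    using continuous_attains_inf[OF K ne cont] by blast
  obtain z2 where z2: "z2 \<in> ?K" "\<And>z. z \<in> ?K \<Longrightarrow> q z \<le> q z2"
    using continuous_attains_sup[OF K ne cont] by blast
  have pos: "q z > 0" if "z \<in> ?K" for z
  proof -
    have "fst z \<in> V" "snd z \<noteq> 0" using that \<rho> by (auto simp: subset_iff)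
    then show ?thesis using ip_form.pos[OF ip_form_g] by (simp add: q_def)
  qed
  show ?thesis
  proof (rule that[of \<rho> "q z1" "q z2"])
    show "q z1 * norm v \<le> sqrt (g y v v) \<and> sqrt (g y v v) \<le> q z2 * norm v" if y: "y \<in> cball y0 \<rho>" for y v
    proof (cases "v = 0")
      case True
      then show ?thesis using ip_form.G_simps(7)[OF ip_form_g] y \<rho> by (auto simp: subset_iff)
    next
      case False
      define w where "w = (1 / norm v) *\<^sub>R v"
      have v: "v = norm v *\<^sub>R w" using False by (simp add: w_def)
      have "(y, w) \<in> ?K" using y False by (simp add: w_def)
      then have "q z1 \<le> sqrt (g y w w)" "sqrt (g y w w) \<le> q z2"
        using z1(2)[of "(y, w)"] z2(2)[of "(y, w)"] by (auto simp: q_def)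
      moreover have "sqrt (g y v v) = norm v * sqrt (g y w w)"
        using g_scaleR_norm[of y "norm v" w] v y \<rho> by auto
      ultimately show ?thesis by (simp add: mult.commute mult_left_mono)
    qed
  qed (use \<rho> pos z1 z2 in auto)
qed

context riemannian
begin

abbreviation speed :: "(real \<Rightarrow> 'a) \<Rightarrow> real \<Rightarrow> real" where
  "speed \<gamma> t \<equiv> gnorm \<Omega> (\<gamma> t) (velocity \<Omega> \<gamma> t)"

lemma gnorm_to_chart:
  "c \<in> atlas \<Omega> \<Longrightarrow> x \<in> cdom c \<Longrightarrow>
    gnorm \<Omega> x v = sqrt (metric_in \<Omega> c (cmap c x) (to_chart \<Omega> c x v) (to_chart \<Omega> c x v))"
  by (simp add: gnorm_def metric_in_to_chart)

lemma gnorm_scaleR: "0 \<le> k \<Longrightarrow> gnorm \<Omega> x (k *\<^sub>R v) = k * gnorm \<Omega> x v"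
  and gnorm_zero: "gnorm \<Omega> x 0 = 0" and gnorm_nonneg: "0 \<le> gnorm \<Omega> x v"
proof -
  interpret ip_form "metric_at \<Omega> x" by (rule ip_form_metric_at)
  show "0 \<le> k \<Longrightarrow> gnorm \<Omega> x (k *\<^sub>R v) = k * gnorm \<Omega> x v"
    by (simp add: gnorm_def G_simps real_sqrt_mult mult.assoc[symmetric])
  show "gnorm \<Omega> x 0 = 0" "0 \<le> gnorm \<Omega> x v" by (simp_all add: gnorm_def G_simps nonneg)
qed

text \<open>\<open>velocity\<close> is read in a chart that changes with \<open>t\<close>; the chain
  rule moves it to one fixed chart, where lengths can be compared with Euclidean ones.\<close>

lemma speed_eq:
  assumes c: "c \<in> atlas \<Omega>" and t: "isCont \<gamma> t" "\<gamma> t \<in> cdom c"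
    and w: "((cmap c \<circ> \<gamma>) has_vector_derivative w) (at t)"
  shows "speed \<gamma> t = sqrt (metric_in \<Omega> c (cmap c (\<gamma> t)) w w)"
proof -
  let ?x = "\<gamma> t" let ?d = "chart_at \<Omega> (\<gamma> t)"
  have d: "?d \<in> atlas \<Omega>" "?x \<in> cdom ?d" by (rule chart_at)+
  have "((cmap ?d \<circ> cinv c) has_derivative coord_change c ?d ?x) (at ((cmap c \<circ> \<gamma>) t))"
    using coord_change_has_derivative[OF c d(1) t(2) d(2)] by simp
  from has_derivative_compose[OF w[unfolded has_vector_derivative_def] this]
  have comp: "((\<lambda>s. (cmap ?d \<circ> cinv c) ((cmap c \<circ> \<gamma>) s)) has_vector_derivative coord_change c ?d ?x w) (at t)"
    by (simp add: has_vector_derivative_def linear_scale[OF coord_change_linear[OF c d(1) t(2) d(2)]])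
  obtain T where T: "open T" "t \<in> T" "\<And>s. s \<in> T \<Longrightarrow> \<gamma> s \<in> cdom c \<inter> cdom ?d"
    using t d open_cdom[OF c] open_cdom[OF d(1)] continuous_at_open[of t \<gamma>] by (metis IntI open_Int)
  have "((cmap ?d \<circ> \<gamma>) has_vector_derivative coord_change c ?d ?x w) (at t)"
    by (rule has_vector_derivative_transform_within_open[OF comp T(1,2)])
       (use T cinv_cmap[OF c] in auto)
  then have "velocity \<Omega> \<gamma> t = coord_change c ?d ?x w"
    unfolding velocity_def by (rule vector_derivative_at)
  then have "to_chart \<Omega> c ?x (velocity \<Omega> \<gamma> t) = w"
    using to_of_chart[OF c t(2)] by (simp add: of_chart_def)
  then show ?thesis using gnorm_to_chart[OF c t(2)] by simp
qed

lemma isCont_curve: "continuous_on {0..1} \<gamma> \<Longrightarrow> t \<in> {0<..<1} \<Longrightarrow> isCont \<gamma> t" for \<gamma> :: "real \<Rightarrow> 'a"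
  by (rule continuous_on_interior[of "{0..1}"]) auto

lemma open_curve_preimage:
  fixes \<gamma> :: "real \<Rightarrow> 'a"
  assumes "continuous_on {0..1} \<gamma>" "finite S" "open U"
  shows "open {t \<in> {0<..<1} - S. \<gamma> t \<in> U}"
proof -
  have "continuous_on ({0<..<1} - S) \<gamma>" by (rule continuous_on_subset[OF assms(1)]) auto
  moreover have "open ({0<..<1::real} - S)" using assms(2) by (intro open_Diff finite_imp_closed) auto
  ultimately have "open (\<gamma> -` U \<inter> ({0<..<1} - S))"
    using assms(3) continuous_on_open_vimage by blast
  moreover have "\<gamma> -` U \<inter> ({0<..<1} - S) = {t \<in> {0<..<1} - S. \<gamma> t \<in> U}" by auto
  ultimately show ?thesis by simp
qed

text \<open>Supplies the measurability of the speed that substitution in the length of a rescaled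
  curve requires.\<close>

lemma continuous_on_speed:
  assumes \<gamma>: "continuous_on {0..1} \<gamma>" and S: "finite S"
    and C1: "\<And>c. c \<in> atlas \<Omega> \<Longrightarrow> (cmap c \<circ> \<gamma>) C1_differentiable_on {t \<in> {0<..<1} - S. \<gamma> t \<in> cdom c}"
  shows "continuous_on ({0<..<1} - S) (speed \<gamma>)"
proof (rule continuous_at_imp_continuous_on, rule ballI)
  fix t assume t: "t \<in> {0<..<1} - S"
  define c where "c = chart_at \<Omega> (\<gamma> t)"
  have c: "c \<in> atlas \<Omega>" "\<gamma> t \<in> cdom c" unfolding c_def by (rule chart_at)+
  define T where "T = {t \<in> {0<..<1} - S. \<gamma> t \<in> cdom c}"
  define w where "w s = vector_derivative (cmap c \<circ> \<gamma>) (at s)" for s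
  have T: "open T" "t \<in> T"
    unfolding T_def using open_curve_preimage[OF \<gamma> S open_cdom[OF c(1)]] t c by auto
  have w: "((cmap c \<circ> \<gamma>) has_vector_derivative w s) (at s)" "continuous_on T w" if "s \<in> T" for s
    using C1[OF c(1)] that unfolding T_def[symmetric] C1_differentiable_on_eq w_def
    by (auto simp: vector_derivative_works[symmetric])
  have speed: "speed \<gamma> s = sqrt (metric_in \<Omega> c (cmap c (\<gamma> s)) (w s) (w s))" if "s \<in> T" for s
    using that w by (intro speed_eq c isCont_curve \<gamma>) (auto simp: T_def)
  interpret m: metric_domain "cimg c" "metric_in \<Omega> c" by (rule metric_domain_chart[OF c(1)])
  have "continuous_on T (\<lambda>s. cmap c (\<gamma> s))"
    by (rule continuous_on_compose2[OF continuous_cmap[OF c(1)] continuous_on_subset[OF \<gamma>]])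
       (auto simp: T_def)
  then have "continuous_on T (\<lambda>s. sqrt (metric_in \<Omega> c (cmap c (\<gamma> s)) (w s) (w s)))"
    using w T by (intro continuous_on_real_sqrt m.continuous_on_g) (auto simp: T_def)
  then have "continuous_on T (speed \<gamma>)" using speed by (simp cong: continuous_on_cong)
  then show "isCont (speed \<gamma>) t" using T continuous_on_eq_continuous_at by blast
qed

text \<open>The finitely many exceptional times and the end points form a null set.\<close>

lemma curve_length_eq:
  assumes "finite S"
  shows "curve_length \<Omega> \<gamma> = (\<integral>\<^sup>+ t. ennreal (indicator ({0<..<1} - S) t *\<^sub>R speed \<gamma> t) \<partial>lborel)"
  unfolding curve_length_def
proof (rule nn_integral_cong_AE)
  have "AE t in lborel. t \<notin> insert 0 (insert 1 S)"
    using assms by (intro AE_not_in countable_imp_null_set_lborel) (auto intro: countable_finite)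
  then show "AE t in lborel. ennreal (speed \<gamma> t) * indicator {0..1} t
      = ennreal (indicator ({0<..<1} - S) t *\<^sub>R speed \<gamma> t)"
    by eventually_elim (auto simp: indicator_def)
qed

lemma self_in_gball:
  assumes "r > 0" shows "x \<in> gball \<Omega> x r"
proof -
  have "curve_length \<Omega> (\<lambda>t. x) = 0"
    by (simp add: curve_length_def velocity_def o_def gnorm_zero)
  moreover have "piecewise_C1_curve \<Omega> (\<lambda>t. x)"
    unfolding piecewise_C1_curve_def by (auto simp: o_def intro!: exI[of _ "{}"])
  ultimately have "riemannian_dist \<Omega> x x \<le> 0"
    unfolding riemannian_dist_def by (intro INF_lower2[of "\<lambda>t. x"]) auto
  then show ?thesis using assms by (simp add: gball_def)
qed

text \<open>A curve that leaves a coordinate ball has to cross it, and inside it the Riemannian length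
  dominates the Euclidean one.\<close>

lemma exists_gball_subset:
  assumes U: "open U" "p \<in> U"
  obtains r where "r > 0" "gball \<Omega> p r \<subseteq> U"
proof -
  define c where "c = chart_at \<Omega> p"
  have c: "c \<in> atlas \<Omega>" "p \<in> cdom c" unfolding c_def by (rule chart_at)+
  interpret m: metric_domain "cimg c" "metric_in \<Omega> c" by (rule metric_domain_chart[OF c(1)])
  define y0 where "y0 = cmap c p"
  obtain \<rho>1 a C where 1: "\<rho>1 > 0" "a > 0" "cball y0 \<rho>1 \<subseteq> cimg c"
    "\<And>y v. y \<in> cball y0 \<rho>1 \<Longrightarrow> a * norm v \<le> sqrt (metric_in \<Omega> c y v v) \<and> sqrt (metric_in \<Omega> c y v v) \<le> C * norm v"
    using m.norm_comparison[of y0] c unfolding y0_def by (metis imageI)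
  have "open (cmap c ` (cdom c \<inter> U))" "y0 \<in> cmap c ` (cdom c \<inter> U)"
    using open_cmap_image[OF c(1) U(1)] c U by (auto simp: y0_def)
  then obtain \<rho>2 where 2: "\<rho>2 > 0" "ball y0 \<rho>2 \<subseteq> cmap c ` (cdom c \<inter> U)" using openE by blast
  define \<rho> where "\<rho> = min \<rho>1 \<rho>2"
  have \<rho>: "\<rho> > 0" using 1 2 by (simp add: \<rho>_def)
  have b1: "ball y0 \<rho> \<subseteq> cball y0 \<rho>1" by (auto simp: \<rho>_def)
  have bc: "ball y0 \<rho> \<subseteq> cimg c" using b1 1 by blast
  define B where "B = cinv c ` ball y0 \<rho>"
  have BU: "B \<subseteq> U"
  proof
    fix x assume "x \<in> B"
    then obtain y where y: "y \<in> ball y0 \<rho>" "x = cinv c y" by (auto simp: B_def)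
    then have "y \<in> cmap c ` (cdom c \<inter> U)" using 2 by (auto simp: \<rho>_def)
    then show "x \<in> U" using y cinv_cmap[OF c(1)] by auto
  qed
  have openB: "open B" unfolding B_def by (rule open_cinv_image[OF c(1) open_ball bc])
  have Bc: "x \<in> cdom c" "cmap c x \<in> ball y0 \<rho>" if "x \<in> B" for x
    using that bc cinv_in[OF c(1)] cmap_cinv[OF c(1)] by (auto simp: B_def subset_iff)
  have len: "ennreal (a * (\<rho> / 2)) \<le> curve_length \<Omega> \<gamma>"
    if \<gamma>: "piecewise_C1_curve \<Omega> \<gamma>" "\<gamma> 0 = p" "\<gamma> 1 \<notin> B" for \<gamma>
  proof -
    have cont: "continuous_on {0..1} \<gamma>" using \<gamma> by (simp add: piecewise_C1_curve_def)
    obtain S where S: "finite S"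
      "\<And>c. c \<in> atlas \<Omega> \<Longrightarrow> (cmap c \<circ> \<gamma>) C1_differentiable_on {t \<in> {0<..<1} - S. \<gamma> t \<in> cdom c}"
      using \<gamma>(1) unfolding piecewise_C1_curve_def by blast
    define T where "T = {t \<in> {0..1}. \<gamma> t \<notin> B}"
    have "T = {0..1} \<inter> \<gamma> -` (- B)" by (auto simp: T_def)
    then have clT: "closed T"
      using continuous_closed_preimage[OF cont] openB by (metis closed_Compl closed_atLeastAtMost)
    have T1: "1 \<in> T" "bdd_below T" using \<gamma> by (auto simp: T_def intro!: bdd_belowI[of _ 0])
    define t2 where "t2 = Inf T"
    have t2: "t2 \<in> T" unfolding t2_def by (rule closed_contains_Inf) (use T1 clT in auto)
    have before: "\<gamma> t \<in> B" if "0 \<le> t" "t < t2" for t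
    proof (rule ccontr)
      assume "\<gamma> t \<notin> B"
      then have "t \<in> T" using that t2 by (auto simp: T_def)
      then have "t2 \<le> t" unfolding t2_def using T1 by (intro cInf_lower) auto
      then show False using that by simp
    qed
    have pB: "p \<in> B" 
      unfolding B_def by (rule image_eqI[of _ _ "cmap c p"]) (simp_all add: y0_def \<rho> cinv_cmap[OF c])
    have t2pos: "0 < t2" using t2 \<gamma>(2) pB by (cases "t2 = 0") (auto simp: T_def)
    \<comment> \<open>Otherwise the curve before \<open>t2\<close> would stay in the image
      \<open>L\<close> of a smaller closed ball. \<open>L\<close> is compact, hence closed in a
      Hausdorff space, and would contain the exit point as well; arguing with \<open>L\<close>
      avoids reading that point in the chart, whose domain it may have left.\<close>
    have "\<exists>t. 0 \<le> t \<and> t < t2 \<and> \<rho> / 2 < dist y0 (cmap c (\<gamma> t))"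
    proof (rule ccontr)
      assume "\<not> ?thesis"
      then have near: "\<And>t. 0 \<le> t \<Longrightarrow> t < t2 \<Longrightarrow> dist y0 (cmap c (\<gamma> t)) \<le> \<rho> / 2" by force
      define L where "L = cinv c ` cball y0 (\<rho> / 2)"
      have sub: "cball y0 (\<rho> / 2) \<subseteq> ball y0 \<rho>" using \<rho> by auto
      have "compact L" unfolding L_def
        using continuous_cinv[OF c(1)] sub bc
        by (intro compact_continuous_image continuous_on_subset[OF continuous_cinv[OF c(1)]]) auto
      then have "closed L" by (rule compact_imp_closed)
      have inL: "\<gamma> t \<in> L" if "t \<in> {0..<t2}" for t
      proof -
        have "\<gamma> t = cinv c (cmap c (\<gamma> t))" using cinv_cmap[OF c(1)] Bc before that by auto
        then show ?thesis using near[of t] that unfolding L_def by force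
      qed
      have cl: "closure {0..<t2} = {0..t2}" using t2pos by simp
      have "continuous_on {0..t2} \<gamma>" using t2 by (intro continuous_on_subset[OF cont]) (auto simp: T_def)
      then have "\<gamma> ` closure {0..<t2} \<subseteq> L"
        using inL by (intro image_closure_subset[OF _ \<open>closed L\<close>]) (auto simp: cl)
      then have "\<gamma> ` {0..t2} \<subseteq> L" by (simp only: cl)
      then have "\<gamma> t2 \<in> L" by (rule subsetD) (use t2pos in \<open>simp add: image_eqI\<close>)
      then have "\<gamma> t2 \<in> B" unfolding L_def B_def by (rule subsetD[OF image_mono[OF sub]])
      then show False using t2 by (simp add: T_def)
    qed
    then obtain t1 where t1: "0 \<le> t1" "t1 < t2" "\<rho> / 2 < dist y0 (cmap c (\<gamma> t1))" by blast
    have t2le: "t2 \<le> 1" using t2 by (simp add: T_def)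
    define w where "w s = vector_derivative (cmap c \<circ> \<gamma>) (at s)" for s
    define A where "A = {0<..<t1} - S"
    have A: "A \<subseteq> {t \<in> {0<..<1} - S. \<gamma> t \<in> cdom c}" using before t1 t2le Bc by (auto simp: A_def)
    have dw: "((cmap c \<circ> \<gamma>) has_vector_derivative w s) (at s)" if "s \<in> A" for s
      using S(2)[OF c(1)] that A unfolding C1_differentiable_on_eq w_def
      by (auto simp: vector_derivative_works[symmetric])
    have contw: "continuous_on A w"
      using S(2)[OF c(1)] continuous_on_subset[OF _ A] unfolding C1_differentiable_on_eq w_def by blast
    have contc: "continuous_on {0..t1} (cmap c \<circ> \<gamma>)"
      using before t1 t2le Bc
      by (intro continuous_on_compose continuous_on_subset[OF cont] continuous_on_subset[OF continuous_cmap[OF c(1)]]) auto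
    have FTC: "(w has_integral ((cmap c \<circ> \<gamma>) t1 - (cmap c \<circ> \<gamma>) 0)) {0..t1}"
      by (rule fundamental_theorem_of_calculus_interior_strong[OF S(1) t1(1) dw contc]) (simp add: A_def)
    have Aborel: "A \<in> sets borel" unfolding A_def using S(1) by (intro sets.Diff) (auto intro: finite_imp_closed borel_closed)
    define wA where "wA s = indicator A s *\<^sub>R w s" for s
    have wA: "wA \<in> borel_measurable borel"
      unfolding wA_def by (rule borel_measurable_continuous_on_indicator[OF Aborel contw])
    have low: "ennreal (a * norm (wA s)) \<le> ennreal (indicator ({0<..<1} - S) s *\<^sub>R speed \<gamma> s)" for s
    proof (cases "s \<in> A")
      case True
      then have s: "s \<in> {0<..<1} - S" "0 \<le> s" "s < t2" using t1 t2le by (auto simp: A_def)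
      have "speed \<gamma> s = sqrt (metric_in \<Omega> c (cmap c (\<gamma> s)) (w s) (w s))"
        using s dw[OF True] Bc[OF before] by (intro speed_eq c isCont_curve cont) auto
      moreover have "cmap c (\<gamma> s) \<in> cball y0 \<rho>1" using Bc[OF before] s b1 by blast
      ultimately have "a * norm (w s) \<le> speed \<gamma> s" using 1(4) by metis
      then show ?thesis using True s by (simp add: wA_def ennreal_leI)
    qed (simp add: wA_def)
    \<comment> \<open>The fundamental theorem of calculus yields a gauge integral. It agrees with
      the Lebesgue integral when the Euclidean length is finite, and the estimate is trivial
      otherwise.\<close>
    have "ennreal (a * (\<rho> / 2)) \<le> ennreal a * (\<integral>\<^sup>+ s. ennreal (norm (wA s)) \<partial>lborel)"
    proof (cases "(\<integral>\<^sup>+ s. ennreal (norm (wA s)) \<partial>lborel) < \<infinity>")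
      case True
      then have int: "integrable lborel wA" using wA by (intro integrableI_bounded) auto
      have "(wA has_integral (\<integral>s. wA s \<partial>lborel)) UNIV" by (rule has_integral_integral_lborel[OF int])
      moreover have "(wA has_integral ((cmap c \<circ> \<gamma>) t1 - (cmap c \<circ> \<gamma>) 0)) UNIV"
      proof -
        have "((\<lambda>s. if s \<in> {0..t1} then w s else 0) has_integral ((cmap c \<circ> \<gamma>) t1 - (cmap c \<circ> \<gamma>) 0)) UNIV"
          using FTC by (simp only: has_integral_restrict_UNIV)
        then show ?thesis
          by (rule has_integral_spike[of "insert 0 (insert t1 S)", rotated 2])
             (use S(1) in \<open>auto simp: wA_def A_def indicator_def intro: negligible_finite\<close>)
      qed
      ultimately have "(\<integral>s. wA s \<partial>lborel) = (cmap c \<circ> \<gamma>) t1 - (cmap c \<circ> \<gamma>) 0"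
        by (rule has_integral_unique)
      then have "norm (cmap c (\<gamma> t1) - y0) = norm (\<integral>s. wA s \<partial>lborel)" by (simp add: \<gamma>(2) y0_def)
      then have "ennreal (norm (cmap c (\<gamma> t1) - y0)) \<le> (\<integral>\<^sup>+ s. ennreal (norm (wA s)) \<partial>lborel)"
        using integral_norm_bound_ennreal[OF int] by simp
      moreover have "\<rho> / 2 \<le> norm (cmap c (\<gamma> t1) - y0)" using t1(3) by (simp add: dist_norm norm_minus_commute)
      ultimately have "ennreal (\<rho> / 2) \<le> (\<integral>\<^sup>+ s. ennreal (norm (wA s)) \<partial>lborel)"
        by (meson ennreal_leI order_trans)
      then have "ennreal a * ennreal (\<rho> / 2) \<le> ennreal a * (\<integral>\<^sup>+ s. ennreal (norm (wA s)) \<partial>lborel)"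
        by (rule mult_left_mono) simp
      then show ?thesis using 1(2) \<rho> by (subst ennreal_mult) simp_all
    next
      case False
      then have "(\<integral>\<^sup>+ s. ennreal (norm (wA s)) \<partial>lborel) = top"
        by (simp add: less_top[symmetric])
      then show ?thesis using 1(2) by (simp add: ennreal_mult_top)
    qed
    also have "\<dots> = (\<integral>\<^sup>+ s. ennreal (a * norm (wA s)) \<partial>lborel)"
      using 1(2) wA by (simp add: ennreal_mult nn_integral_cmult)
    also have "\<dots> \<le> (\<integral>\<^sup>+ s. ennreal (indicator ({0<..<1} - S) s *\<^sub>R speed \<gamma> s) \<partial>lborel)"
      by (intro nn_integral_mono low)
    also have "\<dots> = curve_length \<Omega> \<gamma>" by (rule curve_length_eq[OF S(1), symmetric])
    finally show ?thesis .
  qed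
  show ?thesis
  proof (rule that[of "a * (\<rho> / 2)"])
    show "a * (\<rho> / 2) > 0" using 1(2) \<rho> by simp
    show "gball \<Omega> p (a * (\<rho> / 2)) \<subseteq> U"
    proof
      fix x assume "x \<in> gball \<Omega> p (a * (\<rho> / 2))"
      then obtain \<gamma> where "piecewise_C1_curve \<Omega> \<gamma>" "\<gamma> 0 = p" "\<gamma> 1 = x" "curve_length \<Omega> \<gamma> < ennreal (a * (\<rho> / 2))"
        unfolding gball_def riemannian_dist_def by (auto simp: INF_less_iff)
      then show "x \<in> U" using len BU by (metis leD subsetD)
    qed
  qed
qed


text \<open>A curve from \<open>x\<close> to \<open>y\<close> shorter than \<open>r\<close> is
  prolonged by a straight segment in a chart at \<open>y\<close>, whose length is at most
  \<open>C\<close> times its Euclidean length. Openness makes balls measurable and yields finite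
  subcovers of compact sets.\<close>

lemma open_gball: "open (gball \<Omega> x r)"
proof (subst open_subopen, intro ballI)
  fix y assume "y \<in> gball \<Omega> x r"
  then obtain \<gamma>1 where \<gamma>1: "piecewise_C1_curve \<Omega> \<gamma>1" "\<gamma>1 0 = x" "\<gamma>1 1 = y" "curve_length \<Omega> \<gamma>1 < ennreal r"
    unfolding gball_def riemannian_dist_def by (auto simp: INF_less_iff)
  obtain S1 where S1: "finite S1"
    "\<And>d. d \<in> atlas \<Omega> \<Longrightarrow> (cmap d \<circ> \<gamma>1) C1_differentiable_on {t \<in> {0<..<1} - S1. \<gamma>1 t \<in> cdom d}"
    and cont1: "continuous_on {0..1} \<gamma>1"
    using \<gamma>1(1) unfolding piecewise_C1_curve_def by blast
  obtain l where l: "curve_length \<Omega> \<gamma>1 = ennreal l" "0 \<le> l"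
    using \<gamma>1(4) by (cases "curve_length \<Omega> \<gamma>1") auto
  have lr: "l < r" using \<gamma>1(4) l by (simp add: ennreal_less_iff)
  define c where "c = chart_at \<Omega> y"
  have c: "c \<in> atlas \<Omega>" "y \<in> cdom c" unfolding c_def by (rule chart_at)+
  interpret m: metric_domain "cimg c" "metric_in \<Omega> c" by (rule metric_domain_chart[OF c(1)])
  define y0 where "y0 = cmap c y"
  have y0: "y0 \<in> cimg c" using c by (simp add: y0_def)
  obtain \<rho> a C where \<rho>: "\<rho> > 0" "C > 0" "cball y0 \<rho> \<subseteq> cimg c"
    "\<And>y v. y \<in> cball y0 \<rho> \<Longrightarrow> a * norm v \<le> sqrt (metric_in \<Omega> c y v v) \<and> sqrt (metric_in \<Omega> c y v v) \<le> C * norm v"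
    using m.norm_comparison[OF y0] by metis
  \<comment> \<open>The first bound keeps the segment where the norm comparison holds, the second
    keeps its length below the slack \<open>r - l\<close>.\<close>
  define s where "s = min \<rho> ((r - l) / C)"
  have s: "s > 0" using \<rho> lr by (simp add: s_def)
  have sub: "ball y0 s \<subseteq> cball y0 \<rho>" by (auto simp: s_def)
  have subc: "ball y0 s \<subseteq> cimg c" using sub \<rho> by blast
  show "\<exists>T. open T \<and> y \<in> T \<and> T \<subseteq> gball \<Omega> x r"
  proof (intro exI[of _ "cinv c ` ball y0 s"] conjI)
    show "open (cinv c ` ball y0 s)" by (rule open_cinv_image[OF c(1) open_ball subc])
    show "y \<in> cinv c ` ball y0 s"
      by (rule image_eqI[of _ _ "cmap c y"]) (simp_all add: y0_def s cinv_cmap[OF c])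
    show "cinv c ` ball y0 s \<subseteq> gball \<Omega> x r"
    proof
      fix z assume "z \<in> cinv c ` ball y0 s"
      then obtain z0 where z0: "z0 \<in> ball y0 s" "z = cinv c z0" by blast
      define v where "v = z0 - y0"
      have nv: "norm v < s" using z0 by (simp add: v_def dist_norm norm_minus_commute)
      have inball: "y0 + \<tau> *\<^sub>R v \<in> ball y0 s" if "0 \<le> \<tau>" "\<tau> \<le> 1" for \<tau>
      proof -
        have "\<tau> * norm v \<le> norm v" using that by (simp add: mult_left_le_one_le)
        then show ?thesis using nv that by (simp add: dist_norm)
      qed
      define \<gamma>2 where "\<gamma>2 \<tau> = cinv c (y0 + \<tau> *\<^sub>R v)" for \<tau>
      define \<gamma> where "\<gamma> t = (if t \<le> 1 / 2 then \<gamma>1 (2 * t) else \<gamma>2 (2 * t - 1))" for t :: real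
      have \<gamma>2c: "\<gamma>2 \<tau> \<in> cdom c" "cmap c (\<gamma>2 \<tau>) = y0 + \<tau> *\<^sub>R v" if "0 \<le> \<tau>" "\<tau> \<le> 1" for \<tau>
        using inball[OF that] subc cinv_in[OF c(1)] cmap_cinv[OF c(1)] by (auto simp: \<gamma>2_def)
      have g12: "\<gamma>1 1 = \<gamma>2 0" using \<gamma>1(3) cinv_cmap[OF c] by (simp add: \<gamma>2_def y0_def)
      have cont: "continuous_on {0..1} \<gamma>"
      proof -
        have "continuous_on {0..1/2} (\<lambda>t. \<gamma>1 (2 * t))"
          by (rule continuous_on_compose2[OF cont1]) (auto intro!: continuous_intros)
        moreover have "continuous_on {1/2..1} (\<lambda>t. \<gamma>2 (2 * t - 1))"
          unfolding \<gamma>2_def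
          by (rule continuous_on_compose2[OF continuous_cinv[OF c(1)]])
             (use inball subc in \<open>auto intro!: continuous_intros simp: subset_iff\<close>)
        ultimately have "continuous_on ({0..1/2} \<union> {1/2..1}) \<gamma>"
          unfolding \<gamma>_def by (rule continuous_on_If[rotated 2]) (use g12 in \<open>auto simp: mult.commute[of 2]\<close>)
        moreover have "{0..1/2} \<union> {1/2..1} = {0..1::real}" by auto
        ultimately show ?thesis by simp
      qed
      \<comment> \<open>The exceptional times of the first curve after rescaling, and the
        junction.\<close>
      define S where "S = insert (1/2) ((\<lambda>t. t / 2) ` S1)"
      have S: "finite S" using S1 by (simp add: S_def)
      have half: "2 * t \<notin> S1" if "t \<notin> S" for t
      proof
        assume "2 * t \<in> S1"
        then have "t \<in> (\<lambda>t. t / 2) ` S1" by (rule image_eqI[rotated]) simp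
        then show False using that by (simp add: S_def)
      qed
      have d1: "((cmap d \<circ> \<gamma>) has_vector_derivative 2 *\<^sub>R vector_derivative (cmap d \<circ> \<gamma>1) (at (2 * t))) (at t)"
        if d: "d \<in> atlas \<Omega>" and t: "t \<in> {0<..<1} - S" "t < 1/2" "\<gamma> t \<in> cdom d" for d t
      proof -
        have "2 * t \<in> {t \<in> {0<..<1} - S1. \<gamma>1 t \<in> cdom d}"
          using t half[of t] by (simp add: \<gamma>_def)
        then have "((cmap d \<circ> \<gamma>1) has_vector_derivative vector_derivative (cmap d \<circ> \<gamma>1) (at (2 * t))) (at (2 * t))"
          using S1(2)[OF d] unfolding C1_differentiable_on_eq by (auto simp: vector_derivative_works[symmetric])
        moreover have "((\<lambda>t. 2 * t) has_vector_derivative 2) (at t)"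
          by (auto intro!: derivative_eq_intros simp: has_vector_derivative_def)
        ultimately have "((cmap d \<circ> \<gamma>1) \<circ> (\<lambda>t. 2 * t) has_vector_derivative
            2 *\<^sub>R vector_derivative (cmap d \<circ> \<gamma>1) (at (2 * t))) (at t)"
          using vector_diff_chain_at by blast
        then show ?thesis
          by (rule has_vector_derivative_transform_within_open[where S="{..<1/2}"])
             (use t in \<open>auto simp: \<gamma>_def\<close>)
      qed
      have d2: "((cmap d \<circ> \<gamma>) has_vector_derivative
          2 *\<^sub>R frechet_derivative (cmap d \<circ> cinv c) (at (y0 + (2 * t - 1) *\<^sub>R v)) v) (at t)"
        if d: "d \<in> atlas \<Omega>" and t: "t \<in> {0<..<1} - S" "1/2 < t" "\<gamma> t \<in> cdom d" for d t
      proof -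
        let ?y = "y0 + (2 * t - 1) *\<^sub>R v"
        have x: "\<gamma> t = cinv c ?y" "cinv c ?y \<in> cdom c" "cmap c (cinv c ?y) = ?y"
          using t \<gamma>2c[of "2 * t - 1"] by (auto simp: \<gamma>_def \<gamma>2_def)
        have D: "((cmap d \<circ> cinv c) has_derivative frechet_derivative (cmap d \<circ> cinv c) (at ?y)) (at ?y)"
          using coord_change_has_derivative[OF c(1) d x(2)] t x by (simp add: coord_change_def)
        have "((\<lambda>t. y0 + (2 * t - 1) *\<^sub>R v) has_derivative (\<lambda>h. h *\<^sub>R (2 *\<^sub>R v))) (at t)"
          by (auto intro!: derivative_eq_intros)
        from has_derivative_compose[OF this D]
        have "((\<lambda>t. (cmap d \<circ> cinv c) (y0 + (2 * t - 1) *\<^sub>R v)) has_vector_derivative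
            2 *\<^sub>R frechet_derivative (cmap d \<circ> cinv c) (at ?y) v) (at t)"
          using has_derivative_linear[OF D] by (simp add: has_vector_derivative_def linear_scale mult.commute)
        then show ?thesis
          by (rule has_vector_derivative_transform_within_open[where S="{1/2<..}"])
             (use t in \<open>auto simp: \<gamma>_def \<gamma>2_def\<close>)
      qed
      have C1: "(cmap d \<circ> \<gamma>) C1_differentiable_on {t \<in> {0<..<1} - S. \<gamma> t \<in> cdom d}" if d: "d \<in> atlas \<Omega>" for d
      proof -
        let ?M = "{t \<in> {0<..<1} - S. \<gamma> t \<in> cdom d}"
        have M: "open ?M" by (rule open_curve_preimage[OF cont S open_cdom[OF d]])
        have "(cmap d \<circ> \<gamma>) C1_differentiable_on (?M \<inter> {..<1/2})"
          unfolding C1_differentiable_on_def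
        proof (intro exI conjI ballI)
          show "((cmap d \<circ> \<gamma>) has_vector_derivative 2 *\<^sub>R vector_derivative (cmap d \<circ> \<gamma>1) (at (2 * t))) (at t)"
            if "t \<in> ?M \<inter> {..<1/2}" for t using that by (intro d1 d) auto
          have "continuous_on {t \<in> {0<..<1} - S1. \<gamma>1 t \<in> cdom d} (\<lambda>t. vector_derivative (cmap d \<circ> \<gamma>1) (at t))"
            using S1(2)[OF d] unfolding C1_differentiable_on_eq by blast
          then have "continuous_on (?M \<inter> {..<1/2}) (\<lambda>t. vector_derivative (cmap d \<circ> \<gamma>1) (at (2 * t)))"
            by (rule continuous_on_compose2)
               (auto simp: half \<gamma>_def intro!: continuous_intros)
          then show "continuous_on (?M \<inter> {..<1/2}) (\<lambda>t. 2 *\<^sub>R vector_derivative (cmap d \<circ> \<gamma>1) (at (2 * t)))"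
            by (intro continuous_intros)
        qed
        moreover have "(cmap d \<circ> \<gamma>) C1_differentiable_on (?M \<inter> {1/2<..})"
          unfolding C1_differentiable_on_def
        proof (intro exI conjI ballI)
          show "((cmap d \<circ> \<gamma>) has_vector_derivative
              2 *\<^sub>R frechet_derivative (cmap d \<circ> cinv c) (at (y0 + (2 * t - 1) *\<^sub>R v)) v) (at t)"
            if "t \<in> ?M \<inter> {1/2<..}" for t using that by (intro d2 d) auto
          have "continuous_on (?M \<inter> {1/2<..}) (\<lambda>t. frechet_derivative (cmap d \<circ> cinv c) (at (y0 + (2 * t - 1) *\<^sub>R v)) v)"
          proof (rule C1_on_continuous_deriv_apply[OF smooth_on_C1_on[OF smooth_transition[OF c(1) d]]])
            show "(\<lambda>t. y0 + (2 * t - 1) *\<^sub>R v) ` (?M \<inter> {1/2<..}) \<subseteq> cmap c ` (cdom c \<inter> cdom d)"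
            proof
              fix q assume "q \<in> (\<lambda>t. y0 + (2 * t - 1) *\<^sub>R v) ` (?M \<inter> {1/2<..})"
              then obtain t where t: "t \<in> ?M \<inter> {1/2<..}" "q = y0 + (2 * t - 1) *\<^sub>R v" by blast
              then have "\<gamma> t = \<gamma>2 (2 * t - 1)" by (simp add: \<gamma>_def)
              then have "\<gamma> t \<in> cdom c" "cmap c (\<gamma> t) = q" "\<gamma> t \<in> cdom d"
                using t \<gamma>2c[of "2 * t - 1"] by auto
              then show "q \<in> cmap c ` (cdom c \<inter> cdom d)" by blast
            qed
          qed (intro continuous_intros)+
          then show "continuous_on (?M \<inter> {1/2<..})
              (\<lambda>t. 2 *\<^sub>R frechet_derivative (cmap d \<circ> cinv c) (at (y0 + (2 * t - 1) *\<^sub>R v)) v)"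
            by (intro continuous_intros)
        qed
        ultimately have "(cmap d \<circ> \<gamma>) C1_differentiable_on (?M \<inter> {..<1/2} \<union> ?M \<inter> {1/2<..})"
          using M by (intro C1_differentiable_on_open_Un open_Int) auto
        moreover have "?M \<inter> {..<1/2} \<union> ?M \<inter> {1/2<..} = ?M" by (auto simp: S_def)
        ultimately show ?thesis by metis
      qed
      define G where "G t = ennreal (indicator ({0<..<1} - S1) t *\<^sub>R speed \<gamma>1 t)" for t
      have Gm: "G \<in> borel_measurable borel"
        unfolding G_def
        by (intro measurable_compose[OF borel_measurable_continuous_on_indicator[OF _ continuous_on_speed[OF cont1 S1]] measurable_ennreal])
           (simp add: borel_closed finite_imp_closed S1(1) sets.Diff)
      \<comment> \<open>Both halves are run through at double speed: substituting
        \<open>2 * t\<close> turns the first term into the length of \<open>\<gamma>1\<close>, and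
        the second integrates over an interval of length \<open>1/2\<close> to
        \<open>C * norm v\<close>. The summand 0 gives the form of the affine substitution
        rule.\<close>
      have pt: "ennreal (indicator ({0<..<1} - S) t *\<^sub>R speed \<gamma> t)
          \<le> ennreal 2 * G (0 + 2 * t) + ennreal (2 * (C * norm v)) * indicator {1/2..1} t" for t
      proof -
        consider "t \<notin> {0<..<1} - S" | "t \<in> {0<..<1} - S" "t < 1/2" | "t \<in> {0<..<1} - S" "1/2 < t"
        proof -
          have "t \<noteq> 1/2" if "t \<in> {0<..<1} - S" using that by (auto simp: S_def)
          then show ?thesis using that by (metis linorder_neqE_linordered_idom)
        qed
        then show ?thesis
        proof cases
          case 2
          let ?d = "chart_at \<Omega> (\<gamma> t)"
          have "velocity \<Omega> \<gamma> t = 2 *\<^sub>R velocity \<Omega> \<gamma>1 (2 * t)"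
            using vector_derivative_at[OF d1[OF chart_at(1) 2 chart_at(2)]] 2(2)
            by (simp add: velocity_def \<gamma>_def)
          then have "speed \<gamma> t = 2 * speed \<gamma>1 (2 * t)" using 2(2) by (simp add: gnorm_scaleR \<gamma>_def)
          moreover have "2 * t \<in> {0<..<1} - S1" using 2 half[of t] by simp
          ultimately show ?thesis using 2 by (simp add: G_def ennreal_mult gnorm_nonneg)
        next
          case 3
          have tc: "\<gamma> t \<in> cdom c" "cmap c (\<gamma> t) = y0 + (2 * t - 1) *\<^sub>R v"
            using 3 \<gamma>2c[of "2 * t - 1"] by (auto simp: \<gamma>_def)
          have "frechet_derivative (cmap c \<circ> cinv c) (at (y0 + (2 * t - 1) *\<^sub>R v)) v = v"
            using coord_change_same[OF c(1) tc(1), of v] by (simp add: coord_change_def tc(2))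
          then have "((cmap c \<circ> \<gamma>) has_vector_derivative 2 *\<^sub>R v) (at t)"
            using d2[OF c(1) 3 tc(1)] by simp
          then have "speed \<gamma> t = sqrt (metric_in \<Omega> c (cmap c (\<gamma> t)) (2 *\<^sub>R v) (2 *\<^sub>R v))"
            using 3 by (intro speed_eq c isCont_curve cont tc) auto
          also have "cmap c (\<gamma> t) \<in> cball y0 \<rho>" using inball[of "2 * t - 1"] 3 sub tc(2) by auto
          then have "sqrt (metric_in \<Omega> c (cmap c (\<gamma> t)) (2 *\<^sub>R v) (2 *\<^sub>R v)) \<le> C * norm (2 *\<^sub>R v)"
            using \<rho>(4) by blast
          finally have "speed \<gamma> t \<le> 2 * (C * norm v)" by simp
          then have "ennreal (indicator ({0<..<1} - S) t *\<^sub>R speed \<gamma> t)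
              \<le> ennreal (2 * (C * norm v)) * indicator {1/2..1} t"
            using 3 by (auto intro!: ennreal_leI)
          then show ?thesis by (rule order_trans) simp
        qed simp
      qed
      have "curve_length \<Omega> \<gamma> \<le> (\<integral>\<^sup>+t. ennreal 2 * G (0 + 2 * t) + ennreal (2 * (C * norm v)) * indicator {1/2..1} t \<partial>lborel)"
        unfolding curve_length_eq[OF S] by (intro nn_integral_mono pt)
      also have "\<dots> = (\<integral>\<^sup>+t. ennreal 2 * G (0 + 2 * t) \<partial>lborel) + (\<integral>\<^sup>+t. ennreal (2 * (C * norm v)) * indicator {1/2..1::real} t \<partial>lborel)"
        using Gm by (intro nn_integral_add) auto
      also have "(\<integral>\<^sup>+t. ennreal 2 * G (0 + 2 * t) \<partial>lborel) = (\<integral>\<^sup>+t. G t \<partial>lborel)"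
        using nn_integral_real_affine[OF Gm, of 2 0] Gm by (simp add: nn_integral_cmult)
      also have "\<dots> = ennreal l" unfolding G_def curve_length_eq[OF S1(1), symmetric] by (rule l(1))
      also have "(\<integral>\<^sup>+t. ennreal (2 * (C * norm v)) * indicator {1/2..1::real} t \<partial>lborel) = ennreal (2 * (C * norm v)) * ennreal (1 / 2)"
        by (subst nn_integral_cmult_indicator) auto
      also have "\<dots> = ennreal (C * norm v)"
        using \<rho>(2) by (subst ennreal_mult[symmetric]) auto
      also have "ennreal l + ennreal (C * norm v) = ennreal (l + C * norm v)"
        using l(2) \<rho>(2) by simp
      also have "\<dots> < ennreal r"
      proof (rule ennreal_lessI)
        show "0 < r" using l(2) lr by simp
        have "norm v < (r - l) / C" using nv by (simp add: s_def)
        then show "l + C * norm v < r" using \<rho>(2) by (simp add: field_simps)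
      qed
      finally have "curve_length \<Omega> \<gamma> < ennreal r" .
      moreover have "piecewise_C1_curve \<Omega> \<gamma>"
        unfolding piecewise_C1_curve_def using cont S C1 by blast
      moreover have "\<gamma> 0 = x" "\<gamma> 1 = z" using \<gamma>1(2) z0 by (auto simp: \<gamma>_def \<gamma>2_def v_def)
      ultimately show "z \<in> gball \<Omega> x r"
        unfolding gball_def riemannian_dist_def by (auto simp: INF_less_iff)
    qed
  qed
qed

end

section \<open>Test fields and varifolds in a chart\<close>

context metric_domain
begin

lemma borel_measurable_compose_V:
  fixes q :: "'e \<Rightarrow> real"
  assumes q: "continuous_on V q" and y: "y \<in> borel_measurable M" "\<And>z. z \<in> space M \<Longrightarrow> y z \<in> V"
  shows "(\<lambda>z. q (y z)) \<in> borel_measurable M"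
proof -
  have "(\<lambda>x. indicator V x *\<^sub>R q x) \<in> borel_measurable borel"
    by (rule borel_measurable_continuous_on_indicator[OF borel_open[OF open_V] q])
  from measurable_compose[OF y(1) this]
  have "(\<lambda>z. indicator V (y z) *\<^sub>R q (y z)) \<in> borel_measurable M" .
  then show ?thesis by (rule measurable_cong[THEN iffD1, rotated]) (simp add: y(2))
qed

lemma borel_measurable_bilinear:
  fixes B :: "'e \<Rightarrow> 'e \<Rightarrow> 'e \<Rightarrow> real" and a b :: "'b \<Rightarrow> 'e"
  assumes B: "\<And>y v. y \<in> V \<Longrightarrow> linear (B y v)" "\<And>y v. y \<in> V \<Longrightarrow> linear (\<lambda>x. B y x v)"
    and cont: "\<And>i j. continuous_on V (\<lambda>y. B y i j)"
    and y: "y \<in> borel_measurable M" "\<And>z. z \<in> space M \<Longrightarrow> y z \<in> V"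
    and ab: "a \<in> borel_measurable M" "b \<in> borel_measurable M"
  shows "(\<lambda>z. B (y z) (a z) (b z)) \<in> borel_measurable M"
proof -
  have "(\<lambda>z. \<Sum>i\<in>Basis. \<Sum>j\<in>Basis. (a z \<bullet> i) * (b z \<bullet> j) * B (y z) i j) \<in> borel_measurable M"
    by (intro borel_measurable_sum borel_measurable_times borel_measurable_inner ab
        borel_measurable_const borel_measurable_compose_V[OF cont y])
  moreover have "(\<Sum>i\<in>Basis. \<Sum>j\<in>Basis. (a z \<bullet> i) * (b z \<bullet> j) * B (y z) i j) = B (y z) (a z) (b z)"
    if z: "z \<in> space M" for z
  proof -
    have "B (y z) i (b z) = (\<Sum>j\<in>Basis. (b z \<bullet> j) * B (y z) i j)" for i
      using linear_basis_expansion[OF B(1)[OF y(2)[OF z]], of i "b z"] by simp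
    moreover have "B (y z) (a z) (b z) = (\<Sum>i\<in>Basis. (a z \<bullet> i) * B (y z) i (b z))"
      using linear_basis_expansion[OF B(2)[OF y(2)[OF z]], of "a z" "b z"] by simp
    ultimately show ?thesis by (simp add: sum_distrib_left mult.assoc)
  qed
  ultimately show ?thesis by (simp cong: measurable_cong)
qed

lemma borel_measurable_g:
  assumes "y \<in> borel_measurable M" "\<And>z. z \<in> space M \<Longrightarrow> y z \<in> V"
    and "a \<in> borel_measurable M" "b \<in> borel_measurable M"
  shows "(\<lambda>z. g (y z) (a z) (b z)) \<in> borel_measurable M"
  by (rule borel_measurable_bilinear[where B=g, OF ip_form.linear_right[OF ip_form_g]
        ip_form.linear_left[OF ip_form_g] C1_on_continuous_on[OF C1_g] assms])

lemma borel_measurable_lie_form: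
  assumes \<xi>: "Ck_on 1 \<xi> V" and y: "y \<in> borel_measurable M" "\<And>z. z \<in> space M \<Longrightarrow> y z \<in> V"
    and ab: "a \<in> borel_measurable M" "b \<in> borel_measurable M"
  shows "(\<lambda>z. lie_form \<xi> (y z) (a z) (b z)) \<in> borel_measurable M"
proof (rule borel_measurable_bilinear[where B="lie_form \<xi>", OF _ _ _ y ab])
  show "linear (lie_form \<xi> y v)" "linear (\<lambda>x. lie_form \<xi> y x v)" if "y \<in> V" for y v
    using \<xi> that by (intro lie_form_linear; simp add: C1_on_iff)+
  show "continuous_on V (\<lambda>y. lie_form \<xi> y i j)" for i j
    unfolding lie_form_def
    by (intro continuous_on_add continuous_on_divide continuous_on_const
        continuous_on_Dg[where u="\<lambda>y. y"] continuous_on_g[where u="\<lambda>y. y"] continuous_on_id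
        C1_on_continuous_on[OF \<xi>] C1_on_continuous_deriv[OF \<xi>]) auto
qed

lemma borel_measurable_gram_schmidt:
  assumes y: "y \<in> borel_measurable M" "\<And>z. z \<in> space M \<Longrightarrow> y z \<in> V"
    and v: "\<And>k. (\<lambda>z. v z k) \<in> borel_measurable M"
  shows "(\<lambda>z. gram_schmidt (g (y z)) (v z) k) \<in> borel_measurable M"
proof (induction k rule: less_induct)
  case (less k)
  define w where "w z = v z k - (\<Sum>j<k. g (y z) (v z k) (gram_schmidt (g (y z)) (v z) j) *\<^sub>R
      gram_schmidt (g (y z)) (v z) j)" for z
  have coeff: "(\<lambda>z. g (y z) (v z k) (gram_schmidt (g (y z)) (v z) j)) \<in> borel_measurable M" if "j < k" for j
    by (rule borel_measurable_g[OF y v less[OF that]])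
  have w: "w \<in> borel_measurable M"
    unfolding w_def
    by (rule borel_measurable_diff[OF v borel_measurable_sum], rule borel_measurable_scaleR)
      (auto intro: coeff less)
  have "(\<lambda>z. (1 / sqrt (g (y z) (w z) (w z))) *\<^sub>R w z) \<in> borel_measurable M"
    by (rule borel_measurable_scaleR[OF borel_measurable_divide[OF borel_measurable_const
            measurable_compose[OF borel_measurable_g[OF y w w] borel_measurable_sqrt]] w])
  moreover have "gram_schmidt (g (y z)) (v z) k = (1 / sqrt (g (y z) (w z) (w z))) *\<^sub>R w z" for z
    by (subst gram_schmidt.simps) (simp add: w_def Let_def)
  ultimately show ?case by simp
qed

end

section \<open>Vector fields supported in a chart\<close>

context riemannian
begin

text \<open>Transplants a coordinate field to the manifold; \<open>of_chart\<close> converts to the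
  preferred coordinates of each point. The extension by 0 is regular when \<open>\<xi>\<close> is
  regular and vanishes off a compact subset of the chart image.\<close>

definition chart_field :: "('a, 'e) chart \<Rightarrow> ('e \<Rightarrow> 'e) \<Rightarrow> 'a \<Rightarrow> 'e" where
  "chart_field c \<xi> x = (if x \<in> cdom c then of_chart \<Omega> c x (\<xi> (cmap c x)) else 0)"

lemma to_chart_chart_field:
  "c \<in> atlas \<Omega> \<Longrightarrow> x \<in> cdom c \<Longrightarrow> to_chart \<Omega> c x (chart_field c \<xi> x) = \<xi> (cmap c x)"
  by (simp add: chart_field_def to_of_chart)

lemma chart_field_zero:
  assumes c: "c \<in> atlas \<Omega>" and 0: "\<And>y. y \<in> cimg c - K \<Longrightarrow> \<xi> y = 0" and x: "x \<notin> cinv c ` K"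
  shows "chart_field c \<xi> x = 0"
proof (cases "x \<in> cdom c")
  case True
  then have "cmap c x \<notin> K" using x cinv_cmap[OF c True] by (metis image_eqI)
  then show ?thesis using True 0 linear_0[OF of_chart_linear[OF c True]] by (simp add: chart_field_def)
qed (simp add: chart_field_def)

lemma compact_cinv_image:
  "c \<in> atlas \<Omega> \<Longrightarrow> compact K \<Longrightarrow> K \<subseteq> cimg c \<Longrightarrow> compact (cinv c ` K)"
  by (rule compact_continuous_image[OF continuous_on_subset[OF continuous_cinv]])

text \<open>At points of the chart domain the transformation law for \<open>\<xi>\<close> applies;
  at other points the field vanishes on the complement of the image of \<open>K\<close>, which is
  open because compact subsets of a Hausdorff space are closed.\<close>

lemma C1_field_chart_field:
  assumes c: "c \<in> atlas \<Omega>" and \<xi>: "Ck_on 1 \<xi> (cimg c)" and K: "compact K" "K \<subseteq> cimg c"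
    and 0: "\<And>y. y \<in> cimg c - K \<Longrightarrow> \<xi> y = 0"
  shows "C1_field \<Omega> (chart_field c \<xi>)"
  unfolding C1_field_def
proof (intro ballI C1_on_local)
  fix d y assume d: "d \<in> atlas \<Omega>" and y: "y \<in> cimg d"
  define x where "x = cinv d y"
  have x: "x \<in> cdom d" "cmap d x = y" using cinv_in[OF d y] cmap_cinv[OF d y] by (auto simp: x_def)
  show "\<exists>U. open U \<and> y \<in> U \<and> Ck_on 1 (field_in \<Omega> d (chart_field c \<xi>)) U"
  proof (cases "x \<in> cdom c")
    case True
    define U where "U = cmap d ` (cdom d \<inter> cdom c)"
    have U: "open U" "y \<in> U" unfolding U_def using open_cmap_image[OF d open_cdom[OF c]] x True by auto
    have tr: "Ck_on 1 (cmap c \<circ> cinv d) U" unfolding U_def by (rule smooth_on_C1_on[OF smooth_transition[OF d c]])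
    have im: "(cmap c \<circ> cinv d) ` U \<subseteq> cmap c ` (cdom c \<inter> cdom d)"
      unfolding U_def using cinv_cmap[OF d] by auto
    then have im': "(cmap c \<circ> cinv d) ` U \<subseteq> cimg c" by blast
    have "Ck_on 1 (\<lambda>z. frechet_derivative (cmap d \<circ> cinv c) (at ((cmap c \<circ> cinv d) z)) (\<xi> ((cmap c \<circ> cinv d) z))) U"
      by (rule C1_on_deriv_apply[OF smooth_on_C2_on[OF smooth_transition[OF c d]] tr im C1_on_compose[OF \<xi> tr im'] U(1)])
    then have "Ck_on 1 (field_in \<Omega> d (chart_field c \<xi>)) U"
    proof (rule C1_on_cong[OF _ U(1)])
      fix z assume "z \<in> U"
      then obtain x where x: "x \<in> cdom d" "x \<in> cdom c" "z = cmap d x" by (auto simp: U_def)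
      have "to_chart \<Omega> d x (chart_field c \<xi> x) = coord_change c d x (\<xi> (cmap c x))"
        using coord_change_to_chart[OF c d x(2,1), of "chart_field c \<xi> x"] to_chart_chart_field[OF c x(2)] by simp
      then show "frechet_derivative (cmap d \<circ> cinv c) (at ((cmap c \<circ> cinv d) z)) (\<xi> ((cmap c \<circ> cinv d) z))
          = field_in \<Omega> d (chart_field c \<xi>) z"
        using x cinv_cmap[OF d] by (simp add: field_in_def coord_change_def)
    qed
    then show ?thesis using U by blast
  next
    case False
    define L where "L = cinv c ` K"
    have L: "closed L" unfolding L_def by (rule compact_imp_closed[OF compact_cinv_image[OF c K]])
    have xL: "x \<notin> L" using False cinv_in[OF c] K(2) by (auto simp: L_def)
    define U where "U = cmap d ` (cdom d \<inter> - L)"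
    have U: "open U" "y \<in> U" unfolding U_def
      using open_cmap_image[OF d open_Compl[OF L]] x xL by (auto simp del: image_Int)
    have "Ck_on 1 (field_in \<Omega> d (chart_field c \<xi>)) U"
    proof (rule C1_on_cong[OF C1_on_const U(1)])
      fix z assume "z \<in> U"
      then obtain x where x: "x \<in> cdom d" "x \<notin> L" "z = cmap d x" by (auto simp: U_def)
      have "chart_field c \<xi> x = 0" by (rule chart_field_zero[OF c 0]) (use x in \<open>auto simp: L_def\<close>)
      then show "0 = field_in \<Omega> d (chart_field c \<xi>) z"
        using x linear_0[OF to_chart_linear[OF d x(1)]] cinv_cmap[OF d]
        by (simp add: field_in_def L_def)
    qed
    then show ?thesis using U by blast
  qed
qed

lemma test_field_chart_field:
  assumes c: "c \<in> atlas \<Omega>" and \<xi>: "Ck_on 1 \<xi> (cimg c)" and K: "compact K" "K \<subseteq> cimg c"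
    and 0: "\<And>y. y \<in> cimg c - K \<Longrightarrow> \<xi> y = 0" and U: "cinv c ` K \<subseteq> U"
  shows "test_field \<Omega> U (chart_field c \<xi>)"
proof -
  let ?L = "cinv c ` K"
  have L: "compact ?L" by (rule compact_cinv_image[OF c K])
  have "x \<in> ?L" if "chart_field c \<xi> x \<noteq> 0" for x
    by (rule ccontr) (use chart_field_zero[OF c 0, where x=x] that in auto)
  then have "{x. chart_field c \<xi> x \<noteq> 0} \<subseteq> ?L" by blast
  then have sub: "closure {x. chart_field c \<xi> x \<noteq> 0} \<subseteq> ?L"
    using compact_imp_closed[OF L] by (rule closure_minimal)
  then have "compact (closure {x. chart_field c \<xi> x \<noteq> 0})"
    using compact_Int_closed[OF L closed_closure[of "{x. chart_field c \<xi> x \<noteq> 0}"]] by (simp add: Int_absorb1)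
  then show ?thesis
    unfolding test_field_def using C1_field_chart_field[OF c \<xi> K 0] sub U by blast
qed

lemma gnorm_chart_field:
  assumes "c \<in> atlas \<Omega>"
  shows "gnorm \<Omega> x (chart_field c \<xi> x) = (if x \<in> cdom c
    then sqrt (metric_in \<Omega> c (cmap c x) (\<xi> (cmap c x)) (\<xi> (cmap c x))) else 0)"
proof (cases "x \<in> cdom c")
  case True
  then show ?thesis using gnorm_to_chart[OF assms True] to_chart_chart_field[OF assms True] by simp
qed (simp add: chart_field_def gnorm_zero)

lemma div_plane_chart_field:
  assumes c: "c \<in> atlas \<Omega>" and X: "C1_field \<Omega> (chart_field c \<xi>)" and \<xi>: "Ck_on 1 \<xi> (cimg c)" and x: "x \<in> cdom c" and S: "subspace S"
    and E: "ip_form.orthonormal (metric_in \<Omega> c (cmap c x)) E" "span E = to_chart \<Omega> c x ` S"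
  shows "div_plane \<Omega> (chart_field c \<xi>) x S
    = (\<Sum>e\<in>E. metric_domain.lie_form (metric_in \<Omega> c) \<xi> (cmap c x) e e)"
proof -
  interpret m: metric_domain "cimg c" "metric_in \<Omega> c" by (rule metric_domain_chart[OF c])
  have y: "cmap c x \<in> cimg c" using x by blast
  have eq: "\<xi> z = field_in \<Omega> c (chart_field c \<xi>) z" if "z \<in> cimg c" for z
    using that to_chart_chart_field[OF c cinv_in[OF c that]] cmap_cinv[OF c that] by (simp add: field_in_def)
  have "\<xi> differentiable at (cmap c x)" using \<xi> y unfolding C1_on_iff by blast
  from m.lie_form_cong[OF open_cimg[OF c] y eq this]
  show ?thesis using div_plane_eq[OF X c x S E] by simp
qed

lemma div_plane_zero:
  assumes X: "C1_field \<Omega> X" and U: "open U" "x \<in> U" "\<And>x. x \<in> U \<Longrightarrow> X x = 0" and S: "subspace S"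
  shows "div_plane \<Omega> X x S = 0"
proof -
  define c where "c = chart_at \<Omega> x"
  have c: "c \<in> atlas \<Omega>" "x \<in> cdom c" unfolding c_def by (rule chart_at)+
  interpret m: metric_domain "cimg c" "metric_in \<Omega> c" by (rule metric_domain_chart[OF c(1)])
  have y: "cmap c x \<in> cimg c" using c by blast
  interpret ip_form "metric_in \<Omega> c (cmap c x)" by (rule ip_form_metric_in[OF c(1) y])
  have "subspace (to_chart \<Omega> c x ` S)" using linear_subspace_image[OF to_chart_linear[OF c] S] .
  then obtain E where E: "orthonormal E" "span E = to_chart \<Omega> c x ` S" using exists_orthonormal_basis by blast
  define T where "T = cmap c ` (cdom c \<inter> U)"
  have T: "open T" "cmap c x \<in> T" unfolding T_def using open_cmap_image[OF c(1) U(1)] c U by auto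
  have 0: "field_in \<Omega> c X z = 0" if "z \<in> T" for z
  proof -
    obtain x where "x \<in> cdom c" "x \<in> U" "z = cmap c x" using \<open>z \<in> T\<close> by (auto simp: T_def)
    then show ?thesis using cinv_cmap[OF c(1)] U(3) linear_0[OF to_chart_linear[OF c(1)]] by (simp add: field_in_def)
  qed
  have "((\<lambda>z. 0) has_derivative (\<lambda>v. 0)) (at (cmap c x))" by simp
  then have "(field_in \<Omega> c X has_derivative (\<lambda>v. 0)) (at (cmap c x))"
    by (rule has_derivative_transform_within_open[OF _ T]) (simp add: 0)
  from frechet_derivative_at[OF this, symmetric]
  have "lie c X (cmap c x) e e = 0" for e
    using linear_0[OF m.Dg_linear[OF y]] by (simp add: m.lie_form_def 0[OF T(2)] G_simps)
  then show ?thesis using div_plane_eq[OF X c S E] by simp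
qed

section \<open>Measurability on the Grassmann bundle\<close>

context
  fixes m :: nat and V :: "('a \<times> 'e set) measure"
  assumes V: "varifold \<Omega> m V"
begin

text \<open>The subbasic sets with \<open>W = UNIV\<close> over the preferred charts already exhaust
  all pairs of a point and an \<open>m\<close>-plane.\<close>

lemma space_varifold: "space V = {z. subspace (snd z) \<and> dim (snd z) = m}"
proof -
  have "space V = topspace (grassmann_bundle \<Omega> m)"
    using V sets_eq_imp_space_eq[of V "grassmann_borel \<Omega> m"]
    unfolding varifold_def grassmann_borel_def by (simp add: space_measure_of_conv)
  also have "\<dots> = {z. subspace (snd z) \<and> dim (snd z) = m}"
  proof (intro set_eqI iffI)
    fix z :: "'a \<times> 'e set" assume z: "z \<in> {z. subspace (snd z) \<and> dim (snd z) = m}"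
    obtain x S where xS: "z = (x, S)" by (cases z)
    let ?c = "chart_at \<Omega> x"
    have "{(x, S). x \<in> cdom ?c \<and> subspace S \<and> dim S = m \<and> closest_point (to_chart \<Omega> ?c x ` S) 0 \<in> UNIV}
      \<in> {{(x, S). x \<in> U \<and> subspace S \<and> dim S = m \<and> closest_point (to_chart \<Omega> c x ` S) v \<in> W}
       | c U v W. c \<in> atlas \<Omega> \<and> open U \<and> U \<subseteq> cdom c \<and> open W}"
      using chart_at(1)[of x] open_cdom[OF chart_at(1)[of x]] open_UNIV by blast
    moreover have "z \<in> {(x, S). x \<in> cdom ?c \<and> subspace S \<and> dim S = m \<and> closest_point (to_chart \<Omega> ?c x ` S) 0 \<in> UNIV}"
      using z chart_at(2)[of x] by (simp add: xS)
    ultimately show "z \<in> topspace (grassmann_bundle \<Omega> m)"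
      unfolding grassmann_bundle_def topology_generated_by_topspace by (rule UnionI)
  qed (auto simp: grassmann_bundle_def)
  finally show ?thesis .
qed

lemma sets_varifold_openin: "openin (grassmann_bundle \<Omega> m) A \<Longrightarrow> A \<in> sets V"
proof -
  assume A: "openin (grassmann_bundle \<Omega> m) A"
  have "{A. openin (grassmann_bundle \<Omega> m) A} \<subseteq> Pow (topspace (grassmann_bundle \<Omega> m))"
    using openin_subset by blast
  then have "A \<in> sets (grassmann_borel \<Omega> m)"
    unfolding grassmann_borel_def using A by (simp add: sets_measure_of sigma_sets.Basic)
  then show ?thesis using V unfolding varifold_def by simp
qed

lemma sets_varifold_basic:
  assumes "c \<in> atlas \<Omega>" "open U" "U \<subseteq> cdom c" "open W"
  shows "{z \<in> space V. fst z \<in> U \<and> closest_point (to_chart \<Omega> c (fst z) ` snd z) v \<in> W} \<in> sets V"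
proof -
  have "openin (grassmann_bundle \<Omega> m)
      {(x, S). x \<in> U \<and> subspace S \<and> dim S = m \<and> closest_point (to_chart \<Omega> c x ` S) v \<in> W}"
    unfolding grassmann_bundle_def by (rule topology_generated_by_Basis) (use assms in blast)
  from sets_varifold_openin[OF this] show ?thesis
    by (rule back_subst[of "\<lambda>A. A \<in> sets V"]) (auto simp: space_varifold)
qed

text \<open>Preimages are unions over the whole atlas, possibly uncountable; the union is therefore
  taken among open sets of the bundle before passing to measurable ones.\<close>

lemma measurable_fst_varifold: "fst \<in> V \<rightarrow>\<^sub>M borel"
proof (rule borel_measurableI)
  fix U :: "'a set" assume U: "open U"
  let ?F = "{{(x, S). x \<in> U \<inter> cdom c \<and> subspace S \<and> dim S = m \<and> closest_point (to_chart \<Omega> c x ` S) 0 \<in> UNIV} | c. c \<in> atlas \<Omega>}"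
  have "openin (grassmann_bundle \<Omega> m) (\<Union>?F)"
  proof (rule openin_Union)
    fix A assume "A \<in> ?F"
    then obtain c where c: "c \<in> atlas \<Omega>" and A: "A = {(x, S). x \<in> U \<inter> cdom c \<and> subspace S \<and> dim S = m
        \<and> closest_point (to_chart \<Omega> c x ` S) 0 \<in> UNIV}" by blast
    show "openin (grassmann_bundle \<Omega> m) A"
      unfolding grassmann_bundle_def A
      by (rule topology_generated_by_Basis) (use c open_Int[OF U open_cdom[OF c]] open_UNIV in blast)
  qed
  moreover have "\<Union>?F = fst -` U \<inter> space V"
    using chart_at by (auto simp: space_varifold) blast
  ultimately show "fst -` U \<inter> space V \<in> sets V" using sets_varifold_openin by metis
qed

lemma sets_weight: "sets (weight V) = sets borel" and space_weight: "space (weight V) = UNIV"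
  by (simp_all add: weight_def)

lemma emeasure_weight: "A \<in> sets borel \<Longrightarrow> emeasure (weight V) A = emeasure V {z \<in> space V. fst z \<in> A}"
  unfolding weight_def using emeasure_distr[OF measurable_fst_varifold]
  by (simp add: vimage_def Int_def conj_commute)

lemma weight_compact_finite: "compact K \<Longrightarrow> emeasure (weight V) K < \<infinity>"
proof -
  assume K: "compact K"
  have "{z \<in> space V. fst z \<in> K} = {(x, S). (x, S) \<in> space V \<and> x \<in> K}" by auto
  then show ?thesis
    using V K emeasure_weight[OF borel_closed[OF compact_imp_closed[OF K]]] unfolding varifold_def by simp
qed

text \<open>The basis chosen by \<open>SOME\<close> need not depend measurably on the plane. Basis
  independence permits replacing it by Gram-Schmidt applied to the projections of the standard basis
  onto the plane, which span it and are measurable by the construction of the bundle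
  topology.\<close>

lemma div_plane_measurable:
  assumes c: "c \<in> atlas \<Omega>" and \<xi>: "Ck_on 1 \<xi> (cimg c)" and K: "compact K" "K \<subseteq> cimg c"
    and 0: "\<And>y. y \<in> cimg c - K \<Longrightarrow> \<xi> y = 0"
  shows "(\<lambda>z. div_plane \<Omega> (chart_field c \<xi>) (fst z) (snd z)) \<in> borel_measurable V"
proof -
  let ?X = "chart_field c \<xi>"
  interpret mc: metric_domain "cimg c" "metric_in \<Omega> c" by (rule metric_domain_chart[OF c])
  have X: "C1_field \<Omega> ?X" by (rule C1_field_chart_field[OF c \<xi> K 0])
  define D :: "('a \<times> 'e set) set" where "D = {z. fst z \<in> cdom c}"
  define R where "R = restrict_space V D"
  have D: "D \<inter> space V \<in> sets V"
    using measurable_sets[OF measurable_fst_varifold borel_open[OF open_cdom[OF c]]]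
    by (simp add: D_def vimage_def)
  define y where "y z = cmap c (fst z)" for z :: "'a \<times> 'e set"
  define P where "P z k = closest_point (to_chart \<Omega> c (fst z) ` snd z) (basis_vector k)" for z :: "'a \<times> 'e set" and k
  have spR: "space R = {z \<in> space V. fst z \<in> cdom c}" by (auto simp: R_def space_restrict_space D_def)
  have yV: "y z \<in> cimg c" if "z \<in> space R" for z using that by (simp add: spR y_def)
  have "fst \<in> R \<rightarrow>\<^sub>M restrict_space borel (cdom c)"
    unfolding R_def by (rule measurable_restrict_space3[OF measurable_fst_varifold]) (auto simp: D_def)
  from measurable_compose[OF this borel_measurable_continuous_on_restrict[OF continuous_cmap[OF c]]]
  have ym: "y \<in> borel_measurable R" by (simp add: y_def[abs_def])
  have Pm: "(\<lambda>z. P z k) \<in> borel_measurable R" for k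
  proof (rule borel_measurableI)
    fix W :: "'e set" assume W: "open W"
    have "{z \<in> space V. fst z \<in> cdom c \<and> closest_point (to_chart \<Omega> c (fst z) ` snd z) (basis_vector k) \<in> W} \<in> sets V"
      by (rule sets_varifold_basic[OF c open_cdom[OF c] order_refl W])
    moreover have "(\<lambda>z. P z k) -` W \<inter> space R = {z \<in> space V. fst z \<in> cdom c \<and>
        closest_point (to_chart \<Omega> c (fst z) ` snd z) (basis_vector k) \<in> W}"
      by (auto simp: P_def spR)
    ultimately show "(\<lambda>z. P z k) -` W \<inter> space R \<in> sets R"
      unfolding R_def by (subst sets_restrict_space_iff[OF D]) (auto simp: space_restrict_space D_def)
  qed
  define u where "u z k = gram_schmidt (metric_in \<Omega> c (y z)) (P z) k" for z k
  have um: "(\<lambda>z. u z k) \<in> borel_measurable R" for k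
    unfolding u_def by (rule mc.borel_measurable_gram_schmidt[OF ym yV Pm])
  have "(\<lambda>z. \<Sum>k<DIM('e). mc.lie_form \<xi> (y z) (u z k) (u z k)) \<in> borel_measurable R"
    by (intro borel_measurable_sum mc.borel_measurable_lie_form \<xi> ym yV um)
  moreover have "(\<Sum>k<DIM('e). mc.lie_form \<xi> (y z) (u z k) (u z k)) = div_plane \<Omega> ?X (fst z) (snd z)"
    if z: "z \<in> space R" for z
  proof -
    have x: "fst z \<in> cdom c" and S: "subspace (snd z)" using z by (auto simp: spR space_varifold)
    let ?T = "to_chart \<Omega> c (fst z) ` snd z"
    interpret ip_form "metric_in \<Omega> c (y z)" by (rule mc.ip_form_g[OF yV[OF z]])
    have T: "subspace ?T" using linear_subspace_image[OF to_chart_linear[OF c x] S] .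
    have "P z ` {..<DIM('e)} = closest_point ?T ` (basis_vector ` {..<DIM('e)})"
      by (auto simp: P_def)
    then have "P z ` {..<DIM('e)} = closest_point ?T ` Basis"
      by (simp only: basis_vector_image)
    then have sp: "span (gs (P z) ` {..<DIM('e)} - {0}) = ?T"
      using span_closest_point_Basis[OF T] by (simp add: gs_span)
    have diff: "\<xi> differentiable at (y z)" using \<xi> yV[OF z] unfolding C1_on_iff by blast
    have "(\<Sum>k<DIM('e). mc.lie_form \<xi> (y z) (u z k) (u z k))
        = (\<Sum>e\<in>gs (P z) ` {..<DIM('e)} - {0}. mc.lie_form \<xi> (y z) e e)"
      unfolding u_def by (rule sum_gs) (simp_all add: linear_0[OF mc.lie_form_linear(1)[OF yV[OF z] diff]])
    also have "\<dots> = div_plane \<Omega> ?X (fst z) (snd z)"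
      unfolding y_def
      by (rule div_plane_chart_field[OF c X \<xi> x S gs_orthonormal[unfolded y_def] sp[unfolded y_def], symmetric])
    finally show ?thesis .
  qed
  ultimately have "(\<lambda>z. div_plane \<Omega> ?X (fst z) (snd z)) \<in> borel_measurable R"
    by (simp cong: measurable_cong)
  then have "(\<lambda>z. indicator D z *\<^sub>R div_plane \<Omega> ?X (fst z) (snd z)) \<in> borel_measurable V"
    unfolding R_def by (simp only: borel_measurable_restrict_space_iff[OF D])
  moreover have "indicator D z *\<^sub>R div_plane \<Omega> ?X (fst z) (snd z) = div_plane \<Omega> ?X (fst z) (snd z)"
    if z: "z \<in> space V" for z
  proof (cases "z \<in> D")
    case False
    have L: "closed (cinv c ` K)" by (rule compact_imp_closed[OF compact_cinv_image[OF c K]])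
    have "fst z \<notin> cinv c ` K" using False K(2) cinv_in[OF c] by (auto simp: D_def)
    then have "div_plane \<Omega> ?X (fst z) (snd z) = 0"
      using L z chart_field_zero[OF c 0]
      by (intro div_plane_zero[OF X, of "- cinv c ` K"]) (auto simp: space_varifold)
    then show ?thesis by simp
  qed simp
  ultimately show ?thesis by (rule measurable_cong[THEN iffD1, rotated])
qed

end

end

section \<open>The singular part of the first variation\<close>

text \<open>Open neighbourhoods \<open>U1\<close> and \<open>U2\<close> of \<open>X\<close>
  approximate \<open>A\<close> and \<open>B\<close> separately; the hypothesis is applied to their
  intersection and the two infima are taken one after the other. Finiteness permits the subtractions
  in between.\<close>

lemma emeasure_le_of_open:
  fixes T A B :: "'b::{second_countable_topology, complete_space} measure"
  assumes T: "sets T = sets borel"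
    and A: "sets A = sets borel" "emeasure A (space A) \<noteq> \<infinity>"
    and B: "sets B = sets borel" "emeasure B (space B) \<noteq> \<infinity>"
    and le: "\<And>U. open U \<Longrightarrow> emeasure T U \<le> emeasure A U + emeasure B U"
    and X: "X \<in> sets borel"
  shows "emeasure T X \<le> emeasure A X + emeasure B X"
proof -
  have finB: "emeasure B U \<noteq> \<infinity>" for U
    using emeasure_space[of B U] B(2) by (auto simp: top_unique)
  have finA: "emeasure A U \<noteq> \<infinity>" for U
    using emeasure_space[of A U] A(2) by (auto simp: top_unique)
  have 1: "emeasure T X \<le> emeasure B U2 + emeasure A U1"
    if "open U1" "X \<subseteq> U1" "open U2" "X \<subseteq> U2" for U1 U2
  proof -
    have "emeasure T X \<le> emeasure T (U1 \<inter> U2)"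
      using that T by (intro emeasure_mono) auto
    also have "\<dots> \<le> emeasure A (U1 \<inter> U2) + emeasure B (U1 \<inter> U2)" using that by (intro le open_Int)
    also have "\<dots> \<le> emeasure A U1 + emeasure B U2"
      using that A B by (intro add_mono emeasure_mono) auto
    finally show ?thesis by (simp add: add.commute)
  qed
  have 2: "emeasure T X \<le> emeasure A X + emeasure B U2" if U2: "open U2" "X \<subseteq> U2" for U2
  proof -
    have "emeasure T X - emeasure B U2 \<le> emeasure A U1" if "open U1" "X \<subseteq> U1" for U1
      using 1[OF that U2] finB[of U2] by (simp add: ennreal_minus_le_iff)
    then have "emeasure T X - emeasure B U2 \<le> emeasure A X"
      unfolding outer_regular[OF A X] by (intro INF_greatest) auto
    then show ?thesis using finB[of U2] by (simp add: ennreal_minus_le_iff add.commute)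
  qed
  have "emeasure T X - emeasure A X \<le> emeasure B U2" if "open U2" "X \<subseteq> U2" for U2
    using 2[OF that] finA[of X] by (simp add: ennreal_minus_le_iff)
  then have "emeasure T X - emeasure A X \<le> emeasure B X"
    unfolding outer_regular[OF B X] by (intro INF_greatest) auto
  then show ?thesis using finA[of X] by (simp add: ennreal_minus_le_iff)
qed

text \<open>A non-integrable function has Bochner integral 0, so the bound is unconditional and
  spares the integrability of inner products of \<open>H\<close> with test fields.\<close>

lemma ennreal_abs_integral_le:
  fixes f :: "'b \<Rightarrow> real"
  shows "ennreal \<bar>\<integral>x. f x \<partial>M\<bar> \<le> (\<integral>\<^sup>+x. ennreal \<bar>f x\<bar> \<partial>M)"
proof (cases "integrable M f")
  case True
  then show ?thesis using integral_norm_bound_ennreal[OF True] by simp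
qed (simp add: not_integrable_integral_eq)

context riemannian
begin

lemma abs_metric_at_le: "\<bar>metric_at \<Omega> x v w\<bar> \<le> gnorm \<Omega> x v * gnorm \<Omega> x w"
  unfolding gnorm_def by (rule ip_form.Cauchy_Schwarz[OF ip_form_metric_at])

lemma test_field_support: "test_field \<Omega> U X \<Longrightarrow> x \<notin> U \<Longrightarrow> X x = 0"
  unfolding test_field_def using closure_subset[of "{x. X x \<noteq> 0}"] by auto

lemma ennreal_abs_integral_metric_le:
  assumes "\<And>x. x \<notin> U \<Longrightarrow> X x = 0"
  shows "ennreal \<bar>\<integral>x. metric_at \<Omega> x (H x) (X x) \<partial>\<mu>\<bar>
    \<le> (\<integral>\<^sup>+x. ennreal (gnorm \<Omega> x (H x) * gnorm \<Omega> x (X x)) * indicator U x \<partial>\<mu>)"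
proof (rule order_trans[OF ennreal_abs_integral_le nn_integral_mono])
  fix x
  show "ennreal \<bar>metric_at \<Omega> x (H x) (X x)\<bar>
      \<le> ennreal (gnorm \<Omega> x (H x) * gnorm \<Omega> x (X x)) * indicator U x"
  proof (cases "x \<in> U")
    case True
    then show ?thesis using abs_metric_at_le[of x "H x" "X x"] by (simp add: ennreal_leI)
  next
    case False
    then show ?thesis
      using assms ip_form.G_simps(7)[OF ip_form_metric_at] by simp
  qed
qed

text \<open>Measurability of \<open>H\<close> is expressed chart by chart, hence the indicator of
  one domain; it suffices for integrals over sets inside a single chart.\<close>

lemma gnorm_borel_field:
  assumes H: "borel_field \<Omega> H" and c: "c \<in> atlas \<Omega>"
  shows "(\<lambda>x. indicator (cdom c) x *\<^sub>R gnorm \<Omega> x (H x)) \<in> borel_measurable borel"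
proof -
  interpret m: metric_domain "cimg c" "metric_in \<Omega> c" by (rule metric_domain_chart[OF c])
  let ?R = "restrict_space borel (cdom c)"
  have h: "(\<lambda>x. to_chart \<Omega> c x (H x)) \<in> borel_measurable ?R"
    using H c unfolding borel_field_def by blast
  have "cmap c \<in> borel_measurable ?R"
    by (rule borel_measurable_continuous_on_restrict[OF continuous_cmap[OF c]])
  then have "(\<lambda>x. metric_in \<Omega> c (cmap c x) (to_chart \<Omega> c x (H x)) (to_chart \<Omega> c x (H x))) \<in> borel_measurable ?R"
    by (rule m.borel_measurable_g[OF _ _ h h]) (simp add: space_restrict_space)
  from measurable_compose[OF this borel_measurable_sqrt]
  have "(\<lambda>x. sqrt (metric_in \<Omega> c (cmap c x) (to_chart \<Omega> c x (H x)) (to_chart \<Omega> c x (H x)))) \<in> borel_measurable ?R" .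
  then have "(\<lambda>x. gnorm \<Omega> x (H x)) \<in> borel_measurable ?R"
    by (rule measurable_cong[THEN iffD1, rotated]) (simp add: space_restrict_space gnorm_to_chart[OF c])
  then show ?thesis
    using open_cdom[OF c] by (subst (asm) borel_measurable_restrict_space_iff) auto
qed

lemma borel_cinv_image:
  assumes c: "c \<in> atlas \<Omega>" and U: "open U" "U \<subseteq> cimg c" and N: "N \<in> sets borel"
  shows "{y \<in> U. cinv c y \<in> N} \<in> sets borel"
proof -
  have "cinv c \<in> borel_measurable (restrict_space borel U)"
    by (rule borel_measurable_continuous_on_restrict[OF continuous_on_subset[OF continuous_cinv[OF c] U(2)]])
  from measurable_sets[OF this N] have "cinv c -` N \<inter> U \<in> sets (restrict_space borel U)"
    by (simp add: space_restrict_space)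
  then have "cinv c -` N \<inter> U \<in> sets borel"
    using U(1) by (subst (asm) sets_restrict_space_iff) auto
  moreover have "{y \<in> U. cinv c y \<in> N} = cinv c -` N \<inter> U" by auto
  ultimately show ?thesis by simp
qed

text \<open>\<open>push c U \<nu>\<close> is the measure \<open>\<nu>\<close>, restricted to the part of the manifold with coordinates in \<open>U\<close>,
  in the chart \<open>c\<close>; outer regularity is only available there.\<close>

definition push :: "('a, 'e) chart \<Rightarrow> 'e set \<Rightarrow> 'a measure \<Rightarrow> 'e measure" where
  "push c U \<nu> = distr (restrict_space \<nu> (cinv c ` U)) borel (cmap c)"

lemma sets_push: "sets (push c U \<nu>) = sets borel" and space_push: "space (push c U \<nu>) = UNIV"
  by (simp_all add: push_def)

lemma emeasure_push:
  assumes c: "c \<in> atlas \<Omega>" and U: "open U" "U \<subseteq> cimg c" and \<nu>: "sets \<nu> = sets borel" and B: "B \<in> sets borel"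
  shows "emeasure (push c U \<nu>) B = emeasure \<nu> (cinv c ` (U \<inter> B))"
proof -
  let ?O = "cinv c ` U"
  have O: "?O \<in> sets borel" by (rule borel_open[OF open_cinv_image[OF c U]])
  have Oc: "?O \<subseteq> cdom c" using cinv_in[OF c] U(2) by auto
  have "cmap c \<in> borel_measurable (restrict_space borel ?O)"
    by (rule borel_measurable_continuous_on_restrict[OF continuous_on_subset[OF continuous_cmap[OF c] Oc]])
  then have m: "cmap c \<in> restrict_space \<nu> ?O \<rightarrow>\<^sub>M borel"
    by (simp cong: measurable_cong_sets add: measurable_cong_sets[OF sets_restrict_space_cong[OF \<nu>] refl])
  have sp: "space \<nu> = UNIV" using sets_eq_imp_space_eq[OF \<nu>] by simp
  have eq: "cmap c -` B \<inter> ?O = cinv c ` (U \<inter> B)"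
    using U(2) cmap_cinv[OF c] by (auto simp: subset_iff)
  have "emeasure (push c U \<nu>) B = emeasure (restrict_space \<nu> ?O) (cmap c -` B \<inter> ?O)"
    unfolding push_def using emeasure_distr[OF m B] by (simp add: space_restrict_space sp)
  also have "\<dots> = emeasure \<nu> (cmap c -` B \<inter> ?O)"
    using O \<nu> by (intro emeasure_restrict_space) (auto simp: sp)
  finally show ?thesis by (simp only: eq)
qed

text \<open>Write \<open>\<mu>\<close> for the weight.  On open sets \<open>\<tau>\<close> is at most the total variation \<open>\<mu>'\<close> of the first
  variation plus \<open>|H| \<mu>\<close>, hence on Borel sets by outer regularity.  As \<open>\<tau>\<close> lives on a \<open>\<mu>\<close>-null set, only
  the singular part \<open>\<sigma>\<close> of \<open>\<mu>'\<close> contributes.\<close>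

lemma variation_le_boundary:
  assumes V: "varifold \<Omega> m V" and H: "borel_field \<Omega> H"
    and Hloc: "\<And>K. compact K \<Longrightarrow> (\<integral>\<^sup>+ x\<in>K. ennreal (gnorm \<Omega> x (H x)) \<partial>weight V) < \<infinity>"
    and \<tau>: "total_variation_measure \<Omega>
            (\<lambda>X. first_variation \<Omega> V X + (LINT x|weight V. metric_at \<Omega> x (H x) (X x))) \<tau>"
    and sing: "singular_to (weight V) \<tau>"
    and \<sigma>: "boundary_measure \<Omega> V \<sigma>"
    and c: "c \<in> atlas \<Omega>" and ball: "cball y0 \<rho> \<subseteq> cimg c"
  shows "emeasure \<tau> (cinv c ` ball y0 \<rho>) \<le> emeasure \<sigma> (cinv c ` cball y0 \<rho>)"
proof -
  let ?\<mu> = "weight V"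
  obtain \<mu>' \<alpha> where \<mu>': "total_variation_measure \<Omega> (first_variation \<Omega> V) \<mu>'"
    and \<alpha>: "sets \<alpha> = sets borel" "absolutely_continuous ?\<mu> \<alpha>"
    and split: "\<And>A. A \<in> sets borel \<Longrightarrow> emeasure \<mu>' A = emeasure \<alpha> A + emeasure \<sigma> A"
    and sets\<sigma>: "sets \<sigma> = sets borel"
    using \<sigma> unfolding boundary_measure_def by blast
  have sets\<tau>: "sets \<tau> = sets borel" and sets\<mu>': "sets \<mu>' = sets borel"
    using \<tau> \<mu>' unfolding total_variation_measure_def by auto
  note sets\<mu> = sets_weight[OF V]
  define U where "U = ball y0 \<rho>"
  define D where "D = cinv c ` U"
  define K where "K = cinv c ` cball y0 \<rho>"
  have U: "open U" "U \<subseteq> cimg c" using ball by (auto simp: U_def)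
  have Oo: "open D" unfolding D_def by (rule open_cinv_image[OF c U])
  have OK: "D \<subseteq> K" by (auto simp: D_def K_def U_def)
  have K: "compact K" unfolding K_def by (rule compact_cinv_image[OF c compact_cball ball])
  have Kb: "K \<in> sets borel" by (rule borel_closed[OF compact_imp_closed[OF K]])
  have Oc: "D \<subseteq> cdom c" using cinv_in[OF c] U(2) by (auto simp: D_def)
  define w where "w x = ennreal (indicator D x * (indicator (cdom c) x *\<^sub>R gnorm \<Omega> x (H x)))" for x
  have wm: "w \<in> borel_measurable ?\<mu>"
  proof -
    have "w \<in> borel_measurable borel"
      unfolding w_def
      by (intro measurable_compose[OF borel_measurable_times[OF _ gnorm_borel_field[OF H c]] measurable_ennreal]
          borel_measurable_indicator borel_open Oo)
    then show ?thesis by (simp add: measurable_cong_sets[OF sets\<mu> refl])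
  qed
  have w: "w x = ennreal (gnorm \<Omega> x (H x)) * indicator D x" for x
    using Oc by (auto simp: w_def indicator_def)
  define \<kappa> where "\<kappa> = density ?\<mu> w"
  have sets\<kappa>: "sets \<kappa> = sets borel" by (simp add: \<kappa>_def sets\<mu>)
  have \<kappa>_eq: "emeasure \<kappa> A = (\<integral>\<^sup>+x. w x * indicator A x \<partial>?\<mu>)" if "A \<in> sets borel" for A
    unfolding \<kappa>_def by (rule emeasure_density[OF wm]) (simp add: sets\<mu> that)
  have open_le: "emeasure \<tau> A \<le> emeasure \<mu>' A + emeasure \<kappa> A" if A: "open A" "A \<subseteq> D" for A
  proof -
    have "emeasure \<tau> A = (SUP X\<in>{X. test_field \<Omega> A X \<and> (\<forall>x. gnorm \<Omega> x (X x) \<le> 1)}.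
        ennreal (first_variation \<Omega> V X + (LINT x|?\<mu>. metric_at \<Omega> x (H x) (X x))))"
      using \<tau> A unfolding total_variation_measure_def by blast
    also have "\<dots> \<le> emeasure \<mu>' A + emeasure \<kappa> A"
    proof (rule SUP_least)
      fix X assume "X \<in> {X. test_field \<Omega> A X \<and> (\<forall>x. gnorm \<Omega> x (X x) \<le> 1)}"
      then have X: "test_field \<Omega> A X" "\<And>x. gnorm \<Omega> x (X x) \<le> 1" by auto
      let ?a = "first_variation \<Omega> V X" and ?b = "LINT x|?\<mu>. metric_at \<Omega> x (H x) (X x)"
      have "ennreal ?a \<le> (SUP X\<in>{X. test_field \<Omega> A X \<and> (\<forall>x. gnorm \<Omega> x (X x) \<le> 1)}. ennreal (first_variation \<Omega> V X))"
        by (rule SUP_upper) (use X in simp)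
      also have "\<dots> = emeasure \<mu>' A"
        using \<mu>' A unfolding total_variation_measure_def by simp
      finally have a: "ennreal ?a \<le> emeasure \<mu>' A" .
      have "ennreal \<bar>?b\<bar> \<le> (\<integral>\<^sup>+x. ennreal (gnorm \<Omega> x (H x) * gnorm \<Omega> x (X x)) * indicator A x \<partial>?\<mu>)"
        by (rule ennreal_abs_integral_metric_le) (rule test_field_support[OF X(1)])
      also have "\<dots> \<le> (\<integral>\<^sup>+x. w x * indicator A x \<partial>?\<mu>)"
      proof (intro nn_integral_mono)
        fix x
        have "gnorm \<Omega> x (H x) * gnorm \<Omega> x (X x) \<le> gnorm \<Omega> x (H x)"
          using X(2)[of x] gnorm_nonneg[of x "H x"] by (simp add: mult_left_le)
        then show "ennreal (gnorm \<Omega> x (H x) * gnorm \<Omega> x (X x)) * indicator A x \<le> w x * indicator A x"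
          using A(2) by (auto simp: w indicator_def intro!: ennreal_leI)
      qed
      also have "\<dots> = emeasure \<kappa> A" using \<kappa>_eq[OF borel_open[OF A(1)]] by simp
      finally have b: "ennreal \<bar>?b\<bar> \<le> emeasure \<kappa> A" .
      \<comment> \<open>\<open>ennreal\<close> truncates at 0, so a negative \<open>?a\<close> is
        replaced by 0 before the sum is split.\<close>
      have "ennreal (?a + ?b) \<le> ennreal (max ?a 0 + \<bar>?b\<bar>)" by (intro ennreal_leI) auto
      also have "\<dots> = ennreal ?a + ennreal \<bar>?b\<bar>" by (subst ennreal_plus) (auto simp: max_def ennreal_neg)
      also have "\<dots> \<le> emeasure \<mu>' A + emeasure \<kappa> A" by (intro add_mono a b)
      finally show "ennreal (?a + ?b) \<le> emeasure \<mu>' A + emeasure \<kappa> A" .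
    qed
    finally show ?thesis .
  qed
  \<comment> \<open>Finiteness is given on compact sets; the closed ball passes it on to
    \<open>D\<close>, as \<open>emeasure_le_of_open\<close> requires.\<close>
  have \<mu>'fin: "emeasure \<mu>' D < \<infinity>"
  proof -
    have "emeasure \<mu>' D \<le> emeasure \<mu>' K" using OK Kb sets\<mu>' by (intro emeasure_mono) auto
    also have "\<dots> < \<infinity>" using \<mu>' K unfolding total_variation_measure_def by blast
    finally show ?thesis .
  qed
  have \<kappa>fin: "emeasure \<kappa> D < \<infinity>"
  proof -
    have "emeasure \<kappa> D \<le> (\<integral>\<^sup>+x\<in>K. ennreal (gnorm \<Omega> x (H x)) \<partial>?\<mu>)"
      unfolding \<kappa>_eq[OF borel_open[OF Oo]] using OK by (intro nn_integral_mono) (auto simp: w indicator_def)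
    also have "\<dots> < \<infinity>" by (rule Hloc[OF K])
    finally show ?thesis .
  qed
  have le: "emeasure \<tau> (D \<inter> N) \<le> emeasure \<mu>' (D \<inter> N) + emeasure \<kappa> (D \<inter> N)" if N: "N \<in> sets borel" for N
  proof -
    let ?B = "{y \<in> U. cinv c y \<in> N}"
    have B: "?B \<in> sets borel" by (rule borel_cinv_image[OF c U N])
    have eq: "cinv c ` (U \<inter> ?B) = D \<inter> N" by (auto simp: D_def)
    note push = emeasure_push[OF c U]
    have "emeasure (push c U \<tau>) ?B \<le> emeasure (push c U \<mu>') ?B + emeasure (push c U \<kappa>) ?B"
    proof (rule emeasure_le_of_open[OF sets_push sets_push _ sets_push _ _ B])
      show "emeasure (push c U \<mu>') (space (push c U \<mu>')) \<noteq> \<infinity>"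
        "emeasure (push c U \<kappa>) (space (push c U \<kappa>)) \<noteq> \<infinity>"
        using \<mu>'fin \<kappa>fin by (simp_all add: space_push push sets\<mu>' sets\<kappa> D_def[symmetric])
      fix W :: "'e set" assume W: "open W"
      have "open (cinv c ` (U \<inter> W))" using U W by (intro open_cinv_image[OF c]) auto
      then show "emeasure (push c U \<tau>) W \<le> emeasure (push c U \<mu>') W + emeasure (push c U \<kappa>) W"
        using borel_open[OF W] open_le[of "cinv c ` (U \<inter> W)"] by (simp add: push sets\<mu>' sets\<kappa> sets\<tau> D_def image_mono)
    qed
    then show ?thesis using B by (simp only: push sets\<mu>' sets\<kappa> sets\<tau> eq)
  qed
  obtain N where N: "N \<in> sets ?\<mu>" "emeasure ?\<mu> N = 0" "emeasure \<tau> (space \<tau> - N) = 0"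
    using sing unfolding singular_to_def by blast
  have Nb: "N \<in> sets borel" using N(1) by (simp add: sets\<mu>)
  have Ob: "D \<in> sets borel" by (rule borel_open[OF Oo])
  have ONb: "D \<inter> N \<in> sets borel" "D - N \<in> sets borel" using Ob Nb by auto
  have "emeasure ?\<mu> (D \<inter> N) \<le> emeasure ?\<mu> N" by (rule emeasure_mono) (use N in auto)
  then have null: "D \<inter> N \<in> null_sets ?\<mu>" using N(2) ONb by (simp add: null_sets_def sets\<mu>)
  have "absolutely_continuous ?\<mu> \<kappa>" unfolding \<kappa>_def by (rule absolutely_continuousI_density[OF wm])
  then have \<kappa>0: "emeasure \<kappa> (D \<inter> N) = 0" and \<alpha>0: "emeasure \<alpha> (D \<inter> N) = 0"
    using null \<alpha>(2) unfolding absolutely_continuous_def by (auto simp: null_sets_def)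
  have "emeasure \<tau> (D - N) \<le> emeasure \<tau> (space \<tau> - N)"
    using Nb sets\<tau> sets_eq_imp_space_eq[OF sets\<tau>] by (intro emeasure_mono) auto
  then have \<tau>0: "emeasure \<tau> (D - N) = 0" using N(3) by simp
  have "emeasure \<tau> D = emeasure \<tau> ((D \<inter> N) \<union> (D - N))" by (simp add: Int_Diff_Un)
  also have "\<dots> = emeasure \<tau> (D \<inter> N) + emeasure \<tau> (D - N)"
    using ONb sets\<tau> by (intro plus_emeasure[symmetric]) auto
  also have "\<dots> \<le> emeasure \<sigma> (D \<inter> N)"
    using le[OF Nb] split[OF ONb(1)] \<kappa>0 \<alpha>0 \<tau>0 by simp
  also have "\<dots> \<le> emeasure \<sigma> K" using OK Kb sets\<sigma> by (intro emeasure_mono) auto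
  finally show ?thesis by (simp add: D_def U_def K_def)
qed

end

section \<open>The area blow-up set\<close>

context riemannian
begin

lemma in_cinv_image_iff:
  assumes "c \<in> atlas \<Omega>" "A \<subseteq> cimg c" "x \<in> cdom c"
  shows "x \<in> cinv c ` A \<longleftrightarrow> cmap c x \<in> A"
proof
  assume "x \<in> cinv c ` A"
  then show "cmap c x \<in> A" using cmap_cinv[OF assms(1)] assms(2) by auto
next
  assume "cmap c x \<in> A"
  then show "x \<in> cinv c ` A" using cinv_cmap[OF assms(1,3)] by (metis image_eqI)
qed

text \<open>The trace bounds integrate to a lower bound for the first variation of \<open>X\<close>,
  with main term \<open>h * A\<close>. The first variation is also \<open>L - J\<close>: the
  singular functional \<open>L\<close> is at most the boundary measure, and \<open>J\<close>, the
  integral of \<open>H\<close> against \<open>X\<close>, is at most \<open>h * A\<close> plus the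
  integral of the excess of |H| over \<open>h\<close>. The two occurrences of \<open>h * A\<close>
  cancel.\<close>

lemma first_variation_inequality:
  assumes V: "varifold \<Omega> m V" and H: "generalized_mean_curvature \<Omega> V H" and \<sigma>: "boundary_measure \<Omega> V \<sigma>"
    and c: "c \<in> atlas \<Omega>" and ball: "cball y0 \<rho> \<subseteq> cimg c" and h: "0 \<le> h"
    and \<xi>: "Ck_on 1 \<xi> (cimg c)" and K: "compact K" "K \<subseteq> ball y0 \<rho>" and \<xi>0: "\<And>y. y \<in> cimg c - K \<Longrightarrow> \<xi> y = 0"
    and Q: "compact Q" "Q \<subseteq> K" and N: "open N" "N \<subseteq> K" and \<epsilon>: "0 < \<epsilon>" and C: "0 \<le> C"
    and \<xi>le: "\<And>y. y \<in> cimg c \<Longrightarrow> sqrt (metric_in \<Omega> c y (\<xi> y) (\<xi> y)) \<le> 1"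
    and lower: "\<And>y E. y \<in> cimg c \<Longrightarrow> ip_form.orthonormal (metric_in \<Omega> c y) E \<Longrightarrow> card E = m \<Longrightarrow>
       h * sqrt (metric_in \<Omega> c y (\<xi> y) (\<xi> y)) + \<epsilon> * indicator N y - C * indicator Q y
         \<le> (\<Sum>e\<in>E. metric_domain.lie_form (metric_in \<Omega> c) \<xi> y e e)"
    and upper: "\<And>y E. y \<in> cimg c \<Longrightarrow> ip_form.orthonormal (metric_in \<Omega> c y) E \<Longrightarrow> card E = m \<Longrightarrow>
       \<bar>\<Sum>e\<in>E. metric_domain.lie_form (metric_in \<Omega> c) \<xi> y e e\<bar> \<le> C * indicator K y"
  shows "ennreal \<epsilon> * emeasure (weight V) (cinv c ` N) \<le> ennreal C * emeasure (weight V) (cinv c ` Q)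
    + emeasure \<sigma> (cinv c ` cball y0 \<rho>)
    + (\<integral>\<^sup>+ x\<in>cinv c ` K. ennreal (max (gnorm \<Omega> x (H x) - h) 0) \<partial>weight V)"
proof -
  let ?\<mu> = "weight V"
  note sets\<mu> = sets_weight[OF V]
  interpret mc: metric_domain "cimg c" "metric_in \<Omega> c" by (rule metric_domain_chart[OF c])
  have KV: "K \<subseteq> cimg c" "N \<subseteq> cimg c" "Q \<subseteq> cimg c"
    using order_trans[OF K(2) order_trans[OF ball_subset_cball ball]] Q(2) N(2) by blast+
  define X where "X = chart_field c \<xi>"
  define K' where "K' = cinv c ` K"
  define N' where "N' = cinv c ` N"
  define Q' where "Q' = cinv c ` Q"
  define D where "D = cinv c ` ball y0 \<rho>"
  have X1: "C1_field \<Omega> X" unfolding X_def by (rule C1_field_chart_field[OF c \<xi> K(1) KV(1) \<xi>0])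
  have K': "compact K'" unfolding K'_def by (rule compact_cinv_image[OF c K(1) KV(1)])
  have Q': "compact Q'" unfolding Q'_def by (rule compact_cinv_image[OF c Q(1) KV(3)])
  have N'o: "open N'" unfolding N'_def by (rule open_cinv_image[OF c N(1) KV(2)])
  have sub: "N' \<subseteq> K'" "Q' \<subseteq> K'" "K' \<subseteq> cdom c"
    unfolding N'_def Q'_def K'_def using Q N cinv_in[OF c] KV by auto
  have b: "K' \<in> sets borel" "Q' \<in> sets borel" "N' \<in> sets borel"
    using compact_imp_closed[OF K'] compact_imp_closed[OF Q'] N'o by auto
  have finK: "emeasure ?\<mu> K' < \<infinity>" by (rule weight_compact_finite[OF V K'])
  have fin: "emeasure ?\<mu> A < \<infinity>" if "A \<subseteq> K'" for A
    using emeasure_mono[OF that, of ?\<mu>] finK b by (auto simp: sets\<mu>)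
  define a where "a x = gnorm \<Omega> x (X x)" for x
  have a_eq: "a x = indicator (cdom c) x *\<^sub>R sqrt (metric_in \<Omega> c (cmap c x) (\<xi> (cmap c x)) (\<xi> (cmap c x)))" for x
    unfolding a_def X_def gnorm_chart_field[OF c] by simp
  have a0: "0 \<le> a x" for x unfolding a_def by (rule gnorm_nonneg)
  have a1: "a x \<le> indicator K' x" for x
  proof (cases "x \<in> K'")
    case True
    then show ?thesis using \<xi>le sub(3) by (auto simp: a_eq)
  next
    case False
    then have "X x = 0" unfolding X_def K'_def by (intro chart_field_zero[OF c \<xi>0])
    then show ?thesis using False by (simp add: a_def gnorm_zero)
  qed
  have am: "a \<in> borel_measurable borel"
  proof -
    have "continuous_on (cdom c) (\<lambda>x. sqrt (metric_in \<Omega> c (cmap c x) (\<xi> (cmap c x)) (\<xi> (cmap c x))))"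
      by (intro continuous_on_real_sqrt mc.continuous_on_g continuous_cmap[OF c]
          continuous_on_compose2[OF C1_on_continuous_on[OF \<xi>] continuous_cmap[OF c]]) auto
    then show ?thesis
      unfolding a_eq[abs_def] by (intro borel_measurable_continuous_on_indicator borel_open open_cdom[OF c])
  qed
  \<comment> \<open>The lower bound of the divergence depends only on the base point, so its
    integral over the varifold passes to the weight.\<close>
  define k where "k x = h * a x + \<epsilon> * indicator N' x - C * indicator Q' x" for x
  define dv where "dv z = div_plane \<Omega> X (fst z) (snd z)" for z
  have dvm: "dv \<in> borel_measurable V"
    unfolding dv_def X_def by (rule div_plane_measurable[OF V c \<xi> K(1) KV(1) \<xi>0])
  have dv_bounds: "k (fst z) \<le> dv z" "\<bar>dv z\<bar> \<le> C * indicator K' (fst z)" if z: "z \<in> space V" for z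
  proof -
    obtain x S where zxS: "z = (x, S)" by (cases z)
    have S: "subspace S" "dim S = m" using z by (auto simp: space_varifold[OF V] zxS)
    have "k x \<le> dv z \<and> \<bar>dv z\<bar> \<le> C * indicator K' x"
    proof (cases "x \<in> cdom c")
      case True
      have y: "cmap c x \<in> cimg c" using True by blast
      interpret ip_form "metric_in \<Omega> c (cmap c x)" by (rule mc.ip_form_g[OF y])
      have lin: "linear (to_chart \<Omega> c x)" by (rule to_chart_linear[OF c True])
      have "subspace (to_chart \<Omega> c x ` S)" by (rule linear_subspace_image[OF lin S(1)])
      then obtain E where E: "orthonormal E" "span E = to_chart \<Omega> c x ` S" using exists_orthonormal_basis by blast
      have "inj (to_chart \<Omega> c x)" using of_to_chart[OF c True] by (metis injI)
      then have "dim (to_chart \<Omega> c x ` S) = m" using dim_image_eq[OF lin] S(2) by (metis inj_on_subset subset_UNIV)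
      then have cE: "card E = m" using orthonormal_card[OF E(1)] E(2) by simp
      have dv_eq: "dv z = (\<Sum>e\<in>E. mc.lie_form \<xi> (cmap c x) e e)"
        unfolding dv_def zxS fst_conv snd_conv X_def
        by (rule div_plane_chart_field[OF c X1[unfolded X_def] \<xi> True S(1) E])
      have ind: "indicator N' x = (indicator N (cmap c x) :: real)" "indicator Q' x = (indicator Q (cmap c x) :: real)"
        "indicator K' x = (indicator K (cmap c x) :: real)"
        using in_cinv_image_iff[OF c KV(1) True] in_cinv_image_iff[OF c KV(2) True] in_cinv_image_iff[OF c KV(3) True]
        by (auto simp: indicator_def N'_def Q'_def K'_def)
      show ?thesis
        using lower[OF y E(1) cE] upper[OF y E(1) cE] True unfolding dv_eq k_def a_eq ind by simp
    next
      case False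
      have xK: "x \<notin> K'" using False sub by blast
      have "dv z = 0"
        unfolding dv_def zxS fst_conv snd_conv
      proof (rule div_plane_zero[OF X1 _ _ _ S(1), of "- K'"])
        show "X x = 0" if "x \<in> - K'" for x
          using that unfolding X_def K'_def by (intro chart_field_zero[OF c \<xi>0]) auto
      qed (use xK K' compact_imp_closed in auto)
      moreover have "a x = 0" using False by (simp add: a_eq)
      moreover have "x \<notin> N'" "x \<notin> Q'" using xK sub by auto
      ultimately show ?thesis using C by (simp add: k_def xK)
    qed
    then show "k (fst z) \<le> dv z" "\<bar>dv z\<bar> \<le> C * indicator K' (fst z)" by (auto simp: zxS)
  qed
  have inta: "integrable ?\<mu> a"
  proof (rule Bochner_Integration.integrable_bound[of ?\<mu> "indicator K' :: 'a \<Rightarrow> real"])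
    show "integrable ?\<mu> (indicator K' :: 'a \<Rightarrow> real)" using finK b by (simp add: sets\<mu> integrable_indicator_iff)
    show "a \<in> borel_measurable ?\<mu>" using am by (simp add: measurable_cong_sets[OF sets\<mu> refl])
    show "AE x in ?\<mu>. norm (a x) \<le> norm (indicator K' x :: real)" using a0 a1 by simp
  qed
  have intind: "integrable ?\<mu> (indicator A :: 'a \<Rightarrow> real)" if "A \<in> sets borel" "A \<subseteq> K'" for A
    using fin[OF that(2)] that(1) by (simp add: sets\<mu> integrable_indicator_iff)
  have intk: "integrable ?\<mu> k"
    unfolding k_def using inta intind[OF b(2) sub(2)] intind[OF b(3) sub(1)] by auto
  have km: "k \<in> borel_measurable borel"
    using borel_measurable_integrable[OF intk] by (simp add: measurable_cong_sets[OF sets\<mu> refl])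
  have fstm: "fst \<in> V \<rightarrow>\<^sub>M borel" by (rule measurable_fst_varifold[OF V])
  have intkV: "integrable V (\<lambda>z. k (fst z))"
    using intk unfolding weight_def by (simp add: integrable_distr_eq[OF fstm km])
  \<comment> \<open>Otherwise the integral in \<open>first_variation\<close> would be 0 by
    convention and monotonicity would not apply.\<close>
  have intdv: "integrable V dv"
  proof (rule Bochner_Integration.integrable_bound[of V "\<lambda>z. C * indicator K' (fst z)"])
    have "integrable V (\<lambda>z. indicator K' (fst z) :: real)"
      using intind[OF b(1)] integrable_distr_eq[OF fstm, of "indicator K' :: 'a \<Rightarrow> real"] b(1)
      unfolding weight_def by simp
    then show "integrable V (\<lambda>z. C * indicator K' (fst z))" by simp
    show "AE z in V. norm (dv z) \<le> norm (C * indicator K' (fst z))"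
      using dv_bounds(2) C by (intro AE_I2) simp
  qed (rule dvm)
  define A where "A = (\<integral>x. a x \<partial>?\<mu>)"
  define n where "n = measure ?\<mu> N'"
  define q where "q = measure ?\<mu> Q'"
  define J where "J = (LINT x|?\<mu>. metric_at \<Omega> x (H x) (X x))"
  define L where "L = first_variation \<Omega> V X + J"
  have A0: "0 \<le> A" unfolding A_def by (intro Bochner_Integration.integral_nonneg a0)
  have "h * A + \<epsilon> * n - C * q = (\<integral>x. k x \<partial>?\<mu>)"
    unfolding k_def A_def n_def q_def
    using inta intind[OF b(2) sub(2)] intind[OF b(3) sub(1)] b by (simp add: sets\<mu> space_weight[OF V])
  also have "\<dots> = (\<integral>z. k (fst z) \<partial>V)"
    unfolding weight_def by (rule integral_distr[OF fstm km])
  also have "\<dots> \<le> first_variation \<Omega> V X"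
    unfolding first_variation_def dv_def[symmetric]
    by (rule integral_mono[OF intkV intdv dv_bounds(1)])
  finally have fv: "h * A + \<epsilon> * n \<le> C * q + (max L 0 + \<bar>J\<bar>)" unfolding L_def by linarith
  have Hb: "borel_field \<Omega> H" and Hloc: "\<And>K. compact K \<Longrightarrow> (\<integral>\<^sup>+ x\<in>K. ennreal (gnorm \<Omega> x (H x)) \<partial>?\<mu>) < \<infinity>"
    using H unfolding generalized_mean_curvature_def by blast+
  obtain \<tau> where \<tau>: "total_variation_measure \<Omega>
      (\<lambda>X. first_variation \<Omega> V X + (LINT x|?\<mu>. metric_at \<Omega> x (H x) (X x))) \<tau>" "singular_to ?\<mu> \<tau>"
    using H unfolding generalized_mean_curvature_def by blast
  have Dopen: "open D" 
    unfolding D_def by (rule open_cinv_image[OF c open_ball order_trans[OF ball_subset_cball ball]])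
  have XD: "test_field \<Omega> D X"
    unfolding X_def D_def by (rule test_field_chart_field[OF c \<xi> K(1) KV(1) \<xi>0 image_mono[OF K(2)]])
  have X_le: "gnorm \<Omega> x (X x) \<le> 1" for x
    by (rule order_trans[OF a1[unfolded a_def]]) (simp add: indicator_def)
  have "ennreal L \<le> (SUP X\<in>{X. test_field \<Omega> D X \<and> (\<forall>x. gnorm \<Omega> x (X x) \<le> 1)}.
        ennreal (first_variation \<Omega> V X + (LINT x|?\<mu>. metric_at \<Omega> x (H x) (X x))))"
    unfolding L_def J_def by (rule SUP_upper) (use XD X_le in simp)
  also have "\<dots> = emeasure \<tau> D" using \<tau>(1) Dopen unfolding total_variation_measure_def by simp
  also have "\<dots> \<le> emeasure \<sigma> (cinv c ` cball y0 \<rho>)"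
    unfolding D_def by (rule variation_le_boundary[OF V Hb Hloc \<tau> \<sigma> c ball])
  finally have Lle: "ennreal L \<le> emeasure \<sigma> (cinv c ` cball y0 \<rho>)" .
  let ?R = "\<integral>\<^sup>+ x\<in>K'. ennreal (max (gnorm \<Omega> x (H x) - h) 0) \<partial>?\<mu>"
  have "ennreal \<bar>J\<bar> \<le> (\<integral>\<^sup>+x. ennreal (gnorm \<Omega> x (H x) * gnorm \<Omega> x (X x)) * indicator K' x \<partial>?\<mu>)"
    unfolding J_def
  proof (rule ennreal_abs_integral_metric_le)
    show "X x = 0" if "x \<notin> K'" for x using that unfolding X_def K'_def by (intro chart_field_zero[OF c \<xi>0])
  qed
  also have "\<dots> \<le> (\<integral>\<^sup>+x. ennreal (h * a x) + ennreal (max (gnorm \<Omega> x (H x) - h) 0) * indicator K' x \<partial>?\<mu>)"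
  proof (intro nn_integral_mono)
    fix x
    have "gnorm \<Omega> x (H x) * a x \<le> (h + max (gnorm \<Omega> x (H x) - h) 0) * a x"
      by (intro mult_right_mono a0) auto
    also have "\<dots> = h * a x + max (gnorm \<Omega> x (H x) - h) 0 * a x" by (simp add: distrib_right)
    also have "\<dots> \<le> h * a x + max (gnorm \<Omega> x (H x) - h) 0"
      using X_le[of x] unfolding a_def by (intro add_left_mono) (simp add: mult_left_le)
    finally have "ennreal (gnorm \<Omega> x (H x) * a x) \<le> ennreal (h * a x + max (gnorm \<Omega> x (H x) - h) 0)"
      by (rule ennreal_leI)
    also have "\<dots> = ennreal (h * a x) + ennreal (max (gnorm \<Omega> x (H x) - h) 0)"
      using h a0 by (intro ennreal_plus) auto
    finally show "ennreal (gnorm \<Omega> x (H x) * gnorm \<Omega> x (X x)) * indicator K' x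
        \<le> ennreal (h * a x) + ennreal (max (gnorm \<Omega> x (H x) - h) 0) * indicator K' x"
      by (simp add: a_def indicator_def)
  qed
  also have "\<dots> = (\<integral>\<^sup>+x. ennreal (h * a x) \<partial>?\<mu>) + ?R"
  proof (rule nn_integral_add)
    show "(\<lambda>x. ennreal (h * a x)) \<in> borel_measurable ?\<mu>"
      using borel_measurable_integrable[OF inta] by (intro measurable_compose[OF _ measurable_ennreal]) simp
    have "(\<lambda>x. ennreal (max (indicator (cdom c) x *\<^sub>R gnorm \<Omega> x (H x) - h) 0) * indicator K' x) \<in> borel_measurable borel"
      by (intro borel_measurable_times_ennreal measurable_compose[OF _ measurable_ennreal] borel_measurable_max
          borel_measurable_diff gnorm_borel_field[OF Hb c] borel_measurable_indicator b(1)) auto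
    moreover have "(\<lambda>x. ennreal (max (indicator (cdom c) x *\<^sub>R gnorm \<Omega> x (H x) - h) 0) * indicator K' x)
        = (\<lambda>x. ennreal (max (gnorm \<Omega> x (H x) - h) 0) * indicator K' x)"
      using sub(3) by (auto simp: indicator_def fun_eq_iff)
    ultimately show "(\<lambda>x. ennreal (max (gnorm \<Omega> x (H x) - h) 0) * indicator K' x) \<in> borel_measurable ?\<mu>"
      by (simp add: measurable_cong_sets[OF sets\<mu> refl])
  qed
  also have "(\<integral>\<^sup>+x. ennreal (h * a x) \<partial>?\<mu>) = ennreal (h * A)"
    unfolding A_def using h a0 inta by (subst nn_integral_eq_integral) auto
  finally have Jle: "ennreal \<bar>J\<bar> \<le> ennreal (h * A) + ?R" .
  have n: "ennreal n = emeasure ?\<mu> N'" "ennreal q = emeasure ?\<mu> Q'"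
    unfolding n_def q_def using fin[OF sub(1)] fin[OF sub(2)] by (simp_all add: emeasure_eq_ennreal_measure less_top[symmetric])
  have n0: "0 \<le> n" "0 \<le> q" by (simp_all add: n_def q_def)
  have "ennreal (h * A) + ennreal (\<epsilon> * n) = ennreal (h * A + \<epsilon> * n)"
    using h A0 \<epsilon> n0 by (intro ennreal_plus[symmetric]) auto
  also have "\<dots> \<le> ennreal (C * q + (max L 0 + \<bar>J\<bar>))" by (rule ennreal_leI[OF fv])
  also have "\<dots> = ennreal (C * q) + (ennreal (max L 0) + ennreal \<bar>J\<bar>)"
    using C n0 by (simp add: ennreal_plus)
  also have "ennreal (max L 0) = ennreal L" by (auto simp: max_def ennreal_neg)
  also have "ennreal (C * q) + (ennreal L + ennreal \<bar>J\<bar>)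
      \<le> ennreal (C * q) + (emeasure \<sigma> (cinv c ` cball y0 \<rho>) + (ennreal (h * A) + ?R))"
    by (intro add_mono order_refl Lle Jle)
  also have "\<dots> = ennreal (h * A) + (ennreal (C * q) + emeasure \<sigma> (cinv c ` cball y0 \<rho>) + ?R)"
    by (simp add: ac_simps)
  \<comment> \<open>\<open>h * A\<close> is a finite number, so it may be cancelled in the extended
    reals.\<close>
  finally have "ennreal (\<epsilon> * n) \<le> ennreal (C * q) + emeasure \<sigma> (cinv c ` cball y0 \<rho>) + ?R"
    by (simp add: ennreal_add_left_cancel_le)
  moreover have "ennreal (\<epsilon> * n) = ennreal \<epsilon> * emeasure ?\<mu> N'" "ennreal (C * q) = ennreal C * emeasure ?\<mu> Q'"
    using \<epsilon> C n0 by (simp_all add: ennreal_mult n)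
  ultimately show ?thesis by (simp only: N'_def Q'_def K'_def)
qed

lemma eventually_bounded_of_limsup:
  fixes u :: "nat \<Rightarrow> ennreal"
  assumes "limsup u < \<infinity>" obtains B where "0 \<le> B" "eventually (\<lambda>i. u i \<le> ennreal B) sequentially"
proof -
  obtain b where b: "limsup u < b" "b < \<infinity>" using dense[OF assms] by blast
  have "eventually (\<lambda>i. u i < b) sequentially" by (rule Limsup_lessD[OF b(1)])
  then have "eventually (\<lambda>i. u i \<le> ennreal (enn2real b)) sequentially"
    by eventually_elim (use b(2) in \<open>simp add: less_imp_le\<close>)
  then show ?thesis by (rule that[rotated]) simp
qed

text \<open>Each point of \<open>K\<close> has a ball on which the areas are eventually bounded.
  Finitely many of these open balls cover \<open>K\<close>, so their bounds hold simultaneously from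
  some index on and add up.\<close>

lemma eventually_bounded_off_blowup:
  assumes V: "\<And>i. varifold \<Omega> m (M i)" and K: "compact K" and disj: "K \<inter> area_blowup_set \<Omega> M = {}"
  obtains B where "0 \<le> B" "eventually (\<lambda>i. emeasure (weight (M i)) K \<le> ennreal B) sequentially"
proof -
  have "\<exists>r B. r > 0 \<and> 0 \<le> B \<and> eventually (\<lambda>i. emeasure (weight (M i)) (gball \<Omega> x r) \<le> ennreal B) sequentially"
    if x: "x \<in> K" for x
  proof -
    have "x \<notin> area_blowup_set \<Omega> M" using disj x by blast
    then obtain r where r: "r > 0" "limsup (\<lambda>i. emeasure (weight (M i)) (gball \<Omega> x r)) \<noteq> \<infinity>"
      unfolding area_blowup_set_def by blast
    then have "limsup (\<lambda>i. emeasure (weight (M i)) (gball \<Omega> x r)) < \<infinity>" by (simp add: less_top[symmetric])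
    from eventually_bounded_of_limsup[OF this] r(1) show ?thesis by metis
  qed
  then obtain r B where rB: "\<And>x. x \<in> K \<Longrightarrow> r x > 0" "\<And>x. x \<in> K \<Longrightarrow> 0 \<le> B x"
    "\<And>x. x \<in> K \<Longrightarrow> eventually (\<lambda>i. emeasure (weight (M i)) (gball \<Omega> x (r x)) \<le> ennreal (B x)) sequentially"
    by metis
  have cover: "K \<subseteq> (\<Union>x\<in>K. gball \<Omega> x (r x))" using self_in_gball rB(1) by blast
  obtain F where F: "F \<subseteq> K" "finite F" "K \<subseteq> (\<Union>x\<in>F. gball \<Omega> x (r x))"
    using compactE_image[OF K _ cover] open_gball by metis
  have "eventually (\<lambda>i. \<forall>x\<in>F. emeasure (weight (M i)) (gball \<Omega> x (r x)) \<le> ennreal (B x)) sequentially"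
    using F rB(3) by (intro eventually_ball_finite) auto
  then have "eventually (\<lambda>i. emeasure (weight (M i)) K \<le> ennreal (\<Sum>x\<in>F. B x)) sequentially"
  proof eventually_elim
    case (elim i)
    have g: "gball \<Omega> x (r x) \<in> sets (weight (M i))" for x
      by (simp add: sets_weight[OF V] borel_open[OF open_gball])
    have "emeasure (weight (M i)) K \<le> emeasure (weight (M i)) (\<Union>x\<in>F. gball \<Omega> x (r x))"
      using F g by (intro emeasure_mono sets.finite_UN) auto
    also have "\<dots> \<le> (\<Sum>x\<in>F. emeasure (weight (M i)) (gball \<Omega> x (r x)))"
      using F g by (intro emeasure_subadditive_finite) auto
    also have "\<dots> \<le> (\<Sum>x\<in>F. ennreal (B x))" using elim by (intro sum_mono) auto
    also have "\<dots> = ennreal (\<Sum>x\<in>F. B x)" using F rB(2) by (intro sum_ennreal) auto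
    finally show ?case .
  qed
  moreover have "0 \<le> (\<Sum>x\<in>F. B x)" using F rB(2) by (intro sum_nonneg) auto
  ultimately show ?thesis using that by blast
qed

text \<open>The Christoffel vector solves the Koszul equation, which is tested against the gradient
  of \<open>f\<close> in the chart.\<close>

lemma hessian_eq_hess:
  assumes f: "C2_fun \<Omega> f"
  shows "hessian \<Omega> f p = metric_domain.hess (metric_in \<Omega> (chart_at \<Omega> p)) (f \<circ> cinv (chart_at \<Omega> p)) (cmap (chart_at \<Omega> p) p)"
proof (intro ext)
  fix v w
  define c where "c = chart_at \<Omega> p"
  have c: "c \<in> atlas \<Omega>" "p \<in> cdom c" unfolding c_def by (rule chart_at)+
  interpret mc: metric_domain "cimg c" "metric_in \<Omega> c" by (rule metric_domain_chart[OF c(1)])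
  let ?y = "cmap c p" and ?F = "f \<circ> cinv c"
  have y: "?y \<in> cimg c" using c by blast
  have F1: "Ck_on 1 ?F (cimg c)" using f c(1) C2_on_imp_C1_on unfolding C2_fun_def by blast
  let ?u = "christoffel \<Omega> c ?y v w"
  have "\<forall>z. 2 * metric_in \<Omega> c ?y ?u z = mc.Dg ?y w z v + mc.Dg ?y v z w - mc.Dg ?y v w z"
    unfolding christoffel_def by (rule theI'[OF mc.christoffel_ex1[OF y]])
  then have "2 * metric_in \<Omega> c ?y ?u (mc.grad ?F ?y) = mc.Dg ?y w (mc.grad ?F ?y) v
      + mc.Dg ?y v (mc.grad ?F ?y) w - mc.Dg ?y v w (mc.grad ?F ?y)" by blast
  moreover have "metric_in \<Omega> c ?y ?u (mc.grad ?F ?y) = frechet_derivative ?F (at ?y) ?u"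
    using mc.g_grad[OF F1 y] ip_form.sym[OF mc.ip_form_g[OF y]] by metis
  ultimately show "hessian \<Omega> f p v w
      = metric_domain.hess (metric_in \<Omega> (chart_at \<Omega> p)) (f \<circ> cinv (chart_at \<Omega> p)) (cmap (chart_at \<Omega> p) p) v w"
    unfolding hessian_def mc.hess_def[folded c_def] c_def[symmetric] Let_def by simp
qed

text \<open>The normalized gradient is a competitor in the supremum. For nonnegative
  \<open>h\<close> this transfers the failure of the inequality from the intrinsic norm to the
  chart.\<close>

lemma norm_grad_le_differential_norm:
  fixes p :: 'a
  assumes f: "C2_fun \<Omega> f"
  defines "c \<equiv> chart_at \<Omega> p"
  defines "G \<equiv> metric_domain.grad (metric_in \<Omega> c) (f \<circ> cinv c) (cmap c p)"
  shows "sqrt (metric_in \<Omega> c (cmap c p) G G) \<le> differential_norm \<Omega> f p"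
proof -
  have c: "c \<in> atlas \<Omega>" "p \<in> cdom c" unfolding c_def by (rule chart_at)+
  interpret mc: metric_domain "cimg c" "metric_in \<Omega> c" by (rule metric_domain_chart[OF c(1)])
  let ?y = "cmap c p"
  have y: "?y \<in> cimg c" using c by blast
  interpret ip_form "metric_in \<Omega> c ?y" by (rule mc.ip_form_g[OF y])
  have F1: "Ck_on 1 (f \<circ> cinv c) (cimg c)" using f c(1) C2_on_imp_C1_on unfolding C2_fun_def by blast
  have df: "differential \<Omega> f p v = metric_in \<Omega> c ?y G v" for v
    unfolding G_def mc.g_grad[OF F1 y] by (simp add: differential_def Let_def c_def)
  have gn: "gnorm \<Omega> p v = sqrt (metric_in \<Omega> c ?y v v)" for v
    by (simp add: gnorm_def c_def metric_in_preferred)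
  have bd: "\<bar>differential \<Omega> f p v\<bar> \<le> sqrt (metric_in \<Omega> c ?y G G)" if "gnorm \<Omega> p v \<le> 1" for v
  proof -
    have "\<bar>differential \<Omega> f p v\<bar> \<le> sqrt (metric_in \<Omega> c ?y G G) * sqrt (metric_in \<Omega> c ?y v v)"
      unfolding df by (rule Cauchy_Schwarz)
    also have "\<dots> \<le> sqrt (metric_in \<Omega> c ?y G G)"
      using that unfolding gn by (intro mult_left_le) (auto simp: nonneg)
    finally show ?thesis .
  qed
  \<comment> \<open>A supremum of reals is informative only for bounded sets; Cauchy-Schwarz
    supplies the bound.\<close>
  have bdd: "bdd_above ((\<lambda>v. \<bar>differential \<Omega> f p v\<bar>) ` {v. gnorm \<Omega> p v \<le> 1})"
    using bd by (intro bdd_aboveI2) auto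
  define s where "s = sqrt (metric_in \<Omega> c ?y G G)"
  have s0: "0 \<le> s" by (simp add: s_def nonneg)
  have s2: "s * s = metric_in \<Omega> c ?y G G" by (simp add: s_def nonneg)
  define v where "v = (1 / s) *\<^sub>R G"
  have "gnorm \<Omega> p v \<le> 1 \<and> s \<le> \<bar>differential \<Omega> f p v\<bar>"
  proof (cases "s = 0")
    case True
    then show ?thesis by (simp add: gn v_def G_simps)
  next
    case False
    then have "metric_in \<Omega> c ?y v v = 1" "differential \<Omega> f p v = s"
      unfolding v_def df by (simp_all add: G_simps s2[symmetric])
    then show ?thesis by (simp add: gn)
  qed
  then have "s \<le> differential_norm \<Omega> f p"
    unfolding differential_norm_def by (intro cSUP_upper2[OF bdd, of v]) auto
  then show ?thesis by (simp add: s_def)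
qed

end

theorem theorem1p1:
  fixes \<Omega> :: "('a::{t2_space, second_countable_topology}, 'e::euclidean_space) riemannian_structure"
    and m :: nat and h :: real
    and M :: "nat \<Rightarrow> ('a \<times> 'e set) measure"
    and H :: "nat \<Rightarrow> 'a \<Rightarrow> 'e"
    and bdry :: "nat \<Rightarrow> 'a measure"
    and f :: "'a \<Rightarrow> real" and p :: 'a
  assumes "riemannian_manifold \<Omega>"
    and "0 \<le> h"
    and "\<And>i. varifold \<Omega> m (M i)"
    and "\<And>i. locally_bounded_first_variation \<Omega> (M i)"
    and "\<And>i. generalized_mean_curvature \<Omega> (M i) (H i)"
    and "\<And>i. boundary_measure \<Omega> (M i) (bdry i)"
    and "\<And>K. compact K \<Longrightarrow>
      limsup (\<lambda>i. \<integral>\<^sup>+ x\<in>K. ennreal (max (gnorm \<Omega> x (H i x) - h) 0) \<partial>weight (M i)) < \<infinity>"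
    and "\<And>K. compact K \<Longrightarrow> limsup (\<lambda>i. emeasure (bdry i) K) < \<infinity>"
    and "C2_fun \<Omega> f"
    and "p \<in> area_blowup_set \<Omega> M"
    and "eventually (\<lambda>q. f q \<le> f p) (at p within area_blowup_set \<Omega> M)"
  shows "Trace_lowest m (metric_at \<Omega> p) (hessian \<Omega> f p) \<le> h * differential_norm \<Omega> f p"
proof (rule ccontr)
  interpret riemannian \<Omega> by (unfold_locales) (rule assms(1))
  assume "\<not> Trace_lowest m (metric_at \<Omega> p) (hessian \<Omega> f p) \<le> h * differential_norm \<Omega> f p"
  then have neg: "h * differential_norm \<Omega> f p < Trace_lowest m (metric_at \<Omega> p) (hessian \<Omega> f p)" by simp
  let ?Z = "area_blowup_set \<Omega> M"
  define c where "c = chart_at \<Omega> p"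
  have c: "c \<in> atlas \<Omega>" "p \<in> cdom c" unfolding c_def by (rule chart_at)+
  interpret mc: metric_domain "cimg c" "metric_in \<Omega> c" by (rule metric_domain_chart[OF c(1)])
  define y0 where "y0 = cmap c p"
  define F where "F = f \<circ> cinv c"
  have F2: "Ck_on 2 F (cimg c)" using assms(9) c(1) unfolding C2_fun_def F_def by blast
  have Fy0: "F y0 = f p" by (simp add: F_def y0_def cinv_cmap[OF c])
  have metric: "metric_at \<Omega> p = metric_in \<Omega> c y0"
    by (intro ext) (simp add: c_def y0_def metric_in_preferred)
  have big: "h * sqrt (metric_in \<Omega> c y0 (mc.grad F y0) (mc.grad F y0)) < Trace_lowest m (metric_in \<Omega> c y0) (mc.hess F y0)"
  proof -
    have "h * sqrt (metric_in \<Omega> c y0 (mc.grad F y0) (mc.grad F y0)) \<le> h * differential_norm \<Omega> f p"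
      using norm_grad_le_differential_norm[OF assms(9), of p] assms(2)
      unfolding c_def[symmetric] y0_def[symmetric] F_def[symmetric] by (intro mult_left_mono)
    also have "\<dots> < Trace_lowest m (metric_in \<Omega> c y0) (mc.hess F y0)"
      using neg unfolding metric hessian_eq_hess[OF assms(9)] c_def[symmetric] y0_def[symmetric] F_def[symmetric] .
    finally show ?thesis .
  qed
  \<comment> \<open>The filter at \<open>p\<close> within the blow-up set omits \<open>p\<close>
    itself, where the bound is reflexivity.\<close>
  obtain U where U: "open U" "p \<in> U" "\<And>q. q \<in> U \<Longrightarrow> q \<in> ?Z \<Longrightarrow> f q \<le> f p"
    using assms(11) unfolding eventually_at_topological by (metis order_refl)
  have "open (cmap c ` (cdom c \<inter> U))" "y0 \<in> cmap c ` (cdom c \<inter> U)"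
    using open_cmap_image[OF c(1) U(1)] c U by (auto simp: y0_def)
  then obtain \<rho> where \<rho>: "\<rho> > 0" "cball y0 \<rho> \<subseteq> cmap c ` (cdom c \<inter> U)"
    by (metis open_contains_cball)
  have ballU: "cinv c y \<in> U" if y: "y \<in> cball y0 \<rho>" for y
  proof -
    obtain x where "x \<in> cdom c" "x \<in> U" "y = cmap c x" using y \<rho> by blast
    then show ?thesis using cinv_cmap[OF c(1)] by simp
  qed
  have ballV: "cball y0 \<rho> \<subseteq> cimg c" using \<rho> by blast
  have W: "open (ball y0 \<rho>)" "y0 \<in> ball y0 \<rho>" "ball y0 \<rho> \<subseteq> cimg c"
    using \<rho>(1) order_trans[OF ball_subset_cball ballV] by simp_all
  show False
  proof (rule mc.exists_test_vector_field[OF F2 W assms(2) big])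
    fix \<xi> K Q N C \<epsilon>
    assume \<xi>: "Ck_on 1 \<xi> (cimg c)" and K: "compact K" "K \<subseteq> ball y0 \<rho>" and \<xi>0: "\<And>y. y \<in> cimg c - K \<Longrightarrow> \<xi> y = 0"
      and Q: "compact Q" "Q \<subseteq> K" and QF: "\<And>y. y \<in> Q \<Longrightarrow> F y0 < F y"
      and N: "open N" "y0 \<in> N" "N \<subseteq> K" and \<epsilon>: "0 < \<epsilon>" and C: "0 \<le> C"
      and \<xi>le: "\<And>y. y \<in> cimg c \<Longrightarrow> sqrt (metric_in \<Omega> c y (\<xi> y) (\<xi> y)) \<le> 1"
      and lower: "\<And>y E. y \<in> cimg c \<Longrightarrow> ip_form.orthonormal (metric_in \<Omega> c y) E \<Longrightarrow> card E = m \<Longrightarrow>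
         h * sqrt (metric_in \<Omega> c y (\<xi> y) (\<xi> y)) + \<epsilon> * indicator N y - C * indicator Q y
           \<le> (\<Sum>e\<in>E. mc.lie_form \<xi> y e e)"
      and upper: "\<And>y E. y \<in> cimg c \<Longrightarrow> ip_form.orthonormal (metric_in \<Omega> c y) E \<Longrightarrow> card E = m \<Longrightarrow>
         \<bar>\<Sum>e\<in>E. mc.lie_form \<xi> y e e\<bar> \<le> C * indicator K y"
    have sub: "K \<subseteq> cimg c" "Q \<subseteq> cimg c" "N \<subseteq> cimg c"
      using order_trans[OF K(2) W(3)] Q(2) N(3) by blast+
    let ?\<mu> = "\<lambda>i. weight (M i)"
    let ?N = "cinv c ` N"
    have ineq: "ennreal \<epsilon> * emeasure (?\<mu> i) ?N \<le> ennreal C * emeasure (?\<mu> i) (cinv c ` Q)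
      + emeasure (bdry i) (cinv c ` cball y0 \<rho>)
      + (\<integral>\<^sup>+ x\<in>cinv c ` K. ennreal (max (gnorm \<Omega> x (H i x) - h) 0) \<partial>?\<mu> i)" for i
      by (rule first_variation_inequality[OF assms(3,5,6) c(1) ballV assms(2) \<xi> K \<xi>0 Q N(1,3) \<epsilon> C \<xi>le lower upper])
    \<comment> \<open>The points with coordinates in \<open>Q\<close> lie in \<open>U\<close>, where
      the local maximum forbids larger values of \<open>f\<close> on the blow-up set.\<close>
    have "f q \<le> f p" if "q \<in> cinv c ` Q" "q \<in> ?Z" for q
      using that U(3) ballU Q K by (auto simp: subset_iff)
    moreover have "f p < f q" if "q \<in> cinv c ` Q" for q
      using that QF by (auto simp: Fy0[symmetric] F_def)
    ultimately have disj: "cinv c ` Q \<inter> ?Z = {}" by (meson disjoint_iff leD)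
    obtain B1 where B1: "0 \<le> B1" "eventually (\<lambda>i. emeasure (?\<mu> i) (cinv c ` Q) \<le> ennreal B1) sequentially"
      using eventually_bounded_off_blowup[OF assms(3) compact_cinv_image[OF c(1) Q(1) sub(2)] disj] by blast
    obtain B2 where B2: "0 \<le> B2" "eventually (\<lambda>i. emeasure (bdry i) (cinv c ` cball y0 \<rho>) \<le> ennreal B2) sequentially"
      using eventually_bounded_of_limsup[OF assms(8)[OF compact_cinv_image[OF c(1) compact_cball ballV]]] by blast
    obtain B3 where B3: "0 \<le> B3" "eventually (\<lambda>i. (\<integral>\<^sup>+ x\<in>cinv c ` K. ennreal (max (gnorm \<Omega> x (H i x) - h) 0) \<partial>?\<mu> i) \<le> ennreal B3) sequentially"
      using eventually_bounded_of_limsup[OF assms(7)[OF compact_cinv_image[OF c(1) K(1) sub(1)]]] by blast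
    have No: "open ?N" by (rule open_cinv_image[OF c(1) N(1) sub(3)])
    have pN: "p \<in> ?N" by (rule image_eqI[of _ _ y0]) (use N(2) in \<open>simp_all add: y0_def cinv_cmap[OF c]\<close>)
    obtain r where r: "r > 0" "gball \<Omega> p r \<subseteq> ?N" using exists_gball_subset[OF No pN] by blast
    define B where "B = (C * B1 + B2 + B3) / \<epsilon>"
    have "eventually (\<lambda>i. emeasure (?\<mu> i) (gball \<Omega> p r) \<le> ennreal B) sequentially"
      using B1(2) B2(2) B3(2)
    proof eventually_elim
      case (elim i)
      have "ennreal \<epsilon> * emeasure (?\<mu> i) (gball \<Omega> p r) \<le> ennreal \<epsilon> * emeasure (?\<mu> i) ?N"
        using r(2) No by (intro mult_left_mono emeasure_mono) (auto simp: sets_weight[OF assms(3)])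
      also have "\<dots> \<le> ennreal C * emeasure (?\<mu> i) (cinv c ` Q)
        + emeasure (bdry i) (cinv c ` cball y0 \<rho>)
        + (\<integral>\<^sup>+ x\<in>cinv c ` K. ennreal (max (gnorm \<Omega> x (H i x) - h) 0) \<partial>?\<mu> i)" by (rule ineq)
      also have "\<dots> \<le> ennreal C * ennreal B1 + ennreal B2 + ennreal B3"
        by (intro add_mono mult_left_mono elim) simp
      also have "\<dots> = ennreal (C * B1 + B2 + B3)"
        using C B1(1) B2(1) B3(1) by (simp add: ennreal_mult ennreal_plus)
      also have "\<dots> = ennreal \<epsilon> * ennreal B"
        using \<epsilon> C B1(1) B2(1) B3(1) by (subst ennreal_mult[symmetric]) (auto simp: B_def)
      finally show "emeasure (?\<mu> i) (gball \<Omega> p r) \<le> ennreal B"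
        using \<epsilon> by (simp add: ennreal_mult_le_mult_iff)
    qed
    then have "limsup (\<lambda>i. emeasure (?\<mu> i) (gball \<Omega> p r)) \<le> ennreal B" by (rule Limsup_bounded)
    moreover have "limsup (\<lambda>i. emeasure (?\<mu> i) (gball \<Omega> p r)) = \<infinity>"
      using assms(10) r(1) unfolding area_blowup_set_def by blast
    ultimately show False by (simp add: top_unique)
  qed
qed


end
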